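(* Let $r\ge 1$ and $m\ge 3$ be integers and let $V$ be a complex vector space of dimension $rm$. Then, identifying the diagonal $\Delta\subset \mathbb P(\wedge^r V)^m$ with $\mathbb P(\wedge^r V)$, $$\mathbb G=\{\,o\in \Delta\cap \mathrm{Sing}_{m-1}(\mathbb D_{r,m})\ \mid\ \dim T_{\mathrm{Sing}_{m-1}(\mathbb D_{r,m}),\,o}\ \text{is maximal}\,\},$$ where "maximal" means maximal among all points $o\in\Delta\cap \mathrm{Sing}_{m-1}(\mathbb D_{r,m})$.
   Context: $\mathbb P(W)$ denotes the projective space of one-dimensional subspaces of $W$. $\mathbb G\subset \mathbb P(\wedge^r V)$ is the Plücker embedding of the Grassmannian $G(r,V)$ of $r$-dimensional subspaces of $V$. The Plücker form $\mathbb D_{r,m}\subset \mathbb P(\wedge^r V)^m$ is the divisor of multidegree $(1,\dots,1)$ defined by the vanishing of the multilinear form $$d_{r,m}:(\wedge^r V)^m\to \wedge^{rm}V\cong\mathbb C,\qquad d_{r,m}(w_1,\dots,w_m)=w_1\wedge\dots\wedge w_m .$$ $\Delta=\{(x,\dots,x)\}\subset\mathbb P(\wedge^r V)^m$ is the (small) diagonal. For a divisor $D$ on a smooth variety, $\mathrm{Sing}_k(D)$ is the locus of points at which $D$ has multiplicity $\ge k$, with the scheme structure given locally by the vanishing of all partial derivatives of order $\le k-1$ of a local equation of $D$; $T_{\mathrm{Sing}_k(D),o}$ is its Zariski tangent space at $o$. *)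

theory Defs
  imports "HOL-Analysis.Analysis" "HOL-Library.Function_Algebras"
begin

section \<open>Spaces of complex-valued functions\<close>

definition fscale :: "complex \<Rightarrow> ('a \<Rightarrow> complex) \<Rightarrow> 'a \<Rightarrow> complex" where
  "fscale c f = (\<lambda>x. c * f x)"

interpretation cfun: vector_space "fscale :: complex \<Rightarrow> ('a \<Rightarrow> complex) \<Rightarrow> 'a \<Rightarrow> complex"
  by unfold_locales (auto simp: fscale_def fun_eq_iff algebra_simps)

definition coord_space :: "'a set \<Rightarrow> ('a \<Rightarrow> complex) set" where
  "coord_space B = {w. \<forall>S. S \<notin> B \<longrightarrow> w S = 0}"


section \<open>Exterior powers of a vector space with an ordered basis\<close>

text \<open>
  Let \<open>b\<close> be an ordered basis, of length \<open>n\<close>, of the complex vector space \<open>V\<close> (a type with scalar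
  multiplication \<open>scal\<close>).  An element of the exterior algebra of \<open>V\<close> is given by its coordinates
  with respect to the induced basis \<open>b\<^sub>S = b ! i\<^sub>1 \<and> \<dots> \<and> b ! i\<^sub>k\<close>, where
  \<open>S = {i\<^sub>1 < \<dots> < i\<^sub>k}\<close> runs through the subsets of \<open>{..<n}\<close>, i.e. by a function
  \<open>nat set \<Rightarrow> complex\<close>.
\<close>

definition ordered_basis :: "(complex \<Rightarrow> 'v::ab_group_add \<Rightarrow> 'v) \<Rightarrow> 'v list \<Rightarrow> bool" where
  "ordered_basis scal b \<longleftrightarrow>
     distinct b \<and> \<not> module.dependent scal (set b) \<and> module.span scal (set b) = UNIV"

definition ext_index :: "nat \<Rightarrow> nat \<Rightarrow> nat set set" where
  "ext_index n k = {S. S \<subseteq> {..<n} \<and> card S = k}"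

definition ext_power :: "nat \<Rightarrow> nat \<Rightarrow> (nat set \<Rightarrow> complex) set" where
  "ext_power n k = coord_space (ext_index n k)"

text \<open>
  For disjoint \<open>S\<close>, \<open>T\<close> one has \<open>b\<^sub>S \<and> b\<^sub>T = shuffle_sign S T \<cdot> b\<^bsub>S \<union> T\<^esub>\<close>, and
  \<open>b\<^sub>S \<and> b\<^sub>T = 0\<close> if \<open>S\<close> and \<open>T\<close> meet.
\<close>

definition shuffle_sign :: "nat set \<Rightarrow> nat set \<Rightarrow> complex" where
  "shuffle_sign S T = (- 1) ^ card {(i, j). i \<in> S \<and> j \<in> T \<and> j < i}"

definition wedge :: "(nat set \<Rightarrow> complex) \<Rightarrow> (nat set \<Rightarrow> complex) \<Rightarrow> nat set \<Rightarrow> complex" where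
  "wedge x y = (\<lambda>K. \<Sum>S\<in>Pow K. shuffle_sign S (K - S) * x S * y (K - S))"

definition ext_one :: "nat set \<Rightarrow> complex" where
  "ext_one = (\<lambda>K. if K = {} then 1 else 0)"

definition wedge_list :: "(nat set \<Rightarrow> complex) list \<Rightarrow> nat set \<Rightarrow> complex" where
  "wedge_list xs = foldr wedge xs ext_one"

definition ext_vec ::
  "(complex \<Rightarrow> 'v::ab_group_add \<Rightarrow> 'v) \<Rightarrow> 'v list \<Rightarrow> 'v \<Rightarrow> nat set \<Rightarrow> complex" where
  "ext_vec scal b v =
     (\<lambda>S. \<Sum>i<length b. if S = {i} then module.representation scal (set b) v (b ! i) else 0)"


section \<open>Projective space and the Grassmannian\<close>

definition proj_space :: "('a \<Rightarrow> complex) set \<Rightarrow> ('a \<Rightarrow> complex) set set" where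
  "proj_space W = {L. L \<subseteq> W \<and> cfun.subspace L \<and> cfun.dim L = 1}"

definition grassmannian ::
  "(complex \<Rightarrow> 'v::ab_group_add \<Rightarrow> 'v) \<Rightarrow> nat \<Rightarrow> 'v set set" where
  "grassmannian scal r = {U. module.subspace scal U \<and> vector_space.dim scal U = r}"

text \<open>The Pluecker embedding sends \<open>U\<close> to the line \<open>\<Lambda>\<^sup>r U \<subseteq> \<Lambda>\<^sup>r V\<close>.\<close>

definition plucker ::
  "(complex \<Rightarrow> 'v::ab_group_add \<Rightarrow> 'v) \<Rightarrow> 'v list \<Rightarrow> nat \<Rightarrow> 'v set \<Rightarrow> (nat set \<Rightarrow> complex) set" where
  "plucker scal b r U =
     cfun.span {wedge_list (map (ext_vec scal b) us) |us. length us = r \<and> set us \<subseteq> U}"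


section \<open>Subschemes of affine space and their Zariski tangent spaces\<close>

text \<open>
  The affine space with finite index set \<open>I\<close> of coordinates is \<open>coord_space I\<close>; its coordinate ring
  is the ring of polynomial functions in the coordinates \<open>a p\<close>, \<open>p \<in> I\<close>.
\<close>

inductive_set poly_fun :: "'i set \<Rightarrow> (('i \<Rightarrow> complex) \<Rightarrow> complex) set" for I :: "'i set" where
  const: "(\<lambda>a. c) \<in> poly_fun I"
| coord: "p \<in> I \<Longrightarrow> (\<lambda>a. a p) \<in> poly_fun I"
| add: "g \<in> poly_fun I \<Longrightarrow> h \<in> poly_fun I \<Longrightarrow> g + h \<in> poly_fun I"
| mult: "g \<in> poly_fun I \<Longrightarrow> h \<in> poly_fun I \<Longrightarrow> g * h \<in> poly_fun I"

definition gen_ideal ::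
  "'i set \<Rightarrow> (('i \<Rightarrow> complex) \<Rightarrow> complex) set \<Rightarrow> (('i \<Rightarrow> complex) \<Rightarrow> complex) set" where
  "gen_ideal I G =
     {\<Sum>g\<in>A. h g * g |A h. finite A \<and> A \<subseteq> G \<and> (\<forall>g\<in>A. h g \<in> poly_fun I)}"

definition point_ideal ::
  "'i set \<Rightarrow> ('i \<Rightarrow> complex) \<Rightarrow> (('i \<Rightarrow> complex) \<Rightarrow> complex) set" where
  "point_ideal I a = {g \<in> poly_fun I. g a = 0}"

text \<open>
  The Zariski tangent space at \<open>a\<close> of the closed subscheme with ideal \<open>J\<close> is the dual of
  \<open>M / (M\<^sup>2 + J)\<close>, where \<open>M\<close> is the maximal ideal of \<open>a\<close>: this is the cotangent space
  of the local ring at \<open>a\<close> of the subscheme.  A functional on it is represented by a functional on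
  \<open>M\<close> killing \<open>M\<^sup>2\<close> and \<open>J\<close>, extended by zero outside \<open>M\<close>.
\<close>

definition zariski_tangent ::
  "'i set \<Rightarrow> (('i \<Rightarrow> complex) \<Rightarrow> complex) set \<Rightarrow> ('i \<Rightarrow> complex) \<Rightarrow>
   ((('i \<Rightarrow> complex) \<Rightarrow> complex) \<Rightarrow> complex) set" where
  "zariski_tangent I J a =
     {\<phi>. (\<forall>g\<in>point_ideal I a. \<forall>h\<in>point_ideal I a. \<phi> (g + h) = \<phi> g + \<phi> h) \<and>
         (\<forall>c. \<forall>g\<in>point_ideal I a. \<phi> (fscale c g) = c * \<phi> g) \<and>
         (\<forall>g\<in>point_ideal I a. \<forall>h\<in>point_ideal I a. \<phi> (g * h) = 0) \<and>
         (\<forall>g\<in>J. \<phi> g = 0) \<and>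
         (\<forall>g. g \<notin> point_ideal I a \<longrightarrow> \<phi> g = 0)}"

definition partial :: "'i \<Rightarrow> (('i \<Rightarrow> complex) \<Rightarrow> complex) \<Rightarrow> ('i \<Rightarrow> complex) \<Rightarrow> complex" where
  "partial p f = (\<lambda>a. deriv (\<lambda>t. f (a(p := t))) (a p))"

definition partials_below ::
  "'i set \<Rightarrow> nat \<Rightarrow> (('i \<Rightarrow> complex) \<Rightarrow> complex) \<Rightarrow> (('i \<Rightarrow> complex) \<Rightarrow> complex) set" where
  "partials_below I k f = {fold partial ps f |ps. set ps \<subseteq> I \<and> length ps < k}"


section \<open>Divisors in a power of a projective space and their singular loci\<close>

text \<open>
  A divisor in \<open>\<P>(W)\<^sup>m\<close>, for \<open>W = coord_space B\<close>, is given by a multihomogeneous form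
  \<open>F w\<close> in the \<open>m\<close> vectors \<open>w 0, \<dots>, w (m - 1)\<close> of \<open>W\<close>.  Points of
  \<open>\<P>(W)\<^sup>m\<close> are extensional functions on \<open>{..<m}\<close>.

  The standard chart belonging to \<open>\<sigma>\<close> consists of the points whose \<open>i\<close>-th component has nonzero
  homogeneous coordinate at \<open>\<sigma> i\<close>.  It is an affine space with coordinates \<open>a (i, S)\<close> for
  \<open>i < m\<close> and \<open>S \<in> B - {\<sigma> i}\<close>, and \<open>F\<close> with the coordinates \<open>\<sigma> i\<close> set to \<open>1\<close> is a local
  equation of the divisor.
\<close>

definition multi_proj :: "nat \<Rightarrow> 'b set \<Rightarrow> (nat \<Rightarrow> ('b \<Rightarrow> complex) set) set" where
  "multi_proj m B = {..<m} \<rightarrow>\<^sub>E proj_space (coord_space B)"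

definition diag_point :: "nat \<Rightarrow> ('b \<Rightarrow> complex) set \<Rightarrow> nat \<Rightarrow> ('b \<Rightarrow> complex) set" where
  "diag_point m x = (\<lambda>i\<in>{..<m}. x)"

definition chart_index :: "nat \<Rightarrow> 'b set \<Rightarrow> (nat \<Rightarrow> 'b) \<Rightarrow> (nat \<times> 'b) set" where
  "chart_index m B \<sigma> = {(i, S). i < m \<and> S \<in> B \<and> S \<noteq> \<sigma> i}"

definition chart_vec ::
  "'b set \<Rightarrow> (nat \<Rightarrow> 'b) \<Rightarrow> (nat \<times> 'b \<Rightarrow> complex) \<Rightarrow> nat \<Rightarrow> 'b \<Rightarrow> complex" where
  "chart_vec B \<sigma> a i = (\<lambda>S. if S = \<sigma> i then 1 else if S \<in> B then a (i, S) else 0)"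

definition chart_point ::
  "nat \<Rightarrow> 'b set \<Rightarrow> (nat \<Rightarrow> 'b) \<Rightarrow> (nat \<times> 'b \<Rightarrow> complex) \<Rightarrow> nat \<Rightarrow> ('b \<Rightarrow> complex) set" where
  "chart_point m B \<sigma> a = (\<lambda>i\<in>{..<m}. cfun.span {chart_vec B \<sigma> a i})"

definition in_chart ::
  "nat \<Rightarrow> 'b set \<Rightarrow> (nat \<Rightarrow> 'b) \<Rightarrow> (nat \<times> 'b \<Rightarrow> complex) \<Rightarrow>
   (nat \<Rightarrow> ('b \<Rightarrow> complex) set) \<Rightarrow> bool" where
  "in_chart m B \<sigma> a x \<longleftrightarrow>
     (\<forall>i<m. \<sigma> i \<in> B) \<and> a \<in> coord_space (chart_index m B \<sigma>) \<and> x = chart_point m B \<sigma> a"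

definition local_eq ::
  "'b set \<Rightarrow> ((nat \<Rightarrow> 'b \<Rightarrow> complex) \<Rightarrow> complex) \<Rightarrow> (nat \<Rightarrow> 'b) \<Rightarrow>
   (nat \<times> 'b \<Rightarrow> complex) \<Rightarrow> complex" where
  "local_eq B F \<sigma> = (\<lambda>a. F (chart_vec B \<sigma> a))"

definition sing_ideal ::
  "nat \<Rightarrow> 'b set \<Rightarrow> ((nat \<Rightarrow> 'b \<Rightarrow> complex) \<Rightarrow> complex) \<Rightarrow> nat \<Rightarrow> (nat \<Rightarrow> 'b) \<Rightarrow>
   ((nat \<times> 'b \<Rightarrow> complex) \<Rightarrow> complex) set" where
  "sing_ideal m B F k \<sigma> =
     gen_ideal (chart_index m B \<sigma>) (partials_below (chart_index m B \<sigma>) k (local_eq B F \<sigma>))"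

definition Sing ::
  "nat \<Rightarrow> 'b set \<Rightarrow> ((nat \<Rightarrow> 'b \<Rightarrow> complex) \<Rightarrow> complex) \<Rightarrow> nat \<Rightarrow>
   (nat \<Rightarrow> ('b \<Rightarrow> complex) set) set" where
  "Sing m B F k =
     {x \<in> multi_proj m B. \<exists>\<sigma> a. in_chart m B \<sigma> a x \<and> (\<forall>g\<in>sing_ideal m B F k \<sigma>. g a = 0)}"

text \<open>The dimension below does not depend on the chart, so that the description is meaningful.\<close>

definition sing_tangent_dim ::
  "nat \<Rightarrow> 'b set \<Rightarrow> ((nat \<Rightarrow> 'b \<Rightarrow> complex) \<Rightarrow> complex) \<Rightarrow> nat \<Rightarrow>
   (nat \<Rightarrow> ('b \<Rightarrow> complex) set) \<Rightarrow> nat" where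
  "sing_tangent_dim m B F k x =
     (THE d. \<exists>\<sigma> a. in_chart m B \<sigma> a x \<and>
        d = cfun.dim (zariski_tangent (chart_index m B \<sigma>) (sing_ideal m B F k \<sigma>) a))"


section \<open>The Pluecker form\<close>

text \<open>The line \<open>\<Lambda>\<^sup>n V\<close> is identified with the complex numbers via its basis vector
  \<open>b\<^bsub>{..<n}\<^esub>\<close>.\<close>

definition plucker_form :: "nat \<Rightarrow> nat \<Rightarrow> (nat \<Rightarrow> nat set \<Rightarrow> complex) \<Rightarrow> complex" where
  "plucker_form n m w = wedge_list (map w [0..<m]) {..<n}"

end

theory Submission
  imports Defs
begin

text \<open>
  Put \<open>W = \<Lambda>\<^sup>r V\<close> and \<open>n = r m\<close>, and let \<open>K\<close> be the kernel of \<open>w \<and> _\<close> on \<open>W\<close>.  In a chart the local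
  equation of the divisor is affine in each of the \<open>m\<close> slots, so its partial derivatives are
  obtained by putting basis vectors into slots.  Hence the diagonal point of \<open>w\<close> has multiplicity
  at least \<open>m - 1\<close> iff \<open>w \<and> w = 0\<close>, and \<open>(v\<^sub>0, \<dots>, v\<^bsub>m-1\<^esub>)\<close>, taken modulo \<open>w\<close>, is then a tangent
  vector iff \<open>w \<and> v\<^sub>i + (-1)\<^sup>r w \<and> v\<^sub>j = 0\<close> for all \<open>i < j\<close>.  As \<open>m \<ge> 3\<close>, this says that all \<open>v\<^sub>i\<close> lie
  in \<open>K\<close> if \<open>r\<close> is even and that all differences \<open>v\<^sub>i - v\<^sub>j\<close> do if \<open>r\<close> is odd.  In both cases the
  dimension of the tangent space is a strictly increasing function of \<open>dim K\<close>.

  If \<open>w\<^sub>S \<noteq> 0\<close>, then no nonzero element of \<open>K\<close> is supported on the index sets disjoint from \<open>S\<close>, so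
  \<open>dim K \<le> (n choose r) - (n - r choose r)\<close>.  Equality forces \<open>w \<and> f\<^sub>s = 0\<close> for suitable vectors \<open>f\<^sub>s\<close>
  of the form \<open>e\<^sub>s\<close> plus a combination of the \<open>e\<^sub>t\<close> with \<open>t \<notin> S\<close>, where \<open>s\<close> runs through \<open>S\<close>; then
  \<open>w\<close> is a multiple of their product.  The converse is an elimination of the \<open>e\<^sub>s\<close>.
\<close>

section \<open>The exterior algebra in coordinates\<close>

text \<open>A chart only sees the directions \<open>basis_fun S\<close> with
  \<open>S \<noteq> \<sigma> i\<close>. The vector of the point has coordinate 1 at
  \<open>\<sigma> i\<close>, so it completes these directions to a basis of the slot, and a slot
  filled with it counts as undifferentiated. Hence arbitrary vectors may be inserted and the
  conditions no longer depend on the chart. They concern two slots with all others free, and become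
  equations in the exterior algebra because products of m - 2 elements of W span the degree that is
  dual to degree 2 r.

  The hypothesis m \<ge> 3 enters twice. For even r, three slots are needed to force every v_i into
  K. And n \<ge> 3 r leaves room for r - 1 indices outside two sets of sizes r and r + 1, which is
  how w \<and> f_s = 0 is recovered from products of degree 2 r.

  The bound on dim K is attained inside the singular locus, since nonzero products of r vectors
  exist and satisfy w \<and> w = 0. Conversely w \<and> w = 0 puts w into K, so that dim K \<ge> 1;
  this is what makes the tangent dimension strictly increasing.\<close>

lemma sum_fun_apply: "(\<Sum>i\<in>A. f i) x = (\<Sum>i\<in>A. f i x)"
  by (induction A rule: infinite_finite_induct) auto

text \<open>One definition serves both as the basis multivector of an index set and as a coordinate
  direction in a slot of a chart.\<close>

definition basis_fun :: "'a \<Rightarrow> 'a \<Rightarrow> complex" where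
  "basis_fun p = (\<lambda>q. if q = p then 1 else 0)"

lemma wedge_add_left: "wedge (x + y) z = wedge x z + wedge y z"
  by (auto simp: wedge_def fun_eq_iff algebra_simps sum.distrib)

lemma wedge_add_right: "wedge x (y + z) = wedge x y + wedge x z"
  by (auto simp: wedge_def fun_eq_iff algebra_simps sum.distrib)

lemma wedge_scale_left: "wedge (fscale c x) y = fscale c (wedge x y)"
  by (auto simp: wedge_def fscale_def fun_eq_iff sum_distrib_left algebra_simps intro!: sum.cong)

lemma wedge_scale_right: "wedge x (fscale c y) = fscale c (wedge x y)"
  by (auto simp: wedge_def fscale_def fun_eq_iff sum_distrib_left algebra_simps intro!: sum.cong)

lemma wedge_zero_left [simp]: "wedge 0 y = 0"
  by (auto simp: wedge_def fun_eq_iff)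

lemma wedge_zero_right [simp]: "wedge y 0 = 0"
  by (auto simp: wedge_def fun_eq_iff)

lemma wedge_diff_left: "wedge (x - y) z = wedge x z - wedge y z"
  by (auto simp: wedge_def fun_eq_iff algebra_simps sum_subtractf)

lemma wedge_diff_right: "wedge x (y - z) = wedge x y - wedge x z"
  by (auto simp: wedge_def fun_eq_iff algebra_simps sum_subtractf)

section \<open>Shuffle signs as parities of inversion counts\<close>

lemma shuffle_sign_Un_left:
  assumes "finite S" "finite S'" "finite T" "S \<inter> S' = {}"
  shows "shuffle_sign (S \<union> S') T = shuffle_sign S T * shuffle_sign S' T"
proof -
  have f: "finite {(i, j). i \<in> A \<and> j \<in> T \<and> j < i}" if "finite A" for A
    by (rule finite_subset[of _ "A \<times> T"]) (use that assms in auto)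
  have "{(i, j). i \<in> S \<union> S' \<and> j \<in> T \<and> j < i} =
      {(i, j). i \<in> S \<and> j \<in> T \<and> j < i} \<union> {(i, j). i \<in> S' \<and> j \<in> T \<and> j < i}" by auto
  then have "card {(i, j). i \<in> S \<union> S' \<and> j \<in> T \<and> j < i} =
      card {(i, j). i \<in> S \<and> j \<in> T \<and> j < i} + card {(i, j). i \<in> S' \<and> j \<in> T \<and> j < i}"
    using assms by (auto intro!: card_Un_disjoint f)
  then show ?thesis by (simp add: shuffle_sign_def power_add)
qed

lemma shuffle_sign_Un_right:
  assumes "finite S" "finite T" "finite T'" "T \<inter> T' = {}"
  shows "shuffle_sign S (T \<union> T') = shuffle_sign S T * shuffle_sign S T'"
proof -
  have f: "finite {(i, j). i \<in> S \<and> j \<in> A \<and> j < i}" if "finite A" for A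
    by (rule finite_subset[of _ "S \<times> A"]) (use that assms in auto)
  have "{(i, j). i \<in> S \<and> j \<in> T \<union> T' \<and> j < i} =
      {(i, j). i \<in> S \<and> j \<in> T \<and> j < i} \<union> {(i, j). i \<in> S \<and> j \<in> T' \<and> j < i}" by auto
  then have "card {(i, j). i \<in> S \<and> j \<in> T \<union> T' \<and> j < i} =
      card {(i, j). i \<in> S \<and> j \<in> T \<and> j < i} + card {(i, j). i \<in> S \<and> j \<in> T' \<and> j < i}"
    using assms by (auto intro!: card_Un_disjoint f)
  then show ?thesis by (simp add: shuffle_sign_def power_add)
qed

lemma shuffle_sign_empty [simp]: "shuffle_sign {} T = 1" "shuffle_sign S {} = 1"
  by (simp_all add: shuffle_sign_def)

lemma shuffle_sign_nonzero [simp]: "shuffle_sign S T \<noteq> 0"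
  by (simp add: shuffle_sign_def)

text \<open>A pair in \<open>S \<times> T\<close> has distinct entries, so it is an inversion for
  exactly one of the two orders; the two inversion counts add up to the size of the product.\<close>

lemma shuffle_sign_swap:
  assumes "finite S" "finite T" "S \<inter> T = {}"
  shows "shuffle_sign S T = (-1) ^ (card S * card T) * shuffle_sign T S"
proof -
  let ?A = "{(i, j). i \<in> S \<and> j \<in> T \<and> j < i}" and ?B = "{(i, j). i \<in> T \<and> j \<in> S \<and> j < i}"
  have fA: "finite ?A" by (rule finite_subset[of _ "S \<times> T"]) (use assms in auto)
  have fB: "finite ?B" by (rule finite_subset[of _ "T \<times> S"]) (use assms in auto)
  have "S \<times> T = ?A \<union> prod.swap ` ?B"
    using assms(3) by (auto simp: image_iff)
  moreover have "?A \<inter> prod.swap ` ?B = {}" by auto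
  ultimately have "card (S \<times> T) = card ?A + card (prod.swap ` ?B)"
    using card_Un_disjoint[OF fA finite_imageI[OF fB, of prod.swap]] by (simp only:)
  then have "card S * card T = card ?A + card (prod.swap ` ?B)"
    by (simp only: card_cartesian_product)
  also have "card (prod.swap ` ?B) = card ?B" by (intro card_image) auto
  \<comment> \<open>Adding \<open>card ?B\<close> once more makes it occur twice, so that it drops
    out of the parity.\<close>
  finally have "card S * card T + card ?B = card ?A + 2 * card ?B" by simp
  then have "(-1 :: complex) ^ (card S * card T + card ?B) = (-1) ^ card ?A"
    by (simp add: power_add power_mult)
  then show ?thesis by (simp add: shuffle_sign_def power_add)
qed

lemma wedge_infinite: "infinite K \<Longrightarrow> wedge x y K = 0"
  by (simp add: wedge_def)

text \<open>Both sides are sums over ordered partitions of \<open>K\<close> into three blocks, and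
  both signs factor into the three pairwise signs of the blocks. At infinite \<open>K\<close> both
  sides are zero, since a sum over the infinite set \<open>Pow K\<close> is zero by
  convention.\<close>

lemma wedge_assoc: "wedge (wedge x y) z = wedge x (wedge y z)"
proof
  fix K :: "nat set"
  show "wedge (wedge x y) z K = wedge x (wedge y z) K"
  proof (cases "finite K")
    case True
    have "wedge (wedge x y) z K = (\<Sum>S\<in>Pow K. \<Sum>R\<in>Pow S.
        shuffle_sign S (K - S) * shuffle_sign R (S - R) * x R * y (S - R) * z (K - S))"
      by (simp add: wedge_def sum_distrib_left sum_distrib_right algebra_simps)
    also have "\<dots> = (\<Sum>(S, R)\<in>Sigma (Pow K) Pow.
        shuffle_sign S (K - S) * shuffle_sign R (S - R) * x R * y (S - R) * z (K - S))"
      by (rule sum.Sigma) (use True in \<open>auto intro: finite_subset\<close>)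
    also have "\<dots> = (\<Sum>(R, T)\<in>Sigma (Pow K) (\<lambda>R. Pow (K - R)).
        shuffle_sign R (K - R) * x R * (shuffle_sign T (K - R - T) * y T * z (K - R - T)))"
    \<comment> \<open>\<open>R\<close> is the first block and \<open>S - R\<close> the second; the
      third is the complement of \<open>S\<close> in \<open>K\<close>.\<close>
    proof (rule sum.reindex_bij_witness[of _ "\<lambda>(R, T). (R \<union> T, R)" "\<lambda>(S, R). (R, S - R)"])
      fix p assume "p \<in> Sigma (Pow K) Pow"
      then obtain S R where p: "p = (S, R)" and SR: "S \<subseteq> K" "R \<subseteq> S" by auto
      have fin: "finite S" "finite R" "finite (K - S)" "finite (S - R)"
        using True SR by (auto intro: finite_subset)
      have e: "K - R - (S - R) = K - S" using SR by auto
      have "K - R = (S - R) \<union> (K - S)" using SR by auto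
      then have "shuffle_sign R (K - R) = shuffle_sign R ((S - R) \<union> (K - S))" by (rule arg_cong)
      also have "\<dots> = shuffle_sign R (S - R) * shuffle_sign R (K - S)"
        using fin by (intro shuffle_sign_Un_right) auto
      finally have 1: "shuffle_sign R (K - R) = shuffle_sign R (S - R) * shuffle_sign R (K - S)" .
      have "S = R \<union> (S - R)" using SR by auto
      then have "shuffle_sign S (K - S) = shuffle_sign (R \<union> (S - R)) (K - S)"
        by (rule arg_cong)
      also have "\<dots> = shuffle_sign R (K - S) * shuffle_sign (S - R) (K - S)"
        using fin by (intro shuffle_sign_Un_left) auto
      finally have 2: "shuffle_sign S (K - S) = shuffle_sign R (K - S) * shuffle_sign (S - R) (K - S)" .
      show "(case case p of (S, R) \<Rightarrow> (R, S - R) of (R, T) \<Rightarrow> shuffle_sign R (K - R) * x R *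
            (shuffle_sign T (K - R - T) * y T * z (K - R - T))) =
          (case p of (S, R) \<Rightarrow>
            shuffle_sign S (K - S) * shuffle_sign R (S - R) * x R * y (S - R) * z (K - S))"
        unfolding p prod.case e 1 2 by (simp add: algebra_simps)
    qed (clarsimp, blast)+
    also have "\<dots> = (\<Sum>R\<in>Pow K. \<Sum>T\<in>Pow (K - R).
        shuffle_sign R (K - R) * x R * (shuffle_sign T (K - R - T) * y T * z (K - R - T)))"
      by (rule sum.Sigma[symmetric]) (use True in auto)
    also have "\<dots> = wedge x (wedge y z) K"
      by (simp add: wedge_def sum_distrib_left)
    finally show ?thesis .
  qed (simp add: wedge_infinite)
qed

lemma ext_power_nonzeroD:
  assumes "x \<in> ext_power n p" "x S \<noteq> 0" shows "S \<subseteq> {..<n}" "card S = p" "finite S"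
proof -
  show "S \<subseteq> {..<n}" "card S = p"
    using assms by (auto simp: ext_power_def coord_space_def ext_index_def)
  then show "finite S" by (auto intro: finite_subset)
qed

lemma ext_powerI: "(\<And>S. x S \<noteq> 0 \<Longrightarrow> S \<subseteq> {..<n} \<and> card S = p) \<Longrightarrow> x \<in> ext_power n p"
  by (auto simp: ext_power_def coord_space_def ext_index_def)

text \<open>Taking complements exchanges the two factors. The sign is the same for all summands
  because a summand can be nonzero only if its two blocks have sizes \<open>p\<close> and
  \<open>q\<close>.\<close>

lemma wedge_commute:
  assumes "x \<in> ext_power n p" "y \<in> ext_power n q"
  shows "wedge x y = fscale ((-1) ^ (p * q)) (wedge y x)"
proof
  fix K
  show "wedge x y K = fscale ((-1) ^ (p * q)) (wedge y x) K"
  proof (cases "finite K")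
    case True
    have "wedge x y K = (\<Sum>S\<in>Pow K. shuffle_sign (K - S) S * x (K - S) * y S)"
      unfolding wedge_def
      by (rule sum.reindex_bij_witness[of _ "\<lambda>S. K - S" "\<lambda>S. K - S"])
        (auto simp: double_diff)
    also have "\<dots> = (\<Sum>S\<in>Pow K. (-1) ^ (p * q) * (shuffle_sign S (K - S) * y S * x (K - S)))"
    proof (rule sum.cong, simp)
      fix S assume S: "S \<in> Pow K"
      show "shuffle_sign (K - S) S * x (K - S) * y S =
          (-1) ^ (p * q) * (shuffle_sign S (K - S) * y S * x (K - S))"
      proof (cases "x (K - S) = 0 \<or> y S = 0")
        case False
        then show ?thesis
          using shuffle_sign_swap[of "K - S" S] ext_power_nonzeroD[OF assms(1)]
            ext_power_nonzeroD[OF assms(2)]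
          by auto
      qed auto
    qed
    finally show ?thesis by (simp add: wedge_def fscale_def sum_distrib_left)
  qed (simp add: wedge_infinite fscale_def)
qed

lemma wedge_in_ext_power:
  assumes "x \<in> ext_power n p" "y \<in> ext_power n q"
  shows "wedge x y \<in> ext_power n (p + q)"
proof (rule ext_powerI)
  fix K assume K: "wedge x y K \<noteq> 0"
  then have "finite K" using wedge_infinite by blast
  obtain S where S: "S \<subseteq> K" "x S \<noteq> 0" "y (K - S) \<noteq> 0"
  proof (rule ccontr)
    assume "\<not> thesis"
    then have "\<forall>S\<in>Pow K. shuffle_sign S (K - S) * x S * y (K - S) = 0" using that by auto
    then have "wedge x y K = 0" unfolding wedge_def by (rule sum.neutral)
    then show False using K by simp
  qed
  have "K = S \<union> (K - S)" using S by auto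
  moreover have "card (S \<union> (K - S)) = p + q"
    using S ext_power_nonzeroD[OF assms(1)] ext_power_nonzeroD[OF assms(2)]
    by (subst card_Un_disjoint) auto
  ultimately show "K \<subseteq> {..<n} \<and> card K = p + q"
    using S ext_power_nonzeroD[OF assms(1)] ext_power_nonzeroD[OF assms(2)]
    by (metis Un_least)
qed

lemma wedge_self_vector:
  assumes "f \<in> ext_power n 1" shows "wedge f f = 0"
  using wedge_commute[OF assms assms] by (auto simp: fscale_def fun_eq_iff)

lemma ext_one_in_ext_power: "ext_one \<in> ext_power n 0"
  by (rule ext_powerI) (auto simp: ext_one_def split: if_splits)

lemma wedge_list_Nil [simp]: "wedge_list [] = ext_one"
  by (simp add: wedge_list_def)

lemma wedge_list_Cons [simp]: "wedge_list (x # xs) = wedge x (wedge_list xs)"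
  by (simp add: wedge_list_def)

lemma wedge_list_in_ext_power:
  "set xs \<subseteq> ext_power n p \<Longrightarrow> wedge_list xs \<in> ext_power n (p * length xs)"
  by (induction xs) (auto simp: ext_one_in_ext_power intro: wedge_in_ext_power)

lemma wedge_ext_one_left:
  assumes "x \<in> ext_power n p" shows "wedge ext_one x = x"
proof
  fix K
  show "wedge ext_one x K = x K"
  proof (cases "finite K")
    case True
    have "wedge ext_one x K = (\<Sum>S\<in>Pow K. if S = {} then x K else 0)"
      unfolding wedge_def by (intro sum.cong) (auto simp: ext_one_def)
    then show ?thesis using True by simp
  next
    case False
    then show ?thesis using wedge_infinite ext_power_nonzeroD(3)[OF assms] by auto
  qed
qed

text \<open>Homogeneity of \<open>ys\<close> matters in the base case: \<open>wedge\<close> always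
  vanishes at infinite sets, so \<open>ext_one\<close> is neutral only on functions that do so as
  well.\<close>

lemma wedge_list_append:
  assumes "set ys \<subseteq> ext_power n p"
  shows "wedge_list (xs @ ys) = wedge (wedge_list xs) (wedge_list ys)"
  using wedge_ext_one_left[OF wedge_list_in_ext_power[OF assms]]
  by (induction xs) (simp_all add: wedge_assoc)

text \<open>Multiplying by a basis multivector relabels coefficients up to sign. It serves as a
  probe: a nonzero coefficient at a finite set disjoint from \<open>A\<close> survives in the
  product.\<close>

lemma wedge_basis_fun:
  "wedge x (basis_fun A) R =
     (if A \<subseteq> R \<and> finite R then shuffle_sign (R - A) A * x (R - A) else 0)"
proof (cases "finite R")
  case True
  have "wedge x (basis_fun A) R =
      (\<Sum>S\<in>Pow R. if S = R - A \<and> A \<subseteq> R then shuffle_sign (R - A) A * x (R - A) else 0)"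
    unfolding wedge_def by (intro sum.cong) (auto simp: basis_fun_def double_diff)
  also have "\<dots> = (if A \<subseteq> R then shuffle_sign (R - A) A * x (R - A) else 0)"
    using True by (cases "A \<subseteq> R") auto
  finally show ?thesis using True by simp
qed (simp add: wedge_infinite)

text \<open>The analogue of Laplace expansion: a block on which a vector is nonzero is a singleton,
  so only complements of single elements contribute.\<close>

lemma wedge_vector:
  assumes "f \<in> ext_power n 1" "finite K"
  shows "wedge z f K = (\<Sum>i\<in>K. shuffle_sign (K - {i}) {i} * z (K - {i}) * f {i})"
proof -
  have "wedge z f K = (\<Sum>S\<in>(\<lambda>i. K - {i}) ` K. shuffle_sign S (K - S) * z S * f (K - S))"
    unfolding wedge_def
  proof (rule sum.mono_neutral_right)
    show "\<forall>S\<in>Pow K - (\<lambda>i. K - {i}) ` K. shuffle_sign S (K - S) * z S * f (K - S) = 0"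
    proof
      fix S assume S: "S \<in> Pow K - (\<lambda>i. K - {i}) ` K"
      have "f (K - S) = 0"
      proof (rule ccontr)
        assume "f (K - S) \<noteq> 0"
        then obtain i where i: "K - S = {i}"
          using ext_power_nonzeroD[OF assms(1)] by (metis card_1_singletonE)
        then have "S = K - {i}" "i \<in> K" using S by auto
        then show False using S by auto
      qed
      then show "shuffle_sign S (K - S) * z S * f (K - S) = 0" by simp
    qed
  qed (use assms in auto)
  also have "\<dots> = (\<Sum>i\<in>K. shuffle_sign (K - {i}) (K - (K - {i})) * z (K - {i}) * f (K - (K - {i})))"
    by (subst sum.reindex) (auto simp: inj_on_def)
  also have "\<dots> = (\<Sum>i\<in>K. shuffle_sign (K - {i}) {i} * z (K - {i}) * f {i})"
    by (intro sum.cong) (auto simp: double_diff)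
  finally show ?thesis .
qed

section \<open>Dimensions of spaces of functions\<close>

interpretation cfun_pair: vector_space_pair
  "fscale :: complex \<Rightarrow> ('a \<Rightarrow> complex) \<Rightarrow> 'a \<Rightarrow> complex"
  "fscale :: complex \<Rightarrow> ('b \<Rightarrow> complex) \<Rightarrow> 'b \<Rightarrow> complex" ..

lemma fscale_apply: "fscale c f x = c * f x"
  by (simp add: fscale_def)

lemma dim_eq_card_basis:
  assumes "cfun.independent A" "cfun.span A = V" shows "cfun.dim V = card A"
  by (rule cfun.dim_unique[OF _ _ assms(1) refl])
    (use assms(2) cfun.span_superset[of A] in auto)

lemma linear_fscaleI:
  assumes "\<And>x y. f (x + y) = f x + f y" and "\<And>c x. f (fscale c x) = fscale c (f x)"
  shows "Vector_Spaces.linear fscale fscale f"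
  by unfold_locales (rule assms)+

text \<open>A basis is carried to a basis. Finite dimension is not assumed, because the lemma is
  later applied to functionals on an ideal of polynomial functions.\<close>

lemma dim_linear_image_inj:
  fixes f :: "('a \<Rightarrow> complex) \<Rightarrow> 'b \<Rightarrow> complex"
  assumes f: "Vector_Spaces.linear fscale fscale f" and V: "cfun.subspace V" and inj: "inj_on f V"
  shows "cfun.dim (f ` V) = cfun.dim V"
proof -
  obtain A where A: "A \<subseteq> V" "cfun.independent A" "V \<subseteq> cfun.span A" "card A = cfun.dim V"
    by (rule cfun.basis_exists)
  have spA: "cfun.span A = V"
    using A V by (simp add: cfun.span_minimal subset_antisym)
  have "cfun.independent (f ` A)"
    using cfun_pair.linear_independent_injective_image[OF f A(2)] inj spA by simp
  moreover have "cfun.span (f ` A) = f ` V"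
    using cfun_pair.linear_span_image[OF f, of A] spA by simp
  ultimately have "cfun.dim (f ` V) = card (f ` A)"
    by (rule dim_eq_card_basis)
  also have "\<dots> = card A" using inj A(1) by (intro card_image) (auto intro: inj_on_subset)
  finally show ?thesis using A by simp
qed

lemma subspace_coord_space: "cfun.subspace (coord_space B)"
  by (intro cfun.subspaceI) (auto simp: coord_space_def fscale_def)

lemma coord_space_expand:
  assumes "finite B" "x \<in> coord_space B"
  shows "x = (\<Sum>p\<in>B. fscale (x p) (basis_fun p))"
proof
  fix q
  have "(\<Sum>p\<in>B. fscale (x p) (basis_fun p)) q = (\<Sum>p\<in>B. if p = q then x q else 0)"
    unfolding sum_fun_apply by (intro sum.cong) (auto simp: fscale_def basis_fun_def)
  then show "x q = (\<Sum>p\<in>B. fscale (x p) (basis_fun p)) q"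
    using assms by (auto simp: coord_space_def)
qed

text \<open>Only basis vectors in the support of \<open>x\<close> are asked for; in a triangular
  elimination this is where the induction hypothesis applies.\<close>

lemma in_subspace_if_basis:
  assumes "finite B" "x \<in> coord_space B" "cfun.subspace V"
    and "\<And>p. p \<in> B \<Longrightarrow> x p \<noteq> 0 \<Longrightarrow> basis_fun p \<in> V"
  shows "x \<in> V"
proof -
  have "fscale (x p) (basis_fun p) \<in> V" if "p \<in> B" for p
  proof (cases "x p = 0")
    case True
    then have "fscale (x p) (basis_fun p) = 0" by (auto simp: fscale_def)
    then show ?thesis using cfun.subspace_0[OF assms(3)] by metis
  next
    case False
    then show ?thesis using assms that by (intro cfun.subspace_scale)
  qed
  then have "(\<Sum>p\<in>B. fscale (x p) (basis_fun p)) \<in> V"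
    by (intro cfun.subspace_sum assms(3))
  then show ?thesis using coord_space_expand[OF assms(1,2)] by metis
qed

lemma basis_fun_in_coord_space: "p \<in> B \<Longrightarrow> basis_fun p \<in> coord_space B"
  by (auto simp: basis_fun_def coord_space_def)

lemma span_basis_fun:
  assumes "finite B" shows "cfun.span (basis_fun ` B) = coord_space B"
proof
  show "cfun.span (basis_fun ` B) \<subseteq> coord_space B"
    using basis_fun_in_coord_space by (intro cfun.span_minimal subspace_coord_space) auto
  show "coord_space B \<subseteq> cfun.span (basis_fun ` B)"
  proof
    fix x assume "x \<in> coord_space B"
    then show "x \<in> cfun.span (basis_fun ` B)"
      by (rule in_subspace_if_basis[OF assms _ cfun.subspace_span])
        (auto intro: cfun.span_base)
  qed
qed

lemma inj_basis_fun: "inj_on basis_fun B"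
proof (rule inj_onI)
  fix p q :: 'a assume "basis_fun p = basis_fun q"
  then have "basis_fun p p = basis_fun q p" by simp
  then show "p = q" by (simp add: basis_fun_def split: if_splits)
qed

lemma independent_basis_fun:
  assumes "finite B" shows "cfun.independent (basis_fun ` B)"
proof (subst cfun.dependent_finite)
  show "finite (basis_fun ` B)" using assms by simp
  show "\<not> (\<exists>u. (\<exists>v\<in>basis_fun ` B. u v \<noteq> 0) \<and> (\<Sum>v\<in>basis_fun ` B. fscale (u v) v) = 0)"
  proof clarify
    fix u p
    assume z: "(\<Sum>v\<in>basis_fun ` B. fscale (u v) v) = 0" and p: "p \<in> B" "u (basis_fun p) \<noteq> 0"
    have "(\<Sum>v\<in>basis_fun ` B. fscale (u v) v) p = (\<Sum>q\<in>B. fscale (u (basis_fun q)) (basis_fun q) p)"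
      unfolding sum_fun_apply by (subst sum.reindex[OF inj_basis_fun]) simp
    also have "\<dots> = (\<Sum>q\<in>B. if q = p then u (basis_fun p) else 0)"
      by (intro sum.cong) (auto simp: fscale_def basis_fun_def)
    also have "\<dots> = u (basis_fun p)" using assms p by simp
    finally show False using z p by simp
  qed
qed

lemma dim_coord_space:
  assumes "finite B" shows "cfun.dim (coord_space B) = card B"
  using dim_eq_card_basis[OF independent_basis_fun[OF assms] span_basis_fun[OF assms]]
    card_image[OF inj_basis_fun, of B] by simp

lemma independent_finite_coord_space:
  assumes "finite B" "A \<subseteq> coord_space B" "cfun.independent A"
  shows "finite A" "card A \<le> card B"
  using cfun.independent_span_bound[of "basis_fun ` B" A] assms span_basis_fun[OF assms(1)]
    card_image[OF inj_basis_fun[of B]]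
  by simp_all

lemma dim_le_coord_space:
  assumes "finite B" "V \<subseteq> coord_space B" shows "cfun.dim V \<le> card B"
proof -
  obtain A where "A \<subseteq> V" "cfun.independent A" "card A = cfun.dim V"
    by (rule cfun.basis_exists)
  then show ?thesis using independent_finite_coord_space(2)[OF assms(1), of A] assms by auto
qed

lemma dim_eq_coord_space:
  assumes "finite B" "V \<subseteq> coord_space B" "cfun.subspace V" "cfun.dim V = card B"
  shows "V = coord_space B"
proof (rule ccontr)
  assume "V \<noteq> coord_space B"
  then obtain x where x: "x \<in> coord_space B" "x \<notin> V" using assms by auto
  obtain A where A: "A \<subseteq> V" "cfun.independent A" "V \<subseteq> cfun.span A" "card A = cfun.dim V"
    by (rule cfun.basis_exists)
  have spA: "cfun.span A = V"
    using A assms by (simp add: cfun.span_minimal subset_antisym)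
  have "cfun.independent (insert x A)" using A x spA by (simp add: cfun.independent_insert)
  then have "card (insert x A) \<le> card B" "finite A"
    using independent_finite_coord_space[OF assms(1), of "insert x A"] A assms x by auto
  moreover have "x \<notin> A" using A x by auto
  ultimately show False using A assms by simp
qed

text \<open>The coordinate at \<open>p\<close> is a nonzero functional on \<open>K\<close>, and
  \<open>w\<close> spans a complement of its kernel. In a chart this is the passage from
  \<open>K\<close> to \<open>K\<close> modulo the line of \<open>w\<close>, with tangent directions
  normalised to have coordinate 0 at \<open>p\<close>.\<close>

lemma dim_hyperplane_section:
  assumes "finite B" "K \<subseteq> coord_space B" "cfun.subspace K" "w \<in> K" "w p \<noteq> 0"
  shows "cfun.dim K = cfun.dim {x \<in> K. x p = 0} + 1"
proof -
  let ?H = "{x \<in> K. x p = 0}"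
  have H: "cfun.subspace ?H"
  proof (rule cfun.subspaceI)
    show "0 \<in> ?H" using cfun.subspace_0[OF assms(3)] by simp
    show "x + y \<in> ?H" if "x \<in> ?H" "y \<in> ?H" for x y
      using cfun.subspace_add[OF assms(3), of x y] that by simp
    show "fscale c x \<in> ?H" if "x \<in> ?H" for c x
      using cfun.subspace_scale[OF assms(3), of x c] that by (simp add: fscale_apply)
  qed
  obtain A where A: "A \<subseteq> ?H" "cfun.independent A" "?H \<subseteq> cfun.span A" "card A = cfun.dim ?H"
    by (rule cfun.basis_exists)
  have spA: "cfun.span A = ?H"
    using cfun.span_minimal[OF A(1) H] A(3) by auto
  have w: "w \<notin> cfun.span A" using assms spA by auto
  have ind: "cfun.independent (insert w A)" using A w by (simp add: cfun.independent_insert)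
  have "cfun.span (insert w A) = K"
  proof
    show "cfun.span (insert w A) \<subseteq> K" using A assms by (intro cfun.span_minimal) auto
    show "K \<subseteq> cfun.span (insert w A)"
    proof
      fix x assume x: "x \<in> K"
      have "x - fscale (x p / w p) w \<in> ?H"
        using x assms cfun.subspace_diff[OF assms(3) x cfun.subspace_scale[OF assms(3,4)]]
        by (auto simp: fscale_apply)
      then show "x \<in> cfun.span (insert w A)" using spA cfun.span_breakdown_eq by blast
    qed
  qed
  then have "cfun.dim K = card (insert w A)" by (rule dim_eq_card_basis[OF ind])
  moreover have "finite A" "w \<notin> A"
    using independent_finite_coord_space[OF assms(1), of A] A assms w cfun.span_base[of w A] by auto
  ultimately show ?thesis using A(4) by simp
qed

section \<open>Tuples of vectors as functions on a product\<close>

definition slot_embed :: "'i \<Rightarrow> ('b \<Rightarrow> complex) \<Rightarrow> 'i \<times> 'b \<Rightarrow> complex" where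
  "slot_embed i x = (\<lambda>(j, S). if j = i then x S else 0)"

lemma subspace_product:
  assumes sub: "\<And>i. i \<in> I \<Longrightarrow> cfun.subspace (K i)"
  shows "cfun.subspace {v \<in> coord_space (I \<times> B). \<forall>i\<in>I. (\<lambda>S. v (i, S)) \<in> K i}"
    (is "cfun.subspace ?V")
proof (intro cfun.subspaceI)
  show "0 \<in> ?V"
    using cfun.subspace_0[OF sub] cfun.subspace_0[OF subspace_coord_space[of "I \<times> B"]]
    by (auto simp: zero_fun_def)
  fix v v' assume "v \<in> ?V" "v' \<in> ?V"
  then show "v + v' \<in> ?V"
    using cfun.subspace_add[OF sub] cfun.subspace_add[OF subspace_coord_space[of "I \<times> B"]]
    by (auto simp: plus_fun_def)
next
  fix c v assume "v \<in> ?V"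
  then show "fscale c v \<in> ?V"
    using cfun.subspace_scale[OF sub] cfun.subspace_scale[OF subspace_coord_space[of "I \<times> B"]]
    by (auto simp: fscale_def)
qed

text \<open>The components of a tuple are the rows of one function on \<open>I \<times> B\<close>.
  Bases of the factors, each embedded in its own slot, together form a basis of the product.\<close>

lemma dim_product:
  fixes K :: "'i \<Rightarrow> ('b \<Rightarrow> complex) set"
  assumes "finite I" "finite B" and sub: "\<And>i. i \<in> I \<Longrightarrow> cfun.subspace (K i)"
    and KB: "\<And>i. i \<in> I \<Longrightarrow> K i \<subseteq> coord_space B"
  shows "cfun.dim {v \<in> coord_space (I \<times> B). \<forall>i\<in>I. (\<lambda>S. v (i, S)) \<in> K i} = (\<Sum>i\<in>I. cfun.dim (K i))"
proof -
  let ?V = "{v \<in> coord_space (I \<times> B). \<forall>i\<in>I. (\<lambda>S. v (i, S)) \<in> K i}"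
  have "\<exists>A. A \<subseteq> K i \<and> cfun.independent A \<and> K i \<subseteq> cfun.span A \<and> card A = cfun.dim (K i)" for i
    by (rule cfun.basis_exists[of "K i"]) blast
  then obtain A where A: "\<And>i. A i \<subseteq> K i" "\<And>i. cfun.independent (A i)"
    "\<And>i. K i \<subseteq> cfun.span (A i)" "\<And>i. card (A i) = cfun.dim (K i)"
    by metis
  have finA: "finite (A i)" if "i \<in> I" for i
    using independent_finite_coord_space(1)[OF assms(2) _ A(2)] A(1) KB that by blast
  let ?P = "SIGMA i:I. A i"
  let ?e = "\<lambda>(i, x). slot_embed i x"
  have finP: "finite ?P" using assms finA by auto
  \<comment> \<open>The zero vector would have the same embedding in every slot, so injectivity
    across slots rests on this.\<close>
  have nz: "x \<noteq> 0" if "x \<in> A i" for i x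
    using cfun.dependent_zero[of "A i"] A(2) that by metis
  have inj: "inj_on ?e ?P"
  proof (rule inj_onI, clarify)
    fix i x j y assume ij: "i \<in> I" "x \<in> A i" "j \<in> I" "y \<in> A j" "slot_embed i x = slot_embed j y"
    then have eq: "slot_embed i x (k, S) = slot_embed j y (k, S)" for k S by simp
    have "i = j"
    proof (rule ccontr)
      assume "i \<noteq> j"
      then have "x S = 0" for S using eq[of i S] by (simp add: slot_embed_def)
      then have "x = 0" by auto
      then show False using nz ij by blast
    qed
    moreover have "x = y"
    proof
      fix S show "x S = y S" using eq[of i S] \<open>i = j\<close> by (simp add: slot_embed_def)
    qed
    ultimately show "i = j \<and> x = y" by simp
  qed
  have V: "cfun.subspace ?V" by (rule subspace_product) (rule sub)
  have "cfun.independent (?e ` ?P)"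
  proof (subst cfun.dependent_finite)
    show "finite (?e ` ?P)" using finP by simp
    show "\<not> (\<exists>u. (\<exists>v\<in>?e ` ?P. u v \<noteq> 0) \<and> (\<Sum>v\<in>?e ` ?P. fscale (u v) v) = 0)"
    proof clarify
      fix u i x
      assume z: "(\<Sum>v\<in>?e ` ?P. fscale (u v) v) = 0" and ix: "i \<in> I" "x \<in> A i"
        and u: "u (slot_embed i x) \<noteq> 0"
      \<comment> \<open>Reading the relation in row \<open>i\<close> removes all basis vectors
        embedded in other slots.\<close>
      have z': "(\<Sum>y\<in>A i. fscale (u (slot_embed i y)) y) = 0"
      proof
        fix S
        have "(\<Sum>v\<in>?e ` ?P. fscale (u v) v) (i, S) =
            (\<Sum>p\<in>?P. fscale (u (?e p)) (?e p) (i, S))"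
          unfolding sum_fun_apply by (subst sum.reindex[OF inj]) simp
        also have "\<dots> = (\<Sum>j\<in>I. \<Sum>y\<in>A j. fscale (u (slot_embed j y)) (slot_embed j y) (i, S))"
          using assms finA by (subst sum.Sigma) (auto simp: case_prod_beta)
        also have "\<dots> = (\<Sum>j\<in>I. if j = i then (\<Sum>y\<in>A i. u (slot_embed i y) * y S) else 0)"
          by (intro sum.cong) (auto simp: fscale_def slot_embed_def)
        also have "\<dots> = (\<Sum>y\<in>A i. u (slot_embed i y) * y S)"
          using assms ix by simp
        finally show "(\<Sum>y\<in>A i. fscale (u (slot_embed i y)) y) S = 0 S"
          unfolding z by (simp add: sum_fun_apply fscale_apply)
      qed
      have "cfun.dependent (A i)"
        by (rule cfun.dependent_finite[OF finA[OF ix(1)], THEN iffD2])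
          (intro exI[of _ "\<lambda>y. u (slot_embed i y)"] conjI bexI[of _ x] z' ix u)
      then show False using A(2) by blast
    qed
  qed
  moreover have "cfun.span (?e ` ?P) = ?V"
  proof
    have "slot_embed i x \<in> ?V" if "i \<in> I" "x \<in> A i" for i x
    proof -
      have "x \<in> K i" using A that by auto
      moreover have "(\<lambda>S. slot_embed i x (j, S)) = (if j = i then x else 0)" for j
        by (auto simp: slot_embed_def fun_eq_iff)
      ultimately show ?thesis
        using that KB cfun.subspace_0[OF sub]
        by (auto simp: coord_space_def slot_embed_def subset_iff)
    qed
    then show "cfun.span (?e ` ?P) \<subseteq> ?V"
      by (intro cfun.span_minimal V) auto
    show "?V \<subseteq> cfun.span (?e ` ?P)"
    proof
      fix v assume v: "v \<in> ?V"
      have "v = (\<Sum>i\<in>I. slot_embed i (\<lambda>S. v (i, S)))"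
      proof
        fix p :: "'i \<times> 'b"
        obtain j S where p: "p = (j, S)" by (cases p)
        have "(\<Sum>i\<in>I. slot_embed i (\<lambda>S. v (i, S))) (j, S) = (\<Sum>i\<in>I. if i = j then v (j, S) else 0)"
          unfolding sum_fun_apply by (intro sum.cong) (auto simp: slot_embed_def)
        then show "v p = (\<Sum>i\<in>I. slot_embed i (\<lambda>S. v (i, S))) p"
          using v assms p by (auto simp: coord_space_def)
      qed
      moreover have "slot_embed i (\<lambda>S. v (i, S)) \<in> cfun.span (?e ` ?P)" if "i \<in> I" for i
      proof -
        have lin: "Vector_Spaces.linear fscale fscale (slot_embed i :: ('b \<Rightarrow> complex) \<Rightarrow> _)"
          by (rule linear_fscaleI) (auto simp: slot_embed_def fun_eq_iff fscale_def)
        have "(\<lambda>S. v (i, S)) \<in> cfun.span (A i)" using v A that by blast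
        then have "slot_embed i (\<lambda>S. v (i, S)) \<in> cfun.span (slot_embed i ` A i)"
          using cfun_pair.linear_span_image[OF lin] by blast
        also have "\<dots> \<subseteq> cfun.span (?e ` ?P)"
          using that by (intro cfun.span_mono) force
        finally show ?thesis .
      qed
      ultimately show "v \<in> cfun.span (?e ` ?P)"
        by (metis (no_types, lifting) cfun.span_sum)
    qed
  qed
  ultimately have "cfun.dim ?V = card (?e ` ?P)" by (rule dim_eq_card_basis)
  also have "\<dots> = card ?P" by (rule card_image[OF inj])
  also have "\<dots> = (\<Sum>i\<in>I. card (A i))" using assms finA by (simp add: card_SigmaI)
  finally show ?thesis using A(4) by simp
qed

section \<open>Decomposable multivectors\<close>

definition wedge_kernel :: "nat \<Rightarrow> nat \<Rightarrow> (nat set \<Rightarrow> complex) \<Rightarrow> (nat set \<Rightarrow> complex) set" where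
  "wedge_kernel n r w = {x \<in> ext_power n r. wedge w x = 0}"

text \<open>Reduced row echelon form with pivot set \<open>S\<close>: in the columns
  \<open>S\<close> the coordinate matrix of the family is the identity.\<close>

definition echelon :: "nat \<Rightarrow> nat set \<Rightarrow> (nat \<Rightarrow> nat set \<Rightarrow> complex) \<Rightarrow> bool" where
  "echelon n S f \<longleftrightarrow> S \<subseteq> {..<n} \<and> (\<forall>s\<in>S. f s \<in> ext_power n 1) \<and>
     (\<forall>s\<in>S. \<forall>t\<in>S. f s {t} = (if s = t then 1 else 0))"

text \<open>Encoded by annihilating vectors rather than by a factorisation, since these are what the
  dimension argument produces. For \<open>w\<close> in degree \<open>r\<close> it amounts to being a
  scalar multiple of the product of an echelon family of size \<open>r\<close>.\<close>

definition decomposable :: "nat \<Rightarrow> nat \<Rightarrow> (nat set \<Rightarrow> complex) \<Rightarrow> bool" where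
  "decomposable n r w \<longleftrightarrow>
     (\<exists>S f. card S = r \<and> echelon n S f \<and> (\<forall>s\<in>S. wedge w (f s) = 0))"

definition meeting :: "nat \<Rightarrow> nat \<Rightarrow> nat set \<Rightarrow> nat set set" where
  "meeting n r S = {T \<in> ext_index n r. T \<inter> S \<noteq> {}}"

lemma finite_ext_index: "finite (ext_index n r)"
  by (rule finite_subset[of _ "Pow {..<n}"]) (auto simp: ext_index_def)

lemma finite_meeting: "finite (meeting n r S)"
  using finite_ext_index[of n r] by (simp add: meeting_def)

lemma subspace_ext_power: "cfun.subspace (ext_power n r)"
  unfolding ext_power_def by (rule subspace_coord_space)

lemma subspace_wedge_kernel: "cfun.subspace (wedge_kernel n r w)"
proof (rule cfun.subspaceI)
  show "0 \<in> wedge_kernel n r w"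
    using cfun.subspace_0[OF subspace_ext_power] by (simp only: wedge_kernel_def mem_Collect_eq wedge_zero_right simp_thms)
  show "x + y \<in> wedge_kernel n r w" if "x \<in> wedge_kernel n r w" "y \<in> wedge_kernel n r w" for x y
    using cfun.subspace_add[OF subspace_ext_power, of x n r y] that
    by (simp add: wedge_kernel_def wedge_add_right)
  show "fscale c x \<in> wedge_kernel n r w" if "x \<in> wedge_kernel n r w" for c x
    using cfun.subspace_scale[OF subspace_ext_power, of x n r c] that
    by (simp add: wedge_kernel_def wedge_scale_right)
qed

section \<open>The upper bound for the dimension of the kernel\<close>

lemma card_meeting:
  assumes "S \<in> ext_index n r"
  shows "card (meeting n r S) = (n choose r) - ((n - r) choose r)"
proof -
  have S: "finite S" "S \<subseteq> {..<n}" "card S = r"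
    using assms by (auto simp: ext_index_def intro: finite_subset)
  have "meeting n r S = ext_index n r - {T. T \<subseteq> {..<n} - S \<and> card T = r}"
    by (auto simp: meeting_def ext_index_def)
  moreover have "card {T. T \<subseteq> {..<n} - S \<and> card T = r} = (n - r) choose r"
    using n_subsets[of "{..<n} - S" r] S by (simp add: card_Diff_subset)
  moreover have "card (ext_index n r) = n choose r"
    using n_subsets[of "{..<n}" r] by (simp add: ext_index_def)
  moreover have "{T. T \<subseteq> {..<n} - S \<and> card T = r} \<subseteq> ext_index n r"
    by (auto simp: ext_index_def)
  ultimately show ?thesis
    using card_Diff_subset[of "{T. T \<subseteq> {..<n} - S \<and> card T = r}" "ext_index n r"]
      finite_subset[OF _ finite_ext_index[of n r]]
    by simp
qed

text \<open>If \<open>R\<close> contributes, its complement in \<open>S \<union> T\<close> avoids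
  \<open>S\<close>, so \<open>R\<close> contains \<open>S\<close>; having as many elements as
  \<open>S\<close>, it equals \<open>S\<close>.\<close>

lemma wedge_disjoint_coeff:
  assumes w: "w \<in> ext_power n r" and S: "finite S" "card S = r" and T: "finite T" "T \<inter> S = {}"
    and x: "\<And>R. R \<inter> S \<noteq> {} \<Longrightarrow> x R = 0"
  shows "wedge w x (S \<union> T) = shuffle_sign S T * w S * x T"
proof -
  have TS: "S \<union> T - S = T" using T by auto
  have "wedge w x (S \<union> T) =
      (\<Sum>R\<in>Pow (S \<union> T). if R = S then shuffle_sign S T * w S * x T else 0)"
    unfolding wedge_def
  proof (rule sum.cong[OF refl])
    fix R assume R: "R \<in> Pow (S \<union> T)"
    show "shuffle_sign R (S \<union> T - R) * w R * x (S \<union> T - R) =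
        (if R = S then shuffle_sign S T * w S * x T else 0)"
    proof (cases "w R = 0 \<or> x (S \<union> T - R) = 0 \<or> R = S")
      case False
      then have "(S \<union> T - R) \<inter> S = {}" using x[of "S \<union> T - R"] by metis
      then have "S \<subseteq> R" by auto
      moreover have "card R = card S" "finite R" using ext_power_nonzeroD[OF w, of R] False S by auto
      ultimately have "S = R" using card_subset_eq by metis
      then show ?thesis using False by simp
    qed (use TS in auto)
  qed
  also have "\<dots> = shuffle_sign S T * w S * x T" using S T by simp
  finally show ?thesis .
qed

text \<open>Forgets the coefficients at the sets disjoint from \<open>S\<close>. It embeds the
  kernel into a coordinate space whose dimension is the bound, so in the extremal case every vector
  supported on \<open>meeting n r S\<close> is the image of a kernel element.\<close>

definition meeting_part :: "nat \<Rightarrow> nat \<Rightarrow> nat set \<Rightarrow> (nat set \<Rightarrow> complex) \<Rightarrow> nat set \<Rightarrow> complex" where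
  "meeting_part n r S x = (\<lambda>T. if T \<in> meeting n r S then x T else 0)"

lemma linear_meeting_part: "Vector_Spaces.linear fscale fscale (meeting_part n r S)"
  by (rule linear_fscaleI) (auto simp: meeting_part_def fun_eq_iff fscale_apply)

text \<open>Only the summand \<open>w\<^sub>S e\<^sub>S\<close> of \<open>w\<close> contributes to the coefficients of \<open>w \<and> x\<close> at
  the sets \<open>S \<union> T\<close>, so these coefficients recover \<open>x\<close>.\<close>

lemma zero_if_meeting_part_zero:
  assumes w: "w \<in> ext_power n r" and S: "S \<in> ext_index n r" "w S \<noteq> 0"
    and x: "x \<in> ext_power n r" "meeting_part n r S x = 0"
    and z: "\<And>T. T \<in> ext_index n r \<Longrightarrow> T \<inter> S = {} \<Longrightarrow> wedge w x (S \<union> T) = 0"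
  shows "x = 0"
proof
  fix T
  have S': "finite S" "card S = r" using S by (auto simp: ext_index_def intro: finite_subset)
  have xz: "x R = 0" if "R \<inter> S \<noteq> {}" for R
  proof (rule ccontr)
    assume "x R \<noteq> 0"
    then have "meeting_part n r S x R \<noteq> 0"
      using that ext_power_nonzeroD[OF x(1)] by (simp add: meeting_part_def meeting_def ext_index_def)
    then show False using x(2) by simp
  qed
  show "x T = 0 T"
  proof (rule ccontr)
    assume "x T \<noteq> 0 T"
    then have nz: "x T \<noteq> 0" by simp
    then have T: "T \<inter> S = {}" "finite T" "T \<in> ext_index n r"
      using xz ext_power_nonzeroD[OF x(1) nz] by (auto simp: ext_index_def)
    show False
      using wedge_disjoint_coeff[OF w S' T(2,1) xz] z[OF T(3,1)] S nz by simp
  qed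
qed

lemma meeting_part_image:
  assumes w: "w \<in> ext_power n r" and S: "S \<in> ext_index n r" "w S \<noteq> 0"
  shows "inj_on (meeting_part n r S) (wedge_kernel n r w)"
    and "meeting_part n r S ` wedge_kernel n r w \<subseteq> coord_space (meeting n r S)"
    and "cfun.subspace (meeting_part n r S ` wedge_kernel n r w)"
    and "cfun.dim (meeting_part n r S ` wedge_kernel n r w) = cfun.dim (wedge_kernel n r w)"
proof -
  show inj: "inj_on (meeting_part n r S) (wedge_kernel n r w)"
  proof (rule inj_onI)
    fix x y assume xy: "x \<in> wedge_kernel n r w" "y \<in> wedge_kernel n r w"
      "meeting_part n r S x = meeting_part n r S y"
    have d: "x - y \<in> wedge_kernel n r w"
      by (rule cfun.subspace_diff[OF subspace_wedge_kernel xy(1,2)])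
    have "meeting_part n r S (x - y) = meeting_part n r S x - meeting_part n r S y"
      by (auto simp: meeting_part_def fun_eq_iff)
    then have "meeting_part n r S (x - y) = 0" using xy(3) by simp
    have "x - y = 0"
    proof (rule zero_if_meeting_part_zero[OF w S])
      show "x - y \<in> ext_power n r" using d unfolding wedge_kernel_def by blast
      show "meeting_part n r S (x - y) = 0" by fact
      have "wedge w (x - y) = 0" using d unfolding wedge_kernel_def by blast
      then show "wedge w (x - y) (S \<union> T) = 0" for T by (simp only: zero_fun_apply)
    qed
    then show "x = y" by simp
  qed
  show "meeting_part n r S ` wedge_kernel n r w \<subseteq> coord_space (meeting n r S)"
    by (auto simp: meeting_part_def coord_space_def)
  show "cfun.subspace (meeting_part n r S ` wedge_kernel n r w)"
    by (rule cfun_pair.linear_subspace_image[OF linear_meeting_part subspace_wedge_kernel])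
  show "cfun.dim (meeting_part n r S ` wedge_kernel n r w) = cfun.dim (wedge_kernel n r w)"
    by (rule dim_linear_image_inj[OF linear_meeting_part subspace_wedge_kernel inj])
qed

lemma nonzero_coeff:
  assumes "w \<in> ext_power n r" "w \<noteq> 0"
  obtains S where "S \<in> ext_index n r" "w S \<noteq> 0"
proof -
  obtain S where "w S \<noteq> 0" using assms(2) by (auto simp: fun_eq_iff)
  then show ?thesis using that ext_power_nonzeroD[OF assms(1)] by (auto simp: ext_index_def)
qed

lemma dim_wedge_kernel_le:
  assumes "w \<in> ext_power n r" "w \<noteq> 0"
  shows "cfun.dim (wedge_kernel n r w) \<le> (n choose r) - ((n - r) choose r)"
proof -
  obtain S where S: "S \<in> ext_index n r" "w S \<noteq> 0" using nonzero_coeff[OF assms] .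
  show ?thesis
    using dim_le_coord_space[OF finite_meeting meeting_part_image(2)[OF assms(1) S]]
      meeting_part_image(4)[OF assms(1) S] card_meeting[OF S(1)] by simp
qed

section \<open>A kernel of maximal dimension forces a factorisation\<close>

lemma basis_fun_in_ext_power:
  assumes "A \<subseteq> {..<n}" "card A = k" shows "basis_fun A \<in> ext_power n k"
  using assms by (intro ext_powerI) (auto simp: basis_fun_def split: if_splits)

text \<open>The kernel consists of elements of degree \<open>r\<close> whereas the vectors
  \<open>f s\<close> have degree 1, so these are tested after multiplication by basis multivectors
  of degree \<open>r - 1\<close>. The bound \<open>3 * r \<le> n\<close> ensures that enough of the
  latter are available to detect every coefficient.\<close>

lemma decomposable_if_dim_wedge_kernel:
  assumes w: "w \<in> ext_power n r" "w \<noteq> 0" and n: "3 * r \<le> n" and r: "1 \<le> r"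
    and dim: "cfun.dim (wedge_kernel n r w) = (n choose r) - ((n - r) choose r)"
  shows "decomposable n r w"
proof -
  obtain S where S: "S \<in> ext_index n r" "w S \<noteq> 0" using nonzero_coeff[OF w] .
  have S': "S \<subseteq> {..<n}" "card S = r" "finite S"
    using S by (auto simp: ext_index_def intro: finite_subset)
  have im: "meeting_part n r S ` wedge_kernel n r w = coord_space (meeting n r S)"
    using meeting_part_image[OF w(1) S] finite_meeting dim card_meeting[OF S(1)]
    by (intro dim_eq_coord_space) auto
  \<comment> \<open>The correction terms make the coefficients of \<open>w \<and> f s\<close> at \<open>S \<union> {t}\<close> vanish.\<close>
  define g where "g s t = - (shuffle_sign (insert t S - {s}) {s} * w (insert t S - {s})) /
    (shuffle_sign S {t} * w S)" for s t
  define f where "f s = (\<lambda>R. if R = {s} then 1 else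
    if \<exists>t\<in>{..<n} - S. R = {t} then g s (the_elem R) else 0)" for s
  have f1: "f s \<in> ext_power n 1" if "s \<in> S" for s
    using that S' by (intro ext_powerI) (auto simp: f_def split: if_splits)
  have ech: "echelon n S f"
    using S' f1 by (auto simp: echelon_def f_def)
  have z0: "wedge w (f s) (insert t S) = 0" if s: "s \<in> S" and t: "t \<in> {..<n} - S" for s t
  proof -
    have ts: "t \<noteq> s" using s t by auto
    have "wedge w (f s) (insert t S) =
        (\<Sum>i\<in>insert t S. shuffle_sign (insert t S - {i}) {i} * w (insert t S - {i}) * f s {i})"
      using S' f1[OF s] by (intro wedge_vector) auto
    also have "\<dots> = (\<Sum>i\<in>{t, s}. shuffle_sign (insert t S - {i}) {i} * w (insert t S - {i}) * f s {i})"
      using S' s by (intro sum.mono_neutral_right) (auto simp: f_def)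
    also have "\<dots> = shuffle_sign S {t} * w S * g s t +
        shuffle_sign (insert t S - {s}) {s} * w (insert t S - {s})"
    proof -
      have "insert t S - {t} = S" using t by auto
      moreover have "f s {t} = g s t" "f s {s} = 1" using ts t by (auto simp: f_def)
      ultimately show ?thesis using ts by simp
    qed
    also have "\<dots> = 0" using S by (simp add: g_def)
    finally show ?thesis .
  qed
  \<comment> \<open>Some kernel element \<open>k\<close> has the same meeting part as
    \<open>f s \<and> e_A\<close>. Their difference is supported off \<open>S\<close>, and its
    product with \<open>w\<close> vanishes at all \<open>S \<union> T\<close>, so it is
    zero.\<close>
  have kill: "wedge (wedge w (f s)) (basis_fun A) = 0"
    if s: "s \<in> S" and A: "A \<subseteq> {..<n} - S" "card A = r - 1" for s A
  proof -
    let ?x = "wedge (f s) (basis_fun A)"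
    have fA: "finite A" using A by (auto intro: finite_subset)
    have "basis_fun A \<in> ext_power n (r - 1)"
      using A by (intro basis_fun_in_ext_power) auto
    from wedge_in_ext_power[OF f1[OF s] this] have x: "?x \<in> ext_power n r" using r by simp
    have "meeting_part n r S ?x \<in> coord_space (meeting n r S)"
      by (simp add: meeting_part_def coord_space_def)
    then obtain k where k: "k \<in> wedge_kernel n r w" "meeting_part n r S ?x = meeting_part n r S k"
      using im by (metis imageE)
    have k': "k \<in> ext_power n r" "wedge w k = 0" using k(1) by (auto simp: wedge_kernel_def)
    have "?x - k = 0"
    proof (rule zero_if_meeting_part_zero[OF w(1) S])
      show "?x - k \<in> ext_power n r" by (rule cfun.subspace_diff[OF subspace_ext_power x k'(1)])
      have "meeting_part n r S (?x - k) = meeting_part n r S ?x - meeting_part n r S k"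
        by (auto simp: meeting_part_def fun_eq_iff)
      then show "meeting_part n r S (?x - k) = 0" using k by simp
      fix T assume T: "T \<in> ext_index n r" "T \<inter> S = {}"
      have e: "wedge w (?x - k) = wedge (wedge w (f s)) (basis_fun A)"
        unfolding wedge_diff_right k'(2) wedge_assoc by simp
      have fT: "finite T" "card T = r" "T \<subseteq> {..<n}"
        using T by (auto simp: ext_index_def intro: finite_subset)
      \<comment> \<open>\<open>A\<close> avoids \<open>S\<close> and has one element fewer than
        \<open>T\<close>, so the coefficient is zero or, up to sign, that of
        \<open>w \<and> f s\<close> at \<open>S\<close> with one index added; the choice of
        \<open>g\<close> made the latter vanish.\<close>
      show "wedge w (?x - k) (S \<union> T) = 0"
      proof (cases "A \<subseteq> S \<union> T")
        case True
        then have AT: "A \<subseteq> T" using A by auto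
        then have "card (T - A) = 1" using fT fA A r by (simp add: card_Diff_subset)
        then obtain t where t: "T - A = {t}" by (metis card_1_singletonE)
        then have "S \<union> T - A = insert t S" "t \<in> {..<n} - S" using A AT T fT by auto
        then show ?thesis using z0[OF s] by (simp add: e wedge_basis_fun)
      qed (simp add: e wedge_basis_fun)
    qed
    then have "?x = k" by simp
    then show ?thesis using k'(2) by (simp add: wedge_assoc)
  qed
  have "wedge w (f s) = 0" if s: "s \<in> S" for s
  proof (rule ccontr)
    assume "wedge w (f s) \<noteq> 0"
    then obtain R where R: "wedge w (f s) R \<noteq> 0" by (auto simp: fun_eq_iff)
    have R': "R \<subseteq> {..<n}" "card R = r + 1" "finite R"
      using ext_power_nonzeroD[OF wedge_in_ext_power[OF w(1) f1[OF s]] R] by auto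
    have "card ({..<n} - (S \<union> R)) = n - card (S \<union> R)"
      using S' R' by (subst card_Diff_subset) auto
    moreover have "card (S \<union> R) \<le> r + (r + 1)"
      using card_Un_le[of S R] S' R' by simp
    \<comment> \<open>At least \<open>n - (2 * r + 1)\<close> indices lie outside
      \<open>S \<union> R\<close>, and \<open>3 * r \<le> n\<close> makes this at least
      \<open>r - 1\<close>.\<close>
    ultimately have "r - 1 \<le> card ({..<n} - (S \<union> R))" using n r by linarith
    then obtain A where A: "A \<subseteq> {..<n} - (S \<union> R)" "card A = r - 1" "finite A"
      by (rule obtain_subset_with_card_n)
    have "R \<union> A - A = R" using A by auto
    then have "wedge (wedge w (f s)) (basis_fun A) (R \<union> A) \<noteq> 0"
      using R R' A by (simp add: wedge_basis_fun)
    moreover have "wedge (wedge w (f s)) (basis_fun A) = 0"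
      using A by (intro kill s) auto
    ultimately show False by simp
  qed
  then show ?thesis using ech S' unfolding decomposable_def by blast
qed

text \<open>Induction on the number of pivots missing from \<open>R\<close>. For a missing pivot
  \<open>s\<close>, the coefficient of \<open>z \<and> f s\<close> at \<open>insert s R\<close> is
  \<open>z R\<close> up to sign, plus terms in which a non-pivot of \<open>R\<close> is exchanged
  for \<open>s\<close>; their index sets miss one pivot fewer. If no pivot is missing,
  \<open>R\<close> is \<open>S\<close>, because both have \<open>r\<close> elements.\<close>

lemma echelon_kernel_determined:
  assumes ech: "echelon n S f" and S: "card S = r" and z: "z \<in> ext_power n r"
    and zf: "\<And>s. s \<in> S \<Longrightarrow> wedge z (f s) = 0" and zS: "z S = 0"
  shows "z = 0"
proof -
  have finS: "finite S" using ech by (auto simp: echelon_def intro: finite_subset)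
  have "z R = 0" for R
  proof (induction "card (S - R)" arbitrary: R rule: less_induct)
    case less
    show ?case
    proof (rule ccontr)
      assume nz: "z R \<noteq> 0"
      then have R: "R \<subseteq> {..<n}" "card R = r" "finite R" using ext_power_nonzeroD[OF z] by auto
      have "R \<noteq> S" using nz zS by auto
      then have "\<not> S \<subseteq> R" using R S card_subset_eq[of R S] by auto
      then obtain s where s: "s \<in> S" "s \<notin> R" by auto
      have "wedge z (f s) (insert s R) =
          (\<Sum>i\<in>insert s R. shuffle_sign (insert s R - {i}) {i} * z (insert s R - {i}) * f s {i})"
        using ech s R by (intro wedge_vector[where n = n]) (auto simp: echelon_def)
      also have "\<dots> = (\<Sum>i\<in>{s}. shuffle_sign (insert s R - {i}) {i} * z (insert s R - {i}) * f s {i})"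
      proof (rule sum.mono_neutral_right)
        show "\<forall>i\<in>insert s R - {s}. shuffle_sign (insert s R - {i}) {i} * z (insert s R - {i}) * f s {i} = 0"
        proof
          fix i assume i: "i \<in> insert s R - {s}"
          show "shuffle_sign (insert s R - {i}) {i} * z (insert s R - {i}) * f s {i} = 0"
          proof (cases "i \<in> S")
            case True
            then show ?thesis using ech s i by (auto simp: echelon_def)
          next
            case False
            have "S - (insert s R - {i}) \<subset> S - R" using False s i by auto
            then have "z (insert s R - {i}) = 0" using finS by (intro less psubset_card_mono) auto
            then show ?thesis by simp
          qed
        qed
      qed (use R in auto)
      also have "\<dots> = shuffle_sign R {s} * z R"
      proof -
        have "insert s R - {s} = R" using s by auto
        then show ?thesis using ech s by (auto simp: echelon_def)
      qed
      finally show False using zf[OF s(1)] nz by simp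
    qed
  qed
  then show ?thesis by auto
qed

lemma wedge_list_vector_member:
  assumes "set xs \<subseteq> ext_power n 1" "x \<in> set xs" shows "wedge (wedge_list xs) x = 0"
  using assms
proof (induction xs)
  case (Cons y ys)
  show ?case
  proof (cases "x \<in> set ys")
    case True
    then have "wedge (wedge_list ys) x = 0" using Cons.prems by (intro Cons.IH) auto
    then show ?thesis by (simp only: wedge_list_Cons wedge_assoc wedge_zero_right)
  next
    case False
    then have [simp]: "x = y" using Cons by simp
    have ys: "wedge_list ys \<in> ext_power n (length ys)"
      using wedge_list_in_ext_power[of ys n 1] Cons by simp
    have x: "x \<in> ext_power n 1" using Cons by simp
    have "wedge (wedge_list (y # ys)) x = wedge x (wedge (wedge_list ys) x)"
      by (simp add: wedge_assoc)
    also have "\<dots> = fscale ((-1) ^ length ys) (wedge (wedge x x) (wedge_list ys))"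
      using wedge_commute[OF ys x] by (simp only: wedge_scale_right wedge_assoc mult_1_right)
    also have "\<dots> = 0" unfolding wedge_self_vector[OF x] by (simp add: fun_eq_iff fscale_apply)
    finally show ?thesis .
  qed
qed simp

lemma wedge_list_not_distinct:
  assumes "set xs \<subseteq> ext_power n 1" "\<not> distinct xs" shows "wedge_list xs = 0"
  using assms
proof (induction xs)
  case (Cons y ys)
  show ?case
  proof (cases "distinct ys")
    case True
    then have y: "y \<in> set ys" using Cons by simp
    have ys: "wedge_list ys \<in> ext_power n (1 * length ys)"
      using wedge_list_in_ext_power[of ys n 1] Cons by simp
    have x: "y \<in> ext_power n 1" using Cons by simp
    show ?thesis
      using wedge_commute[OF x ys] wedge_list_vector_member[of ys n y] y Cons.prems
      by (simp add: fun_eq_iff fscale_apply)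
  next
    case False
    then have "wedge_list ys = 0" using Cons.prems by (intro Cons.IH) auto
    then show ?thesis by (simp only: wedge_list_Cons wedge_zero_right)
  qed
qed simp

text \<open>Up to sign the coefficient is the minor of the coordinate matrix in pivot columns, that
  is, of an identity matrix. Expanding along the new vector leaves only its own pivot.\<close>

lemma wedge_list_echelon_nonzero:
  assumes ech: "echelon n S f" and "distinct ss" "set ss \<subseteq> S"
  shows "wedge_list (map f ss) (set ss) \<noteq> 0"
  using assms(2,3)
proof (induction ss)
  case Nil
  then show ?case by (simp add: ext_one_def)
next
  case (Cons s ss)
  let ?Z = "wedge_list (map f ss)"
  have fs: "f s \<in> ext_power n 1" using ech Cons by (auto simp: echelon_def)
  have Z: "?Z \<in> ext_power n (1 * length (map f ss))"
    using ech Cons by (intro wedge_list_in_ext_power) (auto simp: echelon_def)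
  have "wedge ?Z (f s) (insert s (set ss)) =
      (\<Sum>i\<in>insert s (set ss). shuffle_sign (insert s (set ss) - {i}) {i} *
        ?Z (insert s (set ss) - {i}) * f s {i})"
    by (rule wedge_vector[OF fs]) simp
  also have "\<dots> = (\<Sum>i\<in>{s}. shuffle_sign (insert s (set ss) - {i}) {i} *
        ?Z (insert s (set ss) - {i}) * f s {i})"
    using ech Cons.prems by (intro sum.mono_neutral_right) (auto simp: echelon_def subset_iff)
  also have "\<dots> = shuffle_sign (set ss) {s} * ?Z (set ss)"
    using ech Cons.prems by (auto simp: echelon_def)
  finally have "wedge ?Z (f s) (insert s (set ss)) \<noteq> 0" using Cons by simp
  \<comment> \<open>The expansion has the vector on the right, whereas the head of a list stands on
    the left; graded commutativity only costs a sign.\<close>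
  then show ?case unfolding list.map wedge_list_Cons wedge_commute[OF fs Z] list.set fscale_apply
    by simp
qed

text \<open>The scalar matches the coefficients at the pivot set, so the difference of the two sides
  is annihilated by the family and vanishes at the pivots.\<close>

lemma decomposable_eq_scale_wedge_list:
  assumes ech: "echelon n (set ss) f" and ss: "distinct ss" "length ss = r" and w: "w \<in> ext_power n r"
    and wf: "\<And>s. s \<in> set ss \<Longrightarrow> wedge w (f s) = 0"
  shows "w = fscale (w (set ss) / wedge_list (map f ss) (set ss)) (wedge_list (map f ss))"
proof -
  let ?y = "wedge_list (map f ss)"
  let ?c = "w (set ss) / ?y (set ss)"
  have fs: "set (map f ss) \<subseteq> ext_power n 1" using ech by (auto simp: echelon_def)
  have y: "?y \<in> ext_power n r" using wedge_list_in_ext_power[OF fs] ss by simp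
  have "w - fscale ?c ?y = 0"
  proof (rule echelon_kernel_determined[OF ech])
    show "card (set ss) = r" using ss by (simp add: distinct_card)
    show "w - fscale ?c ?y \<in> ext_power n r"
      by (intro cfun.subspace_diff cfun.subspace_scale subspace_ext_power w y)
    show "(w - fscale ?c ?y) (set ss) = 0"
      using wedge_list_echelon_nonzero[OF ech ss(1)] by (simp add: fscale_apply)
    fix s assume s: "s \<in> set ss"
    have "wedge ?y (f s) = 0" by (rule wedge_list_vector_member[OF fs]) (use s in auto)
    then show "wedge (w - fscale ?c ?y) (f s) = 0"
      using wf[OF s] by (simp add: wedge_diff_left wedge_scale_left fun_eq_iff fscale_apply)
  qed
  then show ?thesis by simp
qed

lemma decomposable_wedge_list:
  assumes "echelon n (set ss) f" "distinct ss" "length ss = r"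
  shows "decomposable n r (wedge_list (map f ss))"
proof -
  have "set (map f ss) \<subseteq> ext_power n 1" using assms by (auto simp: echelon_def)
  then have "\<forall>s\<in>set ss. wedge (wedge_list (map f ss)) (f s) = 0"
    using wedge_list_vector_member by auto
  then show ?thesis unfolding decomposable_def
    using assms by (intro exI[of _ "set ss"] exI[of _ f]) (simp add: distinct_card)
qed

lemma decomposableE:
  assumes "decomposable n r w" "w \<in> ext_power n r"
  obtains ss f c where "echelon n (set ss) f" "distinct ss" "length ss = r"
    "\<forall>s\<in>set ss. wedge w (f s) = 0" "w = fscale c (wedge_list (map f ss))"
proof -
  obtain S f where S: "card S = r" "echelon n S f" "\<forall>s\<in>S. wedge w (f s) = 0"
    using assms(1) by (auto simp: decomposable_def)
  have "finite S" using S by (auto simp: echelon_def intro: finite_subset)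
  then obtain ss where "set ss = S" "distinct ss" using finite_distinct_list by blast
  then show ?thesis
    using that decomposable_eq_scale_wedge_list[of n ss f r w] S assms(2)
    by (metis distinct_card)
qed

text \<open>One copy of \<open>w\<close> is written as a product whose first factor annihilates the
  other copy; \<open>1 \<le> r\<close> provides that factor.\<close>

lemma wedge_self_decomposable:
  assumes "decomposable n r w" "w \<in> ext_power n r" "1 \<le> r" shows "wedge w w = 0"
proof -
  obtain ss f c where "echelon n (set ss) f" "distinct ss" and
    *: "length ss = r" and **: "\<forall>s\<in>set ss. wedge w (f s) = 0" and ***: "w = fscale c (wedge_list (map f ss))"
    using decomposableE[OF assms(1,2)] .
  obtain s ts where ss: "ss = s # ts" using * assms(3) by (cases ss) auto
  have "wedge w (wedge_list (map f ss)) = wedge (wedge w (f s)) (wedge_list (map f ts))"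
    by (simp add: ss wedge_assoc)
  also have "\<dots> = 0" using ** ss by simp
  finally have 0: "wedge w (wedge_list (map f ss)) = 0" .
  have "wedge w w = fscale c (wedge w (wedge_list (map f ss)))"
    by (subst (2) ***) (rule wedge_scale_right)
  then show ?thesis using 0 by (simp add: fun_eq_iff fscale_apply)
qed

text \<open>It remains to see that \<open>meeting_part\<close> maps the kernel onto the whole
  coordinate space. Modulo the kernel, a basis multivector whose index set contains a pivot is a
  combination of those with that pivot exchanged for a non-pivot; this is repeated until no pivot is
  left.\<close>

lemma dim_wedge_kernel_decomposable:
  assumes w: "w \<in> ext_power n r" "w \<noteq> 0" and dec: "decomposable n r w" and r: "1 \<le> r"
  shows "cfun.dim (wedge_kernel n r w) = (n choose r) - ((n - r) choose r)"
proof -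
  obtain S f where S: "card S = r" "echelon n S f" "\<And>s. s \<in> S \<Longrightarrow> wedge w (f s) = 0"
    using dec unfolding decomposable_def by metis
  have S': "S \<subseteq> {..<n}" "finite S" using S by (auto simp: echelon_def intro: finite_subset)
  have SI: "S \<in> ext_index n r" using S S' by (simp add: ext_index_def)
  \<comment> \<open>Otherwise the annihilating family would force \<open>w\<close> to be
    zero.\<close>
  have wS: "w S \<noteq> 0" using echelon_kernel_determined[OF S(2,1) w(1) S(3)] w(2) by metis
  let ?\<rho> = "meeting_part n r S"
  \<comment> \<open>This is the sum of the kernel and the vectors supported off \<open>S\<close>;
    the aim is that it is the whole exterior power.\<close>
  let ?V = "{x \<in> ext_power n r. \<exists>k\<in>wedge_kernel n r w. ?\<rho> k = ?\<rho> x}"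
  have lin: "?\<rho> (x + y) = ?\<rho> x + ?\<rho> y" "?\<rho> (fscale c x) = fscale c (?\<rho> x)" for x y c
    by (auto simp: meeting_part_def fun_eq_iff fscale_apply)
  have V: "cfun.subspace ?V"
  proof (rule cfun.subspaceI)
    show "0 \<in> ?V"
      using cfun.subspace_0[OF subspace_ext_power[of n r]] cfun.subspace_0[OF subspace_wedge_kernel]
      by blast
    show "x + y \<in> ?V" if xy: "x \<in> ?V" "y \<in> ?V" for x y
    proof -
      obtain k where k: "k \<in> wedge_kernel n r w" "?\<rho> k = ?\<rho> x" using xy(1) by blast
      obtain l where l: "l \<in> wedge_kernel n r w" "?\<rho> l = ?\<rho> y" using xy(2) by blast
      have "k + l \<in> wedge_kernel n r w" by (rule cfun.subspace_add[OF subspace_wedge_kernel k(1) l(1)])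
      moreover have "?\<rho> (k + l) = ?\<rho> (x + y)" by (simp only: lin(1) k(2) l(2))
      moreover have "x + y \<in> ext_power n r"
        by (rule cfun.subspace_add[OF subspace_ext_power]) (use xy in blast)+
      ultimately show ?thesis by blast
    qed
    show "fscale c x \<in> ?V" if x: "x \<in> ?V" for c x
    proof -
      obtain k where k: "k \<in> wedge_kernel n r w" "?\<rho> k = ?\<rho> x" using x by blast
      have "fscale c k \<in> wedge_kernel n r w"
        by (rule cfun.subspace_scale[OF subspace_wedge_kernel k(1)])
      moreover have "?\<rho> (fscale c k) = ?\<rho> (fscale c x)" by (simp only: lin(2) k(2))
      moreover have "fscale c x \<in> ext_power n r"
        by (rule cfun.subspace_scale[OF subspace_ext_power]) (use x in blast)
      ultimately show ?thesis by blast
    qed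
  qed
  have bas: "basis_fun T \<in> ?V" if "T \<in> ext_index n r" for T
    using that
  proof (induction "card (T \<inter> S)" arbitrary: T rule: less_induct)
    case less
    then have T: "T \<subseteq> {..<n}" "card T = r" "finite T"
      by (auto simp: ext_index_def intro: finite_subset)
    have bT: "basis_fun T \<in> ext_power n r" using T by (intro basis_fun_in_ext_power)
    show ?case
    proof (cases "T \<inter> S = {}")
      case True
      have "?\<rho> 0 = ?\<rho> (basis_fun T)"
        using True by (auto simp: meeting_part_def meeting_def basis_fun_def fun_eq_iff)
      then show ?thesis using bT cfun.subspace_0[OF subspace_wedge_kernel] by blast
    next
      case False
      then obtain s where s: "s \<in> T" "s \<in> S" by auto
      have fs: "f s \<in> ext_power n 1" using S(2) s by (auto simp: echelon_def)
      \<comment> \<open>The index \<open>s\<close> of \<open>T\<close> is replaced by the vector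
        \<open>f s\<close>. The product is killed by \<open>w\<close>, and its coefficient at
        \<open>T\<close> is nonzero. All other sets in its support arise from \<open>T\<close> by
        exchanging \<open>s\<close> for a non-pivot, so they meet \<open>S\<close> in fewer
        elements.\<close>
      let ?x = "wedge (f s) (basis_fun (T - {s}))"
      let ?c = "?x T"
      have ne: "s \<in> T" "T - (T - {s}) = {s}" using s by auto
      have c: "?c \<noteq> 0"
        using T S(2) s unfolding wedge_basis_fun ne(2) by (auto simp: echelon_def)
      have "basis_fun (T - {s}) \<in> ext_power n (r - 1)"
        using T s by (intro basis_fun_in_ext_power) auto
      from wedge_in_ext_power[OF fs this] have x: "?x \<in> ext_power n r" using r by simp
      have "wedge w ?x = wedge (wedge w (f s)) (basis_fun (T - {s}))" by (rule wedge_assoc[symmetric])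
      also have "\<dots> = 0" unfolding S(3)[OF s(2)] by simp
      finally have xK: "?x \<in> wedge_kernel n r w" using x by (simp add: wedge_kernel_def)
      then have xV: "?x \<in> ?V" using x by blast
      have "?x - fscale ?c (basis_fun T) \<in> ?V"
      proof (rule in_subspace_if_basis[OF finite_ext_index[of n r] _ V])
        show d: "?x - fscale ?c (basis_fun T) \<in> coord_space (ext_index n r)"
          using x bT unfolding ext_power_def
          by (intro cfun.subspace_diff cfun.subspace_scale subspace_coord_space)
        fix R assume R: "R \<in> ext_index n r" "(?x - fscale ?c (basis_fun T)) R \<noteq> 0"
        have RT: "R \<noteq> T" using R(2) by (auto simp: fscale_apply basis_fun_def)
        then have "?x R \<noteq> 0" using R(2) by (simp add: fscale_apply basis_fun_def)
        then have a: "T - {s} \<subseteq> R" "f s (R - (T - {s})) \<noteq> 0" "finite R"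
          by (auto simp: wedge_basis_fun split: if_splits)
        then obtain t where t: "R - (T - {s}) = {t}"
          using ext_power_nonzeroD[OF fs] by (metis card_1_singletonE)
        have "R = insert t (T - {s})" using t a by auto
        have ts: "t \<noteq> s" using RT a t s by auto
        have "t \<notin> S"
          using S(2) s ts a(2) t by (auto simp: echelon_def)
        then have "R \<inter> S \<subset> T \<inter> S" using \<open>R = _\<close> s by auto
        then show "basis_fun R \<in> ?V"
          using T R(1) by (intro less psubset_card_mono) auto
      qed
      from cfun.subspace_diff[OF V xV this]
      have "fscale ?c (basis_fun T) \<in> ?V" unfolding diff_diff_eq2 add_diff_cancel_left' .
      then have "fscale (1 / ?c) (fscale ?c (basis_fun T)) \<in> ?V"
        by (rule cfun.subspace_scale[OF V])
      moreover have "fscale (1 / ?c) (fscale ?c (basis_fun T)) = basis_fun T"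
        using c by (simp add: fun_eq_iff fscale_apply)
      ultimately show ?thesis by metis
    qed
  qed
  have "coord_space (meeting n r S) \<subseteq> ?\<rho> ` wedge_kernel n r w"
  proof
    fix x assume x: "x \<in> coord_space (meeting n r S)"
    then have "x \<in> coord_space (ext_index n r)" by (auto simp: coord_space_def meeting_def)
    then have "x \<in> ?V" by (rule in_subspace_if_basis[OF finite_ext_index _ V bas])
    then obtain k where "k \<in> wedge_kernel n r w" "?\<rho> k = ?\<rho> x" by blast
    moreover have "?\<rho> x = x" using x by (auto simp: meeting_part_def coord_space_def)
    ultimately show "x \<in> ?\<rho> ` wedge_kernel n r w" by (metis imageI)
  qed
  then have "?\<rho> ` wedge_kernel n r w = coord_space (meeting n r S)"
    using meeting_part_image(2)[OF w(1) SI wS] by auto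
  then show ?thesis
    using meeting_part_image(4)[OF w(1) SI wS] dim_coord_space[OF finite_meeting]
      card_meeting[OF SI] by metis
qed

section \<open>Zariski tangent spaces\<close>

text \<open>A derivative in one variable along the line through \<open>a\<close>, so that the rules
  for \<open>deriv\<close> apply, as they do for \<open>partial\<close>.\<close>

definition dirderiv ::
  "('i \<Rightarrow> complex) \<Rightarrow> ('i \<Rightarrow> complex) \<Rightarrow> (('i \<Rightarrow> complex) \<Rightarrow> complex) \<Rightarrow> complex" where
  "dirderiv a v g = deriv (\<lambda>t. g (\<lambda>p. a p + t * v p)) 0"

lemma poly_fun_has_dirderiv:
  assumes "g \<in> poly_fun I"
  shows "((\<lambda>t. g (\<lambda>p. a p + t * v p)) has_field_derivative dirderiv a v g) (at 0)"
proof -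
  have "(\<lambda>t. g (\<lambda>p. a p + t * v p)) field_differentiable at 0"
    using assms
  proof induction
    case (add g h)
    then show ?case by (simp add: field_differentiable_add)
  next
    case (mult g h)
    then show ?case by (simp add: field_differentiable_mult)
  qed (auto intro!: derivative_intros)
  then show ?thesis unfolding dirderiv_def by (rule DERIV_deriv_iff_field_differentiable[THEN iffD2])
qed

lemma dirderivI:
  "((\<lambda>t. g (\<lambda>p. a p + t * v p)) has_field_derivative D) (at 0) \<Longrightarrow> dirderiv a v g = D"
  unfolding dirderiv_def by (rule DERIV_imp_deriv)

lemma dirderiv_const: "dirderiv a v (\<lambda>x. c) = 0"
  by (rule dirderivI) auto

lemma dirderiv_coord: "dirderiv a v (\<lambda>x. x p) = v p"
  by (rule dirderivI) (auto intro!: derivative_eq_intros)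

lemma dirderiv_add:
  assumes "g \<in> poly_fun I" "h \<in> poly_fun I"
  shows "dirderiv a v (g + h) = dirderiv a v g + dirderiv a v h"
  using DERIV_add[OF assms[THEN poly_fun_has_dirderiv, of a v]] by (intro dirderivI) simp

lemma dirderiv_mult:
  assumes "g \<in> poly_fun I" "h \<in> poly_fun I"
  shows "dirderiv a v (g * h) = dirderiv a v g * h a + g a * dirderiv a v h"
  using DERIV_mult[OF assms[THEN poly_fun_has_dirderiv, of a v]]
  by (intro dirderivI) (simp add: algebra_simps)

lemma poly_fun_scale: "g \<in> poly_fun I \<Longrightarrow> fscale c g \<in> poly_fun I"
proof -
  assume "g \<in> poly_fun I"
  then have "(\<lambda>a. c) * g \<in> poly_fun I" by (intro poly_fun.intros)
  then show ?thesis by (simp add: fscale_def times_fun_def)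
qed

lemma poly_fun_zero: "0 \<in> poly_fun I"
  unfolding zero_fun_def by (rule poly_fun.const)

lemma poly_fun_sum: "(\<And>i. i \<in> A \<Longrightarrow> g i \<in> poly_fun I) \<Longrightarrow> (\<Sum>i\<in>A. g i) \<in> poly_fun I"
proof (induction A rule: infinite_finite_induct)
  case (insert i A)
  then show ?case unfolding sum.insert[OF insert(1,2)] by (intro poly_fun.add) auto
qed (simp_all only: sum.infinite sum.empty poly_fun_zero not_False_eq_True)

lemma dirderiv_scale:
  assumes "g \<in> poly_fun I" shows "dirderiv a v (fscale c g) = c * dirderiv a v g"
  using DERIV_cmult[OF poly_fun_has_dirderiv[OF assms, of a v], of c]
  by (intro dirderivI) (simp add: fscale_def)

lemma dirderiv_zero: "dirderiv a v 0 = 0"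
  unfolding zero_fun_def by (rule dirderiv_const)

lemma dirderiv_sum:
  assumes "\<And>i. i \<in> A \<Longrightarrow> g i \<in> poly_fun I"
  shows "dirderiv a v (\<Sum>i\<in>A. g i) = (\<Sum>i\<in>A. dirderiv a v (g i))"
  using assms
proof (induction A rule: infinite_finite_induct)
  case (insert i A)
  then show ?case unfolding sum.insert[OF insert(1,2)]
    by (subst dirderiv_add[where I = I]) (auto intro: poly_fun_sum)
qed (simp_all only: sum.infinite sum.empty dirderiv_zero not_False_eq_True)

lemma poly_fun_shift:
  assumes "g \<in> poly_fun I" shows "(\<lambda>x. g x - c) \<in> poly_fun I"
proof -
  have "(\<lambda>x. g x - c) = g + (\<lambda>x. - c)" by (simp add: fun_eq_iff)
  then show ?thesis using poly_fun.add[OF assms poly_fun.const] by simp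
qed

lemma point_ideal_shift: "g \<in> poly_fun I \<Longrightarrow> (\<lambda>x. g x - g a) \<in> point_ideal I a"
  by (simp add: point_ideal_def poly_fun_shift)

lemma gen_ideal_base:
  assumes "g \<in> G" shows "g \<in> gen_ideal I G"
proof -
  have "g = (\<Sum>f\<in>{g}. (\<lambda>x. 1) * f)" by (simp add: fun_eq_iff)
  moreover have "\<forall>f\<in>{g}. (\<lambda>x. 1) \<in> poly_fun I" by (simp add: poly_fun.const)
  ultimately show ?thesis unfolding gen_ideal_def mem_Collect_eq
    using assms by (intro exI[of _ "{g}"] exI[of _ "\<lambda>_ _. 1"]) simp
qed

text \<open>After subtraction of the value at \<open>a\<close>, both sides obey the Leibniz rule at
  \<open>a\<close>, and they agree on the coordinates.\<close>

lemma zariski_tangent_eq_dirderiv: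
  assumes \<phi>: "\<phi> \<in> zariski_tangent I J a" and g: "g \<in> poly_fun I"
    and v: "\<And>p. p \<in> I \<Longrightarrow> v p = \<phi> (\<lambda>x. x p - a p)"
  shows "\<phi> (\<lambda>x. g x - g a) = dirderiv a v g"
proof -
  let ?M = "point_ideal I a"
  have \<phi>_add: "\<phi> (g + h) = \<phi> g + \<phi> h" if "g \<in> ?M" "h \<in> ?M" for g h
    using \<phi> that by (simp add: zariski_tangent_def)
  have scale: "\<phi> (fscale c g) = c * \<phi> g" if "g \<in> ?M" for c g
    using \<phi> that by (simp add: zariski_tangent_def)
  have \<phi>_mult: "\<phi> (g * h) = 0" if "g \<in> ?M" "h \<in> ?M" for g h
    using \<phi> that by (simp add: zariski_tangent_def)
  show ?thesis using g
  proof induction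
    case (const c)
    have "(0 :: ('a \<Rightarrow> complex) \<Rightarrow> complex) \<in> ?M" by (simp add: point_ideal_def poly_fun_zero)
    from scale[OF this, of 0] have "\<phi> 0 = 0" by (simp add: fscale_def zero_fun_def)
    then show ?case by (simp add: dirderiv_const zero_fun_def)
  next
    case (coord p)
    then show ?case by (simp add: dirderiv_coord v)
  next
    case (add g h)
    have "(\<lambda>x. (g + h) x - (g + h) a) = (\<lambda>x. g x - g a) + (\<lambda>x. h x - h a)"
      by (simp add: fun_eq_iff)
    then have "\<phi> (\<lambda>x. (g + h) x - (g + h) a) = \<phi> (\<lambda>x. g x - g a) + \<phi> (\<lambda>x. h x - h a)"
      using add.hyps by (simp only: \<phi>_add point_ideal_shift)
    also have "\<dots> = dirderiv a v (g + h)"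
      unfolding add.IH dirderiv_add[OF add.hyps] ..
    finally show ?case .
  next
    case (mult g h)
    let ?g = "\<lambda>x. g x - g a" and ?h = "\<lambda>x. h x - h a"
    have M: "?g \<in> ?M" "?h \<in> ?M" using mult by (simp_all add: point_ideal_shift)
    have M2: "?g * ?h \<in> ?M" "fscale (g a) ?h \<in> ?M" "fscale (h a) ?g \<in> ?M"
      "fscale (g a) ?h + fscale (h a) ?g \<in> ?M"
      using M by (auto simp: point_ideal_def fscale_apply intro!: poly_fun.mult poly_fun.add poly_fun_scale)
    \<comment> \<open>The product \<open>?g * ?h\<close> lies in the square of the maximal ideal and
      is killed; the remaining two terms give the Leibniz rule.\<close>
    have "(\<lambda>x. (g * h) x - (g * h) a) = ?g * ?h + (fscale (g a) ?h + fscale (h a) ?g)"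
      by (simp add: fun_eq_iff fscale_apply algebra_simps)
    then have "\<phi> (\<lambda>x. (g * h) x - (g * h) a) = 0 + (g a * \<phi> ?h + h a * \<phi> ?g)"
      using M M2 by (simp only: \<phi>_add \<phi>_mult scale)
    also have "\<dots> = dirderiv a v (g * h)"
      unfolding mult.IH dirderiv_mult[OF mult.hyps] by simp
    finally show ?case .
  qed
qed

lemma subspace_zariski_tangent: "cfun.subspace (zariski_tangent I J a)"
proof (rule cfun.subspaceI)
  show "0 \<in> zariski_tangent I J a" by (simp add: zariski_tangent_def)
qed (auto simp: zariski_tangent_def fscale_apply algebra_simps)

text \<open>A point derivation is determined by its values on the coordinate functions.\<close>

lemma dim_zariski_tangent:
  assumes G: "G \<subseteq> point_ideal I a"
  shows "cfun.dim (zariski_tangent I (gen_ideal I G) a) =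
    cfun.dim {v \<in> coord_space I. \<forall>g\<in>G. dirderiv a v g = 0}"
proof -
  let ?Z = "zariski_tangent I (gen_ideal I G) a" and ?M = "point_ideal I a"
  let ?T = "{v \<in> coord_space I. \<forall>g\<in>G. dirderiv a v g = 0}"
  let ?\<Psi> = "\<lambda>\<phi> p. if p \<in> I then \<phi> (\<lambda>x. x p - a p) else (0 :: complex)"
  have lin: "Vector_Spaces.linear fscale fscale ?\<Psi>"
    by (rule linear_fscaleI) (auto simp: fun_eq_iff fscale_apply)
  have eq: "\<phi> g = dirderiv a (?\<Psi> \<phi>) g" if "\<phi> \<in> ?Z" "g \<in> ?M" for \<phi> g
    using zariski_tangent_eq_dirderiv[OF that(1), of g "?\<Psi> \<phi>"] that(2)
    by (simp add: point_ideal_def)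
  have inj: "inj_on ?\<Psi> ?Z"
  proof (rule inj_onI)
    fix \<phi> \<psi> assume *: "\<phi> \<in> ?Z" "\<psi> \<in> ?Z" "?\<Psi> \<phi> = ?\<Psi> \<psi>"
    show "\<phi> = \<psi>"
    proof
      fix g
      show "\<phi> g = \<psi> g"
      proof (cases "g \<in> ?M")
        case True
        then show ?thesis using eq[OF *(1) True] eq[OF *(2) True] *(3) by simp
      next
        case False
        then show ?thesis using *(1,2) by (simp add: zariski_tangent_def)
      qed
    qed
  qed
  have "?\<Psi> ` ?Z = ?T"
  proof
    show "?\<Psi> ` ?Z \<subseteq> ?T"
    proof (rule image_subsetI)
      fix \<phi> assume \<phi>: "\<phi> \<in> ?Z"
      have "dirderiv a (?\<Psi> \<phi>) g = 0" if "g \<in> G" for g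
        using eq[OF \<phi>, of g] gen_ideal_base[OF that, of I] G that \<phi>
        by (auto simp: zariski_tangent_def)
      then show "?\<Psi> \<phi> \<in> ?T" by (simp add: coord_space_def)
    qed
    show "?T \<subseteq> ?\<Psi> ` ?Z"
    proof
      fix v assume v: "v \<in> ?T"
      \<comment> \<open>A direction in \<open>?T\<close> gives back a functional. It has to be cut
        off outside the maximal ideal, where the derivative need not vanish.\<close>
      let ?\<phi> = "\<lambda>g. if g \<in> ?M then dirderiv a v g else 0"
      have M: "g \<in> poly_fun I" "g a = 0" if "g \<in> ?M" for g
        using that by (simp_all add: point_ideal_def)
      have "?\<phi> f = 0" if f: "f \<in> gen_ideal I G" for f
      proof -
        obtain A h where A: "f = (\<Sum>g\<in>A. h g * g)" "A \<subseteq> G" "\<forall>g\<in>A. h g \<in> poly_fun I"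
          using f by (auto simp: gen_ideal_def)
        \<comment> \<open>Since \<open>g\<close> vanishes at \<open>a\<close>, the product rule
          leaves only \<open>h g a * dirderiv a v g\<close>, and \<open>v\<close> annihilates the
          generators.\<close>
        have "dirderiv a v (h g * g) = 0" if "g \<in> A" for g
        proof -
          have "g \<in> ?M" "h g \<in> poly_fun I" "dirderiv a v g = 0" using A G v that by auto
          then show ?thesis using M[of g] by (simp add: dirderiv_mult[of _ I])
        qed
        moreover have "h g * g \<in> poly_fun I" if "g \<in> A" for g
          using A G M that by (intro poly_fun.mult) auto
        ultimately have "dirderiv a v f = 0" unfolding A(1) by (subst dirderiv_sum[of _ _ I]) auto
        then show ?thesis by simp
      qed
      moreover have "g + h \<in> ?M" "g * h \<in> ?M" if "g \<in> ?M" "h \<in> ?M" for g h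
        using that by (auto simp: point_ideal_def intro: poly_fun.intros)
      moreover have "fscale c g \<in> ?M" if "g \<in> ?M" for g c
        using that by (auto simp: point_ideal_def fscale_apply intro: poly_fun_scale)
      ultimately have "?\<phi> \<in> ?Z"
        unfolding zariski_tangent_def using M
        by (simp add: dirderiv_add[of _ I] dirderiv_mult[of _ I] dirderiv_scale[of _ I]) (simp add: M(2))
      moreover have "?\<Psi> ?\<phi> = v"
      proof
        fix p
        show "?\<Psi> ?\<phi> p = v p"
        proof (cases "p \<in> I")
          case True
          have *: "(\<lambda>x. x p - a p) \<in> ?M"
            using point_ideal_shift[OF poly_fun.coord[OF True], of a] .
          have "dirderiv a v (\<lambda>x. x p - a p) = v p"
            by (rule dirderivI) (auto intro!: derivative_eq_intros)
          then show ?thesis using True * by simp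
        next
          case False
          then show ?thesis using v by (simp add: coord_space_def)
        qed
      qed
      ultimately show "v \<in> ?\<Psi> ` ?Z" by (intro image_eqI[of _ _ ?\<phi>]) (rule sym)
    qed
  qed
  then show ?thesis
    using dim_linear_image_inj[OF lin subspace_zariski_tangent inj] by simp
qed

section \<open>Multilinear forms in the standard charts\<close>

text \<open>The set of slots holding arbitrary span elements grows by one slot at a time: with the
  other slots fixed, the vectors at which \<open>L\<close> vanishes form a subspace containing the
  generators. Slots outside \<open>E\<close> act as parameters.\<close>

lemma multilinear_zero_extend:
  fixes L :: "('i \<Rightarrow> 'b \<Rightarrow> complex) \<Rightarrow> complex"
  assumes E: "finite E"
    and add: "\<And>i u x y. i \<in> E \<Longrightarrow> L (u(i := x + y)) = L (u(i := x)) + L (u(i := y))"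
    and scale: "\<And>i u c x. i \<in> E \<Longrightarrow> L (u(i := fscale c x)) = c * L (u(i := x))"
    and zero: "\<And>u. (\<And>i. i \<in> E \<Longrightarrow> u i \<in> X i) \<Longrightarrow> L u = 0"
    and u: "\<And>i. i \<in> E \<Longrightarrow> u i \<in> cfun.span (X i)"
  shows "L u = 0"
proof -
  have "L u = 0" if "D \<subseteq> E" "\<And>i. i \<in> D \<Longrightarrow> u i \<in> cfun.span (X i)" "\<And>i. i \<in> E - D \<Longrightarrow> u i \<in> X i"
    for D u
    using finite_subset[OF that(1) E] that
  proof (induction D arbitrary: u rule: finite_induct)
    case empty
    then show ?case using zero by simp
  next
    case (insert k D)
    have k: "k \<in> E" using insert by auto
    have "cfun.subspace {x. L (u(k := x)) = 0}"
    proof (rule cfun.subspaceI)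
      show "0 \<in> {x. L (u(k := x)) = 0}"
        using scale[OF k, of u 0 0] by (simp add: fscale_def zero_fun_def)
    qed (auto simp: add[OF k] scale[OF k])
    moreover have "X k \<subseteq> {x. L (u(k := x)) = 0}"
    proof
      fix x assume "x \<in> X k"
      then have "L (u(k := x)) = 0"
        using insert.prems insert.hyps by (intro insert.IH) auto
      then show "x \<in> {x. L (u(k := x)) = 0}" by simp
    qed
    ultimately have "cfun.span (X k) \<subseteq> {x. L (u(k := x)) = 0}" by (rule cfun.span_minimal[rotated])
    then have "L (u(k := u k)) = 0" using insert.prems by blast
    then show ?case by simp
  qed
  from this[of E u] show ?thesis using u by simp
qed

text \<open>Typically \<open>z\<close> is the point and \<open>u\<close> gives the vectors put into
  the differentiated slots \<open>E\<close>.\<close>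

definition mix :: "nat set \<Rightarrow> (nat \<Rightarrow> 'b \<Rightarrow> complex) \<Rightarrow> (nat \<Rightarrow> 'b \<Rightarrow> complex) \<Rightarrow> nat \<Rightarrow> 'b \<Rightarrow> complex" where
  "mix E u z = (\<lambda>i. if i \<in> E then u i else z i)"

text \<open>The slots of a chart direction, as vectors. The coordinate at \<open>\<sigma> i\<close>
  is 0 because the chart keeps it constantly equal to 1.\<close>

definition chart_dir :: "'b set \<Rightarrow> (nat \<Rightarrow> 'b) \<Rightarrow> (nat \<times> 'b \<Rightarrow> complex) \<Rightarrow> nat \<Rightarrow> 'b \<Rightarrow> complex" where
  "chart_dir B \<sigma> v i = (\<lambda>S. if S \<in> B \<and> S \<noteq> \<sigma> i then v (i, S) else 0)"

lemma chart_vec_line: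
  "chart_vec B \<sigma> (\<lambda>p. a p + t * v p) = (\<lambda>i. chart_vec B \<sigma> a i + fscale t (chart_dir B \<sigma> v i))"
  by (auto simp: chart_vec_def chart_dir_def fscale_apply fun_eq_iff)

lemma chart_vec_in_coord_space: "\<sigma> i \<in> B \<Longrightarrow> chart_vec B \<sigma> a i \<in> coord_space B"
  by (auto simp: chart_vec_def coord_space_def)

lemma chart_dir_in_coord_space: "chart_dir B \<sigma> v i \<in> coord_space B"
  by (auto simp: chart_dir_def coord_space_def)

text \<open>The chart vector has coordinate 1 at \<open>\<sigma> i\<close>, so subtracting its other
  coordinates recovers the missing basis vector.\<close>

lemma span_chart_vec:
  assumes B: "finite B" and \<sigma>: "\<sigma> i \<in> B"
  shows "coord_space B \<subseteq> cfun.span (insert (chart_vec B \<sigma> a i) (basis_fun ` (B - {\<sigma> i})))"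
proof -
  let ?V = "cfun.span (insert (chart_vec B \<sigma> a i) (basis_fun ` (B - {\<sigma> i})))"
  let ?z = "chart_vec B \<sigma> a i"
  have b: "basis_fun S \<in> ?V" if "S \<in> B" "S \<noteq> \<sigma> i" for S
    using that by (intro cfun.span_base) auto
  have "?z - basis_fun (\<sigma> i) \<in> ?V"
  proof (rule in_subspace_if_basis[OF B _ cfun.subspace_span])
    show "?z - basis_fun (\<sigma> i) \<in> coord_space B"
      by (intro cfun.subspace_diff subspace_coord_space chart_vec_in_coord_space
        basis_fun_in_coord_space \<sigma>)
    fix S assume "S \<in> B" "(?z - basis_fun (\<sigma> i)) S \<noteq> 0"
    then show "basis_fun S \<in> ?V" by (intro b) (auto simp: chart_vec_def basis_fun_def)
  qed
  moreover have "?z \<in> ?V" by (rule cfun.span_base) simp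
  ultimately have "?z - (?z - basis_fun (\<sigma> i)) \<in> ?V" by (rule cfun.span_diff[rotated])
  then have "basis_fun (\<sigma> i) \<in> ?V" unfolding diff_diff_eq2 add_diff_cancel_left' .
  then have "basis_fun S \<in> ?V" if "S \<in> B" for S using b that by metis
  then show ?thesis using in_subspace_if_basis[OF B _ cfun.subspace_span] by blast
qed

text \<open>Arguments are functions on all natural numbers; \<open>F_cong\<close> says that only the
  first \<open>m\<close> slots matter.\<close>

locale multilinear_form =
  fixes m :: nat and B :: "'b set" and F :: "(nat \<Rightarrow> 'b \<Rightarrow> complex) \<Rightarrow> complex"
  assumes finite_B: "finite B"
    and F_add: "i < m \<Longrightarrow> F (w(i := x + y)) = F (w(i := x)) + F (w(i := y))"
    and F_scale: "i < m \<Longrightarrow> F (w(i := fscale c x)) = c * F (w(i := x))"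
    and F_cong: "(\<And>i. i < m \<Longrightarrow> w i = w' i) \<Longrightarrow> F w = F w'"
begin

lemma F_zero: "i < m \<Longrightarrow> w i = 0 \<Longrightarrow> F w = 0"
  using F_scale[of i w 0 0] fun_upd_triv[of w i] by (simp add: fscale_def zero_fun_def)

lemma F_sum: "i < m \<Longrightarrow> F (w(i := (\<Sum>s\<in>A. x s))) = (\<Sum>s\<in>A. F (w(i := x s)))"
proof (induction A rule: infinite_finite_induct)
  case (insert s A)
  then show ?case unfolding sum.insert[OF insert(1,2)] by (simp only: F_add)
qed (simp_all only: sum.infinite sum.empty not_False_eq_True F_zero fun_upd_same)

text \<open>Expanding one slot after the other in the standard basis leaves sums of products of
  coordinate functions with constants. The basis vectors already chosen are stored in
  \<open>u\<close>, which is therefore arbitrary in the induction.\<close>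

lemma F_poly_fun:
  assumes x: "\<And>i a. i < m \<Longrightarrow> x a i \<in> coord_space B"
    and xp: "\<And>i S. i < m \<Longrightarrow> S \<in> B \<Longrightarrow> (\<lambda>a. x a i S) \<in> poly_fun I"
  shows "(\<lambda>a. F (x a)) \<in> poly_fun I"
proof -
  have "(\<lambda>a. F (mix E (x a) u)) \<in> poly_fun I" if "finite E" "E \<subseteq> {..<m}" for E u
    using that
  proof (induction E arbitrary: u rule: finite_induct)
    case empty
    then show ?case by (simp add: mix_def poly_fun.const)
  next
    case (insert k E)
    have k: "k < m" using insert by auto
    have "F (mix (insert k E) (x a) u) =
        (\<Sum>S\<in>B. x a k S * F (mix E (x a) (u(k := basis_fun S))))" for a
    proof -
      have "mix (insert k E) (x a) u = (mix E (x a) u)(k := x a k)"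
        by (auto simp: mix_def fun_eq_iff)
      also have "\<dots> = (mix E (x a) u)(k := (\<Sum>S\<in>B. fscale (x a k S) (basis_fun S)))"
        using coord_space_expand[OF finite_B x[OF k]] by metis
      finally have "F (mix (insert k E) (x a) u) =
          (\<Sum>S\<in>B. x a k S * F ((mix E (x a) u)(k := basis_fun S)))"
        by (simp only: F_sum[OF k] F_scale[OF k])
      moreover have "(mix E (x a) u)(k := basis_fun S) = mix E (x a) (u(k := basis_fun S))" for S
        using insert.hyps by (auto simp: mix_def fun_eq_iff)
      ultimately show ?thesis by (simp only:)
    qed
    then have "(\<lambda>a. F (mix (insert k E) (x a) u)) =
        (\<Sum>S\<in>B. (\<lambda>a. x a k S) * (\<lambda>a. F (mix E (x a) (u(k := basis_fun S)))))"
      by (auto simp: fun_eq_iff sum_fun_apply)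
    also have "\<dots> \<in> poly_fun I"
      using insert.prems k by (intro poly_fun_sum poly_fun.mult xp insert.IH) auto
    finally show ?case .
  qed
  from this[of "{..<m}" undefined] have "(\<lambda>a. F (mix {..<m} (x a) undefined)) \<in> poly_fun I" by simp
  also have "(\<lambda>a. F (mix {..<m} (x a) undefined)) = (\<lambda>a. F (x a))"
    by (auto simp: mix_def intro!: F_cong)
  finally show ?thesis .
qed

text \<open>The product rule for multilinear maps. Splitting off slot \<open>k\<close> produces a
  summand \<open>t\<close> times an expression of the same kind with \<open>y k\<close> in that
  slot, so the induction runs over all base points \<open>x\<close>.\<close>

lemma F_has_derivative:
  "((\<lambda>t. F (\<lambda>i. x i + fscale t (y i))) has_field_derivative (\<Sum>i<m. F (x(i := y i)))) (at 0)"
proof -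
  have "((\<lambda>t. F (mix E (\<lambda>i. x i + fscale t (y i)) x)) has_field_derivative
      (\<Sum>i\<in>E. F (x(i := y i)))) (at 0)" if "finite E" "E \<subseteq> {..<m}" for E x
    using that
  proof (induction E arbitrary: x rule: finite_induct)
    case empty
    then show ?case by (simp add: mix_def)
  next
    case (insert k E)
    have k: "k < m" using insert by auto
    let ?x = "x(k := y k)"
    have eq: "F (mix (insert k E) (\<lambda>i. x i + fscale t (y i)) x) =
        F (mix E (\<lambda>i. x i + fscale t (y i)) x) + t * F (mix E (\<lambda>i. ?x i + fscale t (y i)) ?x)" for t
    proof -
      let ?z = "mix E (\<lambda>i. x i + fscale t (y i)) x"
      have "mix (insert k E) (\<lambda>i. x i + fscale t (y i)) x = ?z(k := x k + fscale t (y k))"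
        by (auto simp: mix_def fun_eq_iff)
      then have "F (mix (insert k E) (\<lambda>i. x i + fscale t (y i)) x) =
          F (?z(k := x k)) + t * F (?z(k := y k))"
        by (simp only: F_add[OF k] F_scale[OF k])
      moreover have "?z(k := x k) = ?z" "?z(k := y k) = mix E (\<lambda>i. ?x i + fscale t (y i)) ?x"
        using insert.hyps by (auto simp: mix_def fun_eq_iff)
      ultimately show ?thesis by simp
    qed
    have z: "mix E (\<lambda>i. ?x i + fscale 0 (y i)) ?x = ?x"
      by (auto simp: mix_def fun_eq_iff fscale_apply)
    \<comment> \<open>The derivative of \<open>t * G t\<close> at 0 is \<open>G 0\<close>; for the
      modified base point the induction hypothesis contributes only differentiability.\<close>
    have "((\<lambda>t. F (mix E (\<lambda>i. x i + fscale t (y i)) x) + t * F (mix E (\<lambda>i. ?x i + fscale t (y i)) ?x))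
        has_field_derivative (\<Sum>i\<in>E. F (x(i := y i))) +
          (1 * F (mix E (\<lambda>i. ?x i + fscale 0 (y i)) ?x) + (\<Sum>i\<in>E. F (?x(i := y i))) * 0)) (at 0)"
      using insert.prems by (intro DERIV_add DERIV_mult DERIV_ident insert.IH) blast+
    moreover have "(\<Sum>i\<in>E. F (x(i := y i))) +
        (1 * F (mix E (\<lambda>i. ?x i + fscale 0 (y i)) ?x) + (\<Sum>i\<in>E. F (?x(i := y i))) * 0) =
        (\<Sum>i\<in>insert k E. F (x(i := y i)))"
      unfolding z sum.insert[OF insert.hyps] mult_1 mult_zero_right add_0_right
      by (rule add.commute)
    ultimately show ?case unfolding eq by (simp only:)
  qed
  from this[of "{..<m}" x] show ?thesis
    using F_cong[of "mix {..<m} (\<lambda>i. x i + fscale _ (y i)) x" "\<lambda>i. x i + fscale _ (y i)"]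
    by (simp add: mix_def cong: F_cong)
qed

section \<open>Iterated partial derivatives of the local equation in one chart\<close>

context
  fixes \<sigma> :: "nat \<Rightarrow> 'b"
  assumes \<sigma>: "\<And>i. i < m \<Longrightarrow> \<sigma> i \<in> B"
begin

text \<open>\<open>E\<close> is the set of differentiated slots and \<open>\<tau>\<close> selects
  the coordinate in each. One coordinate per slot is enough, since a second derivative in the same
  slot is zero.\<close>

definition chart_assignment :: "nat set \<Rightarrow> (nat \<Rightarrow> 'b) \<Rightarrow> bool" where
  "chart_assignment E \<tau> \<longleftrightarrow> E \<subseteq> {..<m} \<and> (\<forall>i\<in>E. \<tau> i \<in> B \<and> \<tau> i \<noteq> \<sigma> i)"

definition chart_partial :: "nat set \<Rightarrow> (nat \<Rightarrow> 'b) \<Rightarrow> (nat \<times> 'b \<Rightarrow> complex) \<Rightarrow> complex" where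
  "chart_partial E \<tau> a = F (mix E (\<lambda>i. basis_fun (\<tau> i)) (chart_vec B \<sigma> a))"

lemma local_eq_chart_partial: "local_eq B F \<sigma> = chart_partial {} \<tau>"
  by (simp add: local_eq_def chart_partial_def mix_def fun_eq_iff)

text \<open>The expression is affine in the coordinates of an untouched slot, so differentiation
  replaces the vector there by the coordinate direction; a differentiated slot is already
  constant.\<close>

lemma partial_chart_partial:
  assumes p: "(i, S) \<in> chart_index m B \<sigma>"
  shows "partial (i, S) (chart_partial E \<tau>) =
    (if i \<in> E then 0 else chart_partial (insert i E) (\<tau>(i := S)))"
proof
  fix a
  have i: "i < m" "S \<in> B" "S \<noteq> \<sigma> i" using p by (auto simp: chart_index_def)
  have up: "chart_vec B \<sigma> (a((i, S) := t)) =
      (chart_vec B \<sigma> a)(i := chart_vec B \<sigma> a i + fscale (t - a (i, S)) (basis_fun S))" for t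
    using i by (auto simp: chart_vec_def fun_eq_iff fscale_apply basis_fun_def)
  show "partial (i, S) (chart_partial E \<tau>) a =
      (if i \<in> E then 0 else chart_partial (insert i E) (\<tau>(i := S))) a"
  proof (cases "i \<in> E")
    case True
    then have "chart_partial E \<tau> (a((i, S) := t)) = chart_partial E \<tau> a" for t
      unfolding chart_partial_def by (intro arg_cong[where f = F]) (auto simp: mix_def up fun_eq_iff)
    then show ?thesis using True by (simp add: partial_def)
  next
    case False
    let ?z = "mix E (\<lambda>i. basis_fun (\<tau> i)) (chart_vec B \<sigma> a)"
    have "chart_partial E \<tau> (a((i, S) := t)) =
        F ?z + (t - a (i, S)) * chart_partial (insert i E) (\<tau>(i := S)) a" for t
    proof -
      have "mix E (\<lambda>i. basis_fun (\<tau> i)) (chart_vec B \<sigma> (a((i, S) := t))) =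
          ?z(i := chart_vec B \<sigma> a i + fscale (t - a (i, S)) (basis_fun S))"
        using False unfolding up by (auto simp: mix_def fun_eq_iff)
      then have "chart_partial E \<tau> (a((i, S) := t)) =
          F (?z(i := chart_vec B \<sigma> a i)) + (t - a (i, S)) * F (?z(i := basis_fun S))"
        by (simp only: chart_partial_def F_add[OF i(1)] F_scale[OF i(1)])
      moreover have "?z(i := chart_vec B \<sigma> a i) = ?z"
        using False by (auto simp: mix_def fun_eq_iff)
      moreover have "?z(i := basis_fun S) =
          mix (insert i E) (\<lambda>j. basis_fun ((\<tau>(i := S)) j)) (chart_vec B \<sigma> a)"
        by (auto simp: mix_def fun_eq_iff)
      ultimately show ?thesis by (simp add: chart_partial_def)
    qed
    moreover have "((\<lambda>t. F ?z + (t - a (i, S)) * chart_partial (insert i E) (\<tau>(i := S)) a)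
        has_field_derivative chart_partial (insert i E) (\<tau>(i := S)) a) (at (a (i, S)))"
      by (auto intro!: derivative_eq_intros)
    ultimately show ?thesis
      using False by (simp add: partial_def DERIV_imp_deriv)
  qed
qed

definition chart_partials :: "nat \<Rightarrow> ((nat \<times> 'b \<Rightarrow> complex) \<Rightarrow> complex) set" where
  "chart_partials k = {chart_partial E \<tau> |E \<tau>. chart_assignment E \<tau> \<and> card E < k}"

lemma finite_chart_assignment: "chart_assignment E \<tau> \<Longrightarrow> finite E"
  by (auto simp: chart_assignment_def intro: finite_subset)

lemma fold_partial_zero: "fold partial ps 0 = 0"
proof (induction ps)
  case (Cons p ps)
  have "partial p 0 = 0" by (auto simp: partial_def)
  then show ?case using Cons by (simp only: fold_simps)
qed (simp only: fold_simps)

lemma fold_partial_chart_partial: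
  assumes "set ps \<subseteq> chart_index m B \<sigma>" "chart_assignment E \<tau>"
  shows "fold partial ps (chart_partial E \<tau>) \<in> insert 0 (chart_partials (Suc (card E + length ps)))"
  using assms
proof (induction ps arbitrary: E \<tau>)
  case Nil
  then show ?case by (auto simp: chart_partials_def)
next
  case (Cons p ps)
  obtain i S where p: "p = (i, S)" by (cases p)
  have iS: "(i, S) \<in> chart_index m B \<sigma>" using Cons p by simp
  show ?case
  proof (cases "i \<in> E")
    case True
    then have "partial p (chart_partial E \<tau>) = 0" using partial_chart_partial[OF iS, of E \<tau>] p by simp
    then have "fold partial (p # ps) (chart_partial E \<tau>) = 0"
      by (simp only: fold_simps fold_partial_zero)
    then show ?thesis by blast
  next
    case False
    have "partial p (chart_partial E \<tau>) = chart_partial (insert i E) (\<tau>(i := S))"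
      using partial_chart_partial[OF iS, of E \<tau>] p False by simp
    moreover have "chart_assignment (insert i E) (\<tau>(i := S))"
      using Cons.prems iS by (auto simp: chart_assignment_def chart_index_def)
    moreover have "card (insert i E) = Suc (card E)"
      using False finite_chart_assignment[OF Cons.prems(2)] by simp
    moreover have "set ps \<subseteq> chart_index m B \<sigma>" using Cons.prems by simp
    ultimately show ?thesis
      using Cons.IH[of "insert i E" "\<tau>(i := S)"]
      by (simp only: fold_simps list.size add_Suc add_Suc_right add_0_right)
  qed
qed

lemma partials_below_subset:
  "partials_below (chart_index m B \<sigma>) k (local_eq B F \<sigma>) \<subseteq> insert 0 (chart_partials k)"
proof
  fix g assume "g \<in> partials_below (chart_index m B \<sigma>) k (local_eq B F \<sigma>)"
  then obtain ps where ps: "set ps \<subseteq> chart_index m B \<sigma>" "length ps < k"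
    "g = fold partial ps (chart_partial {} \<sigma>)"
    unfolding partials_below_def local_eq_chart_partial[of \<sigma>] by blast
  have "chart_assignment {} \<sigma>" by (simp add: chart_assignment_def)
  have "chart_partials (Suc (card ({} :: nat set) + length ps)) \<subseteq> chart_partials k"
    using ps(2) unfolding chart_partials_def by fastforce
  then show "g \<in> insert 0 (chart_partials k)"
    using fold_partial_chart_partial[OF ps(1) \<open>chart_assignment {} \<sigma>\<close>] ps(3) by blast
qed

lemma chart_partials_subset:
  "chart_partials k \<subseteq> partials_below (chart_index m B \<sigma>) k (local_eq B F \<sigma>)"
proof
  have ex: "\<exists>ps. set ps \<subseteq> chart_index m B \<sigma> \<and> length ps = card E \<and>
      chart_partial E \<tau> = fold partial ps (chart_partial {} \<tau>)"
    if "finite E" "chart_assignment E \<tau>" for E \<tau>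
    using that
  proof (induction E rule: finite_induct)
    case empty
    then show ?case by simp
  next
    case (insert i E)
    then have "chart_assignment E \<tau>" by (simp add: chart_assignment_def)
    then obtain ps where ps: "set ps \<subseteq> chart_index m B \<sigma>" "length ps = card E"
      "chart_partial E \<tau> = fold partial ps (chart_partial {} \<tau>)" using insert by blast
    have iS: "(i, \<tau> i) \<in> chart_index m B \<sigma>"
      using insert.prems by (auto simp: chart_assignment_def chart_index_def)
    have "fold partial (ps @ [(i, \<tau> i)]) (chart_partial {} \<tau>) = chart_partial (insert i E) \<tau>"
      using insert.hyps ps(3)[symmetric] partial_chart_partial[OF iS, of E \<tau>] by simp
    then show ?case using ps iS insert.hyps by (intro exI[of _ "ps @ [(i, \<tau> i)]"]) simp
  qed
  fix g assume "g \<in> chart_partials k"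
  then obtain E \<tau> where E: "chart_assignment E \<tau>" "card E < k" "g = chart_partial E \<tau>"
    by (auto simp: chart_partials_def)
  obtain ps where "set ps \<subseteq> chart_index m B \<sigma>" "length ps = card E"
    "g = fold partial ps (chart_partial {} \<tau>)"
    using ex[OF finite_chart_assignment[OF E(1)] E(1)] E(3) by blast
  then show "g \<in> partials_below (chart_index m B \<sigma>) k (local_eq B F \<sigma>)"
    using E(2) unfolding partials_below_def local_eq_chart_partial[of \<tau>] by auto
qed

lemma chart_partial_poly_fun:
  assumes "chart_assignment E \<tau>"
  shows "chart_partial E \<tau> \<in> poly_fun (chart_index m B \<sigma>)"
  unfolding chart_partial_def
proof (rule F_poly_fun)
  fix i a assume "i < m"
  then show "mix E (\<lambda>i. basis_fun (\<tau> i)) (chart_vec B \<sigma> a) i \<in> coord_space B"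
    using \<sigma> assms
    by (auto simp: mix_def chart_assignment_def intro: chart_vec_in_coord_space basis_fun_in_coord_space)
next
  fix i S assume i: "i < m" "S \<in> B"
  have "(\<lambda>a. chart_vec B \<sigma> a i S) \<in> poly_fun (chart_index m B \<sigma>)"
    using i by (cases "S = \<sigma> i") (auto simp: chart_vec_def chart_index_def intro: poly_fun.intros)
  then show "(\<lambda>a. mix E (\<lambda>i. basis_fun (\<tau> i)) (chart_vec B \<sigma> a) i S) \<in> poly_fun (chart_index m B \<sigma>)"
    by (cases "i \<in> E") (auto simp: mix_def intro: poly_fun.const)
qed

lemma sing_ideal_vanish_iff:
  "(\<forall>g\<in>sing_ideal m B F k \<sigma>. g a = 0) \<longleftrightarrow>
   (\<forall>E \<tau>. chart_assignment E \<tau> \<longrightarrow> card E < k \<longrightarrow> chart_partial E \<tau> a = 0)"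
proof
  assume L: "\<forall>g\<in>sing_ideal m B F k \<sigma>. g a = 0"
  show "\<forall>E \<tau>. chart_assignment E \<tau> \<longrightarrow> card E < k \<longrightarrow> chart_partial E \<tau> a = 0"
  proof (intro allI impI)
    fix E \<tau> assume "chart_assignment E \<tau>" "card E < k"
    then have "chart_partial E \<tau> \<in> sing_ideal m B F k \<sigma>"
      using chart_partials_subset unfolding sing_ideal_def
      by (intro gen_ideal_base) (auto simp: chart_partials_def)
    then show "chart_partial E \<tau> a = 0" using L by blast
  qed
next
  assume R: "\<forall>E \<tau>. chart_assignment E \<tau> \<longrightarrow> card E < k \<longrightarrow> chart_partial E \<tau> a = 0"
  then have "g a = 0" if "g \<in> partials_below (chart_index m B \<sigma>) k (local_eq B F \<sigma>)" for g
    using partials_below_subset[of k] that by (auto simp: chart_partials_def)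
  then show "\<forall>g\<in>sing_ideal m B F k \<sigma>. g a = 0"
    by (auto simp: sing_ideal_def gen_ideal_def sum_fun_apply subset_iff intro!: sum.neutral)
qed

text \<open>The slots in \<open>E\<close> hold constant vectors, so the direction enters only
  through the remaining ones.\<close>

lemma dirderiv_chart_partial:
  "dirderiv a v (chart_partial E \<tau>) = (\<Sum>i\<in>{..<m} - E.
     F ((mix E (\<lambda>i. basis_fun (\<tau> i)) (chart_vec B \<sigma> a))(i := chart_dir B \<sigma> v i)))"
proof -
  let ?x = "mix E (\<lambda>i. basis_fun (\<tau> i)) (chart_vec B \<sigma> a)"
  let ?y = "mix E (\<lambda>i. 0) (chart_dir B \<sigma> v)"
  have "mix E (\<lambda>i. basis_fun (\<tau> i)) (chart_vec B \<sigma> (\<lambda>p. a p + t * v p)) =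
      (\<lambda>i. ?x i + fscale t (?y i))" for t
    unfolding chart_vec_line by (auto simp: mix_def fun_eq_iff fscale_apply)
  then have "dirderiv a v (chart_partial E \<tau>) = (\<Sum>i<m. F (?x(i := ?y i)))"
    using F_has_derivative[of ?x ?y] by (intro dirderivI) (simp add: chart_partial_def)
  also have "\<dots> = (\<Sum>i\<in>{..<m} - E. F (?x(i := ?y i)))"
  proof (rule sum.mono_neutral_right)
    show "\<forall>i\<in>{..<m} - ({..<m} - E). F (?x(i := ?y i)) = 0"
      by (auto simp: mix_def zero_fun_def intro!: F_zero)
  qed auto
  also have "\<dots> = (\<Sum>i\<in>{..<m} - E. F (?x(i := chart_dir B \<sigma> v i)))"
    by (intro sum.cong) (auto simp: mix_def)
  finally show ?thesis .
qed

lemma dim_zariski_tangent_sing: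
  assumes van: "\<forall>g\<in>sing_ideal m B F k \<sigma>. g a = 0"
  shows "cfun.dim (zariski_tangent (chart_index m B \<sigma>) (sing_ideal m B F k \<sigma>) a) =
    cfun.dim {v \<in> coord_space (chart_index m B \<sigma>). \<forall>E \<tau>. chart_assignment E \<tau> \<longrightarrow> card E < k \<longrightarrow>
      (\<Sum>i\<in>{..<m} - E. F ((mix E (\<lambda>i. basis_fun (\<tau> i)) (chart_vec B \<sigma> a))
        (i := chart_dir B \<sigma> v i))) = 0}"
proof -
  let ?G = "partials_below (chart_index m B \<sigma>) k (local_eq B F \<sigma>)"
  have "?G \<subseteq> point_ideal (chart_index m B \<sigma>) a"
  proof
    fix g assume g: "g \<in> ?G"
    then have "g a = 0" using van gen_ideal_base[of g ?G] by (auto simp: sing_ideal_def)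
    moreover have "g \<in> poly_fun (chart_index m B \<sigma>)"
      using partials_below_subset[of k] g poly_fun_zero chart_partial_poly_fun
      by (auto simp: chart_partials_def)
    ultimately show "g \<in> point_ideal (chart_index m B \<sigma>) a" by (simp add: point_ideal_def)
  qed
  from dim_zariski_tangent[OF this]
  have "cfun.dim (zariski_tangent (chart_index m B \<sigma>) (sing_ideal m B F k \<sigma>) a) =
    cfun.dim {v \<in> coord_space (chart_index m B \<sigma>). \<forall>g\<in>?G. dirderiv a v g = 0}"
    by (simp add: sing_ideal_def)
  moreover have "(\<forall>g\<in>?G. dirderiv a v g = 0) \<longleftrightarrow> (\<forall>g\<in>chart_partials k. dirderiv a v g = 0)" for v
    using partials_below_subset[of k] chart_partials_subset[of k] dirderiv_zero[of a v] by blast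
  moreover have "(\<forall>g\<in>chart_partials k. dirderiv a v g = 0) \<longleftrightarrow> (\<forall>E \<tau>. chart_assignment E \<tau> \<longrightarrow>
      card E < k \<longrightarrow> dirderiv a v (chart_partial E \<tau>) = 0)" for v
    by (auto simp: chart_partials_def)
  ultimately show ?thesis by (simp only: dirderiv_chart_partial)
qed

text \<open>A generator is either a coordinate direction or the vector of the point. In the second
  case the slot may be regarded as undifferentiated, which only lowers the order of the
  derivative.\<close>

lemma chart_generators:
  assumes "\<And>i. i \<in> E \<Longrightarrow> u i \<in> insert (chart_vec B \<sigma> a i) (basis_fun ` (B - {\<sigma> i}))"
    and E: "E \<subseteq> {..<m}"
  obtains E' \<tau> where "E' \<subseteq> E" "chart_assignment E' \<tau>"
    "mix E u (chart_vec B \<sigma> a) = mix E' (\<lambda>i. basis_fun (\<tau> i)) (chart_vec B \<sigma> a)"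
proof -
  define E' where "E' = {i \<in> E. u i \<in> basis_fun ` (B - {\<sigma> i})}"
  have "\<forall>i\<in>E'. \<exists>S. S \<in> B - {\<sigma> i} \<and> u i = basis_fun S" by (auto simp: E'_def)
  then obtain \<tau> where \<tau>: "\<And>i. i \<in> E' \<Longrightarrow> \<tau> i \<in> B - {\<sigma> i} \<and> u i = basis_fun (\<tau> i)" by metis
  show thesis
  proof (rule that)
    show "E' \<subseteq> E" by (auto simp: E'_def)
    then show "chart_assignment E' \<tau>" using \<tau> E by (auto simp: chart_assignment_def)
    show "mix E u (chart_vec B \<sigma> a) = mix E' (\<lambda>i. basis_fun (\<tau> i)) (chart_vec B \<sigma> a)"
    proof
      fix i
      show "mix E u (chart_vec B \<sigma> a) i = mix E' (\<lambda>i. basis_fun (\<tau> i)) (chart_vec B \<sigma> a) i"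
      proof (cases "i \<in> E'")
        case True
        then have "i \<in> E" unfolding E'_def by blast
        moreover have "u i = basis_fun (\<tau> i)" using \<tau>[OF True] by blast
        ultimately show ?thesis using True by (simp only: mix_def if_True)
      next
        case False
        then have "i \<in> E \<Longrightarrow> u i = chart_vec B \<sigma> a i" using assms(1)[of i] by (auto simp: E'_def)
        then show ?thesis using False by (simp only: mix_def if_False split: if_split) simp
      qed
    qed
  qed
qed

text \<open>Coordinate directions and the vector of the point span each slot. By multilinearity,
  vanishing of the partial derivatives of order below \<open>k\<close> therefore allows any vectors
  in fewer than \<open>k\<close> slots, with the point in the others.\<close>

lemma chart_partials_vanish_extend:
  assumes van: "\<And>E \<tau>. chart_assignment E \<tau> \<Longrightarrow> card E < k \<Longrightarrow> chart_partial E \<tau> a = 0"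
    and E: "E \<subseteq> {..<m}" "card E < k" and u: "\<And>i. i \<in> E \<Longrightarrow> u i \<in> coord_space B"
  shows "F (mix E u (chart_vec B \<sigma> a)) = 0"
proof (rule multilinear_zero_extend[where L = "\<lambda>u. F (mix E u (chart_vec B \<sigma> a))" and E = E
      and X = "\<lambda>i. insert (chart_vec B \<sigma> a i) (basis_fun ` (B - {\<sigma> i}))"])
  show fin: "finite E" using E by (auto intro: finite_subset)
  have upd: "mix E (u(i := x)) (chart_vec B \<sigma> a) = (mix E u (chart_vec B \<sigma> a))(i := x)" if "i \<in> E" for i u x
    using that by (auto simp: mix_def fun_eq_iff)
  show "F (mix E (u(i := x + y)) (chart_vec B \<sigma> a)) =
      F (mix E (u(i := x)) (chart_vec B \<sigma> a)) + F (mix E (u(i := y)) (chart_vec B \<sigma> a))"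
    if "i \<in> E" for i u x y
    unfolding upd[OF that] using that E by (intro F_add) auto
  show "F (mix E (u(i := fscale c x)) (chart_vec B \<sigma> a)) = c * F (mix E (u(i := x)) (chart_vec B \<sigma> a))"
    if "i \<in> E" for i u c x
    unfolding upd[OF that] using that E by (intro F_scale) auto
  show "F (mix E u (chart_vec B \<sigma> a)) = 0"
    if X: "\<And>i. i \<in> E \<Longrightarrow> u i \<in> insert (chart_vec B \<sigma> a i) (basis_fun ` (B - {\<sigma> i}))" for u
  proof -
    obtain E' \<tau> where E': "E' \<subseteq> E" "chart_assignment E' \<tau>"
      "mix E u (chart_vec B \<sigma> a) = mix E' (\<lambda>i. basis_fun (\<tau> i)) (chart_vec B \<sigma> a)"
      by (rule chart_generators[OF X E(1)])
    have "card E' < k" using card_mono[OF fin E'(1)] E(2) by simp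
    then show ?thesis using van[OF E'(2)] E'(3) by (simp add: chart_partial_def)
  qed
  show "u i \<in> cfun.span (insert (chart_vec B \<sigma> a i) (basis_fun ` (B - {\<sigma> i})))" if "i \<in> E" for i
    using span_chart_vec[where i = i and a = a and \<sigma> = \<sigma>, OF finite_B \<sigma>] u[OF that] that E(1) by blast
qed

text \<open>The linearised counterpart. Regarding a slot that holds the point as undifferentiated
  adds summands here; they vanish because the point itself has multiplicity at least
  \<open>k\<close>.\<close>

lemma chart_partials_derivative_extend:
  assumes van: "\<And>E \<tau>. chart_assignment E \<tau> \<Longrightarrow> card E < k \<Longrightarrow> chart_partial E \<tau> a = 0"
    and tan: "\<And>E \<tau>. chart_assignment E \<tau> \<Longrightarrow> card E < k \<Longrightarrow> (\<Sum>i\<in>{..<m} - E.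
      F ((mix E (\<lambda>i. basis_fun (\<tau> i)) (chart_vec B \<sigma> a))(i := d i))) = 0"
    and d: "\<And>i. d i \<in> coord_space B"
    and E: "E \<subseteq> {..<m}" "card E < k" and u: "\<And>i. i \<in> E \<Longrightarrow> u i \<in> coord_space B"
  shows "(\<Sum>i\<in>{..<m} - E. F ((mix E u (chart_vec B \<sigma> a))(i := d i))) = 0"
proof (rule multilinear_zero_extend[where E = E
      and L = "\<lambda>u. \<Sum>i\<in>{..<m} - E. F ((mix E u (chart_vec B \<sigma> a))(i := d i))"
      and X = "\<lambda>i. insert (chart_vec B \<sigma> a i) (basis_fun ` (B - {\<sigma> i}))"])
  let ?z = "chart_vec B \<sigma> a"
  show fin: "finite E" using E by (auto intro: finite_subset)
  have upd: "(mix E (u(i := x)) ?z)(j := d j) = ((mix E u ?z)(j := d j))(i := x)"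
    if "i \<in> E" "j \<in> {..<m} - E" for i j u x
    using that by (auto simp: mix_def fun_eq_iff)
  show "(\<Sum>j\<in>{..<m} - E. F ((mix E (u(i := x + y)) ?z)(j := d j))) =
      (\<Sum>j\<in>{..<m} - E. F ((mix E (u(i := x)) ?z)(j := d j))) +
      (\<Sum>j\<in>{..<m} - E. F ((mix E (u(i := y)) ?z)(j := d j)))"
    if i: "i \<in> E" for i u x y
    unfolding sum.distrib[symmetric]
  proof (rule sum.cong[OF refl])
    fix j assume j: "j \<in> {..<m} - E"
    show "F ((mix E (u(i := x + y)) ?z)(j := d j)) =
        F ((mix E (u(i := x)) ?z)(j := d j)) + F ((mix E (u(i := y)) ?z)(j := d j))"
      unfolding upd[OF i j] using i E by (intro F_add) auto
  qed
  show "(\<Sum>j\<in>{..<m} - E. F ((mix E (u(i := fscale c x)) ?z)(j := d j))) =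
      c * (\<Sum>j\<in>{..<m} - E. F ((mix E (u(i := x)) ?z)(j := d j)))"
    if i: "i \<in> E" for i u c x
    unfolding sum_distrib_left
  proof (rule sum.cong[OF refl])
    fix j assume j: "j \<in> {..<m} - E"
    show "F ((mix E (u(i := fscale c x)) ?z)(j := d j)) = c * F ((mix E (u(i := x)) ?z)(j := d j))"
      unfolding upd[OF i j] using i E by (intro F_scale) auto
  qed
  show "(\<Sum>j\<in>{..<m} - E. F ((mix E u ?z)(j := d j))) = 0"
    if X: "\<And>i. i \<in> E \<Longrightarrow> u i \<in> insert (?z i) (basis_fun ` (B - {\<sigma> i}))" for u
  proof -
    obtain E' \<tau> where E': "E' \<subseteq> E" "chart_assignment E' \<tau>"
      "mix E u ?z = mix E' (\<lambda>i. basis_fun (\<tau> i)) ?z"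
      by (rule chart_generators[OF X E(1)])
    have k: "card E' < k" using card_mono[OF fin E'(1)] E(2) by simp
    \<comment> \<open>The slots not holding the point are those of \<open>E'\<close> together with
      \<open>j\<close>; they all lie in \<open>E\<close>, so there are still fewer than
      \<open>k\<close>.\<close>
    have 0: "F ((mix E' (\<lambda>i. basis_fun (\<tau> i)) ?z)(j := d j)) = 0" if j: "j \<in> E - E'" for j
    proof -
      let ?u = "(\<lambda>i. basis_fun (\<tau> i))(j := d j)"
      have "(mix E' (\<lambda>i. basis_fun (\<tau> i)) ?z)(j := d j) = mix (insert j E') ?u ?z"
        by (auto simp: mix_def fun_eq_iff)
      moreover have "F (mix (insert j E') ?u ?z) = 0"
      proof (rule chart_partials_vanish_extend[OF van])
        show "insert j E' \<subseteq> {..<m}" using j E E' by auto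
        have "card (insert j E') \<le> card E" using j E' fin by (intro card_mono) auto
        then show "card (insert j E') < k" using E(2) by simp
        show "?u i \<in> coord_space B" if "i \<in> insert j E'" for i
          using that E'(2) d by (auto simp: chart_assignment_def intro: basis_fun_in_coord_space)
      qed
      ultimately show ?thesis by (simp only:)
    qed
    have "(\<Sum>j\<in>{..<m} - E. F ((mix E' (\<lambda>i. basis_fun (\<tau> i)) ?z)(j := d j))) =
        (\<Sum>j\<in>{..<m} - E'. F ((mix E' (\<lambda>i. basis_fun (\<tau> i)) ?z)(j := d j)))"
    proof (rule sum.mono_neutral_left)
      show "\<forall>i\<in>{..<m} - E' - ({..<m} - E). F ((mix E' (\<lambda>i. basis_fun (\<tau> i)) ?z)(i := d i)) = 0"
        using 0 by blast
    qed (use E' in auto)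
    then show ?thesis using tan[OF E'(2) k] unfolding E'(3) by simp
  qed
  show "u i \<in> cfun.span (insert (?z i) (basis_fun ` (B - {\<sigma> i})))" if "i \<in> E" for i
    using span_chart_vec[where i = i and a = a and \<sigma> = \<sigma>, OF finite_B \<sigma>] u[OF that] that E(1) by blast
qed

section \<open>Multiplicity m - 1 as a condition on pairs of slots\<close>

lemma two_outside:
  assumes "E \<subseteq> {..<m}" "card E < m - 1"
  obtains i j where "i < j" "j < m" "i \<notin> E" "j \<notin> E"
proof -
  have "card ({..<m} - E) = m - card E"
    using assms(1) finite_subset[OF assms(1)] by (simp add: card_Diff_subset)
  then have "2 \<le> card ({..<m} - E)" using assms by linarith
  then obtain T where "T \<subseteq> {..<m} - E" "card T = 2" by (meson obtain_subset_with_card_n)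
  then obtain i j where "i \<noteq> j" "i \<in> {..<m} - E" "j \<in> {..<m} - E"
    by (auto simp: card_2_iff)
  then show thesis using that[of i j] that[of j i] by (cases "i < j") auto
qed

text \<open>Derivatives of order \<open>m - 2\<close> leave the point in an arbitrary pair of slots.
  Those of lower order are the special cases in which it occupies further slots.\<close>

lemma sing_ideal_vanish_pairs:
  "(\<forall>g\<in>sing_ideal m B F (m - 1) \<sigma>. g a = 0) \<longleftrightarrow>
   (\<forall>i j u. i < j \<longrightarrow> j < m \<longrightarrow> (\<forall>l<m. u l \<in> coord_space B) \<longrightarrow>
      F (u(i := chart_vec B \<sigma> a i, j := chart_vec B \<sigma> a j)) = 0)" (is "?L \<longleftrightarrow> ?R")
proof
  let ?z = "chart_vec B \<sigma> a"
  assume L: ?L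
  show ?R
  proof (intro allI impI)
    fix i j u assume ij: "i < j" "j < m" and u: "\<forall>l<m. u l \<in> coord_space B"
    have "F (u(i := ?z i, j := ?z j)) = F (mix ({..<m} - {i, j}) u ?z)"
      by (rule F_cong) (auto simp: mix_def)
    also have "\<dots> = 0"
    proof (rule chart_partials_vanish_extend)
      have "card ({..<m} - {i, j}) = m - 2" using ij by (subst card_Diff_subset) auto
      then show "card ({..<m} - {i, j}) < m - 1" using ij by linarith
    qed (use L u in \<open>auto simp: sing_ideal_vanish_iff\<close>)
    finally show "F (u(i := ?z i, j := ?z j)) = 0" .
  qed
next
  let ?z = "chart_vec B \<sigma> a"
  assume R: ?R
  show ?L unfolding sing_ideal_vanish_iff
  proof (intro allI impI)
    fix E \<tau> assume E: "chart_assignment E \<tau>" "card E < m - 1"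
    obtain i j where ij: "i < j" "j < m" "i \<notin> E" "j \<notin> E"
      using two_outside[of E] E by (auto simp: chart_assignment_def)
    let ?u = "mix E (\<lambda>i. basis_fun (\<tau> i)) ?z"
    have "?u = ?u(i := ?z i, j := ?z j)" using ij by (auto simp: mix_def fun_eq_iff)
    moreover have "\<forall>l<m. ?u l \<in> coord_space B"
      using E \<sigma> by (auto simp: mix_def chart_assignment_def
        intro: basis_fun_in_coord_space chart_vec_in_coord_space)
    ultimately have "F ?u = 0" using R ij by metis
    then show "chart_partial E \<tau> a = 0" by (simp add: chart_partial_def)
  qed
qed

text \<open>With exactly two undifferentiated slots the linearised condition is a sum of two terms.
  Derivatives of lower order impose nothing on \<open>v\<close>, because the multiplicity at the
  point makes each summand vanish.\<close>

lemma dim_zariski_tangent_pairs: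
  assumes van: "\<forall>g\<in>sing_ideal m B F (m - 1) \<sigma>. g a = 0"
  shows "cfun.dim (zariski_tangent (chart_index m B \<sigma>) (sing_ideal m B F (m - 1) \<sigma>) a) =
    cfun.dim {v \<in> coord_space (chart_index m B \<sigma>).
      \<forall>i j u. i < j \<longrightarrow> j < m \<longrightarrow> (\<forall>l<m. u l \<in> coord_space B) \<longrightarrow>
        F (u(i := chart_dir B \<sigma> v i, j := chart_vec B \<sigma> a j)) +
        F (u(i := chart_vec B \<sigma> a i, j := chart_dir B \<sigma> v j)) = 0}"
proof -
  let ?z = "chart_vec B \<sigma> a"
  have van': "chart_partial E \<tau> a = 0" if "chart_assignment E \<tau>" "card E < m - 1" for E \<tau>
    using van that by (simp add: sing_ideal_vanish_iff)
  have "(\<forall>E \<tau>. chart_assignment E \<tau> \<longrightarrow> card E < m - 1 \<longrightarrow>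
      (\<Sum>i\<in>{..<m} - E. F ((mix E (\<lambda>i. basis_fun (\<tau> i)) ?z)(i := chart_dir B \<sigma> v i))) = 0) \<longleftrightarrow>
      (\<forall>i j u. i < j \<longrightarrow> j < m \<longrightarrow> (\<forall>l<m. u l \<in> coord_space B) \<longrightarrow>
        F (u(i := chart_dir B \<sigma> v i, j := ?z j)) + F (u(i := ?z i, j := chart_dir B \<sigma> v j)) = 0)"
    (is "?L \<longleftrightarrow> ?R") for v
  proof
    let ?d = "chart_dir B \<sigma> v"
    assume L: ?L
    show ?R
    proof (intro allI impI)
      fix i j u assume ij: "i < j" "j < m" and u: "\<forall>l<m. u l \<in> coord_space B"
      let ?E = "{..<m} - {i, j}"
      have "(\<Sum>l\<in>{..<m} - ?E. F ((mix ?E u ?z)(l := ?d l))) = 0"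
      proof (rule chart_partials_derivative_extend[OF van'])
        have "card ?E = m - 2" using ij by (subst card_Diff_subset) auto
        then show "card ?E < m - 1" using ij by linarith
      qed (use L u in \<open>auto intro: chart_dir_in_coord_space\<close>)
      moreover have "{..<m} - ?E = {i, j}" using ij by auto
      moreover have "F ((mix ?E u ?z)(i := ?d i)) = F (u(i := ?d i, j := ?z j))"
        using ij by (intro F_cong) (auto simp: mix_def)
      moreover have "F ((mix ?E u ?z)(j := ?d j)) = F (u(i := ?z i, j := ?d j))"
        using ij by (intro F_cong) (auto simp: mix_def)
      ultimately show "F (u(i := ?d i, j := ?z j)) + F (u(i := ?z i, j := ?d j)) = 0"
        using ij by simp
    qed
  next
    let ?d = "chart_dir B \<sigma> v"
    assume R: ?R
    show ?L
    proof (intro allI impI)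
      fix E \<tau> assume E: "chart_assignment E \<tau>" "card E < m - 1"
      have E': "E \<subseteq> {..<m}" using E by (simp add: chart_assignment_def)
      let ?u = "mix E (\<lambda>i. basis_fun (\<tau> i)) ?z"
      have u: "\<forall>l<m. ?u l \<in> coord_space B"
        using E \<sigma> by (auto simp: mix_def chart_assignment_def
          intro: basis_fun_in_coord_space chart_vec_in_coord_space)
      obtain i j where ij: "i < j" "j < m" "i \<notin> E" "j \<notin> E"
        using two_outside[OF E' E(2)] .
      show "(\<Sum>l\<in>{..<m} - E. F (?u(l := ?d l))) = 0"
      proof (cases "{..<m} - E = {i, j}")
        case True
        have "?u(i := ?d i) = ?u(i := ?d i, j := ?z j)" "?u(j := ?d j) = ?u(i := ?z i, j := ?d j)"
          using ij by (auto simp: mix_def fun_eq_iff)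
        moreover have "F (?u(i := ?d i, j := ?z j)) + F (?u(i := ?z i, j := ?d j)) = 0"
          using R ij u by blast
        moreover have "i \<noteq> j" using ij by simp
        ultimately show ?thesis unfolding True by simp
      next
        case False
        \<comment> \<open>Each summand still has two undifferentiated slots outside \<open>E\<close>.\<close>
        then obtain k where k: "k < m" "k \<notin> E" "k \<noteq> i" "k \<noteq> j" using ij by auto
        have "F (?u(l := ?d l)) = 0" if l: "l \<in> {..<m} - E" for l
        proof -
          have "F (?u(l := ?d l)) = F (mix ({..<m} - {p, q}) (?u(l := ?d l)) ?z)"
            if "p \<notin> E" "q \<notin> E" "p \<noteq> l" "q \<noteq> l" for p q
            using that by (intro F_cong) (auto simp: mix_def)
          moreover have "\<exists>p q. p \<noteq> q \<and> p < m \<and> q < m \<and> p \<notin> E \<and> q \<notin> E \<and> p \<noteq> l \<and> q \<noteq> l"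
          proof (cases "l = i")
            case True
            then show ?thesis using k ij by (intro exI[of _ j] exI[of _ k]) auto
          next
            case False
            then show ?thesis
            proof (cases "l = j")
              case True
              then show ?thesis using k ij by (intro exI[of _ i] exI[of _ k]) auto
            next
              case False
              then show ?thesis using \<open>l \<noteq> i\<close> ij by (intro exI[of _ i] exI[of _ j]) auto
            qed
          qed
          ultimately obtain p q where pq: "p \<noteq> q" "p < m" "q < m"
            and eq: "F (?u(l := ?d l)) = F (mix ({..<m} - {p, q}) (?u(l := ?d l)) ?z)" by metis
          have "F (mix ({..<m} - {p, q}) (?u(l := ?d l)) ?z) = 0"
          proof (rule chart_partials_vanish_extend[OF van'])
            have "card ({..<m} - {p, q}) = m - 2" using pq by (subst card_Diff_subset) auto
            then show "card ({..<m} - {p, q}) < m - 1" using pq by linarith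
          qed (use u in \<open>auto intro: chart_dir_in_coord_space\<close>)
          then show ?thesis using eq by simp
        qed
        then show ?thesis by (intro sum.neutral) blast
      qed
    qed
  qed
  then show ?thesis using dim_zariski_tangent_sing[OF van] by (simp only:)
qed

end

end

section \<open>The Pluecker form along the diagonal\<close>

lemma wedge_list_scale_slot:
  "wedge_list (xs @ [fscale c x] @ ys) = fscale c (wedge_list (xs @ [x] @ ys))"
  by (induction xs) (simp_all add: wedge_scale_left wedge_scale_right)

lemma wedge_list_add_slot:
  "wedge_list (xs @ [x + y] @ ys) = wedge_list (xs @ [x] @ ys) + wedge_list (xs @ [y] @ ys)"
proof (induction xs)
  case Nil
  show ?case by (simp only: append_Nil append_Cons wedge_list_Cons wedge_add_left)
next
  case (Cons z xs)
  then show ?case by (simp only: append_Cons wedge_list_Cons wedge_add_right)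
qed

lemma map_upd_upt:
  assumes "i < m"
  shows "map (w(i := x)) [0..<m] = map w [0..<i] @ [x] @ map w [Suc i..<m]"
proof -
  have "[0..<m] = [0..<i] @ [i] @ [Suc i..<m]"
    using assms upt_add_eq_append[of 0 i "m - i"] upt_conv_Cons[of i m] by simp
  then show ?thesis by simp
qed

lemma multilinear_form_plucker: "multilinear_form m (ext_index n r) (plucker_form n m)"
proof
  show "finite (ext_index n r)" by (rule finite_ext_index)
  show "plucker_form n m (w(i := x + y)) = plucker_form n m (w(i := x)) + plucker_form n m (w(i := y))"
    if "i < m" for i w x y
    unfolding plucker_form_def map_upd_upt[OF that] wedge_list_add_slot by simp
  show "plucker_form n m (w(i := fscale c x)) = c * plucker_form n m (w(i := x))"
    if "i < m" for i w c x
    unfolding plucker_form_def map_upd_upt[OF that] wedge_list_scale_slot by (simp add: fscale_apply)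
  show "plucker_form n m w = plucker_form n m w'" if "\<And>i. i < m \<Longrightarrow> w i = w' i" for w w'
    unfolding plucker_form_def using that by (intro arg_cong[where f = "\<lambda>xs. wedge_list xs {..<n}"]) simp
qed

section \<open>Nondegeneracy of the form in a pair of slots\<close>

lemma exists_map_eq:
  fixes ps :: "('b \<Rightarrow> complex) list"
  assumes "length is = length ps" "distinct is"
  obtains u where "map u is = ps" "\<And>l. l \<notin> set is \<Longrightarrow> u l = 0"
proof -
  have "\<exists>u. map u is = ps \<and> (\<forall>l. l \<notin> set is \<longrightarrow> u l = 0)" using assms
  proof (induction "is" ps rule: list_induct2)
    case Nil
    show ?case by (rule exI[of _ "\<lambda>_. 0"]) simp
  next
    case (Cons i "is" p ps)
    have "\<exists>u. map u is = ps \<and> (\<forall>l. l \<notin> set is \<longrightarrow> u l = 0)"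
      by (rule Cons.IH) (use Cons.prems in simp)
    then obtain u where u: "map u is = ps" "\<forall>l. l \<notin> set is \<longrightarrow> u l = 0" by blast
    have "map (u(i := p)) is = ps" using Cons.prems u(1) by auto
    then show ?case using u(2) by (intro exI[of _ "u(i := p)"]) auto
  qed
  then show ?thesis using that by blast
qed

text \<open>\<open>Q\<close> is cut into \<open>k\<close> blocks of size \<open>r\<close>. The
  resulting factors are the test vectors for the remaining slots of the form.\<close>

lemma basis_fun_wedge_list:
  assumes "finite Q" "card Q = r * k"
  obtains ps c where "length ps = k" "set ps \<subseteq> basis_fun ` {T. T \<subseteq> Q \<and> card T = r}"
    "c \<noteq> 0" "wedge_list ps = fscale c (basis_fun Q)"
proof -
  have "\<exists>ps c. length ps = k \<and> set ps \<subseteq> basis_fun ` {T. T \<subseteq> Q \<and> card T = r} \<and> c \<noteq> 0 \<and>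
      wedge_list ps = fscale c (basis_fun Q)"
    using assms
  proof (induction k arbitrary: Q)
    case 0
    then have "Q = {}" by simp
    then show ?case
      by (intro exI[of _ "[]"] exI[of _ 1]) (auto simp: ext_one_def basis_fun_def fscale_apply fun_eq_iff)
  next
    case (Suc k)
    have "r \<le> card Q" using Suc.prems by simp
    then obtain T where T: "T \<subseteq> Q" "card T = r" "finite T" by (rule obtain_subset_with_card_n)
    have "card (Q - T) = r * k" using T Suc.prems by (simp add: card_Diff_subset)
    then obtain ps c where ps: "length ps = k" "c \<noteq> 0" "wedge_list ps = fscale c (basis_fun (Q - T))"
      "set ps \<subseteq> basis_fun ` {T'. T' \<subseteq> Q - T \<and> card T' = r}"
      using Suc.IH[of "Q - T"] Suc.prems by auto
    have e: "wedge (basis_fun T) (basis_fun (Q - T)) = fscale (shuffle_sign T (Q - T)) (basis_fun Q)"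
    proof
      fix R
      show "wedge (basis_fun T) (basis_fun (Q - T)) R = fscale (shuffle_sign T (Q - T)) (basis_fun Q) R"
      proof (cases "R = Q")
        case True
        have "Q - (Q - T) = T" using T by auto
        then show ?thesis using Suc.prems True
          unfolding wedge_basis_fun fscale_apply by (simp add: basis_fun_def)
      next
        case False
        then have "Q - T \<subseteq> R \<Longrightarrow> R - (Q - T) \<noteq> T" using T by blast
        then show ?thesis using False
          unfolding wedge_basis_fun fscale_apply by (simp add: basis_fun_def)
      qed
    qed
    have "wedge_list (basis_fun T # ps) = fscale (c * shuffle_sign T (Q - T)) (basis_fun Q)"
      by (simp only: wedge_list_Cons ps(3) wedge_scale_right e cfun.scale_scale)
    moreover have "set (basis_fun T # ps) \<subseteq> basis_fun ` {T. T \<subseteq> Q \<and> card T = r}"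
    proof -
      have "{T'. T' \<subseteq> Q - T \<and> card T' = r} \<subseteq> {T. T \<subseteq> Q \<and> card T = r}" by blast
      then have "set ps \<subseteq> basis_fun ` {T. T \<subseteq> Q \<and> card T = r}"
        using ps(4) image_mono by (metis (no_types, lifting) subset_trans)
      moreover have "basis_fun T \<in> basis_fun ` {T. T \<subseteq> Q \<and> card T = r}" using T by blast
      ultimately show ?thesis unfolding list.set by (rule insert_subsetI[rotated])
    qed
    ultimately show ?case using ps(1,2)
      by (intro exI[of _ "basis_fun T # ps"] exI[of _ "c * shuffle_sign T (Q - T)"]) simp
  qed
  then show ?thesis using that by blast
qed

definition pair_slots :: "nat \<Rightarrow> nat \<Rightarrow> nat \<Rightarrow> nat list" where
  "pair_slots m i j = [0..<i] @ [Suc i..<j] @ [Suc j..<m]"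

lemma map_pair_upd_upt:
  assumes "i < j" "j < m"
  shows "map (u(i := x, j := y)) [0..<m] =
    map u [0..<i] @ [x] @ map u [Suc i..<j] @ [y] @ map u [Suc j..<m]"
  unfolding map_upd_upt[OF assms(2)] map_upd_upt[OF assms(1)] using assms by auto

text \<open>Moving the slots \<open>i\<close> and \<open>j\<close> to the front costs a sign that depends on \<open>i\<close>, \<open>j\<close> only.\<close>

lemma plucker_form_pair:
  assumes ij: "i < j" "j < m" and u: "\<And>l. l < m \<Longrightarrow> u l \<in> ext_power n r"
    and xy: "x \<in> ext_power n r" "y \<in> ext_power n r"
  shows "plucker_form n m (u(i := x, j := y)) =
    (-1) ^ (r * i * (2 * r)) * (-1) ^ (r * (j - Suc i) * r) *
      wedge (wedge x y) (wedge_list (map u (pair_slots m i j))) {..<n}"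
proof -
  let ?A = "map u [0..<i]" and ?C = "map u [Suc i..<j]" and ?D = "map u [Suc j..<m]"
  have sets: "set ?A \<subseteq> ext_power n r" "set ?C \<subseteq> ext_power n r" "set ?D \<subseteq> ext_power n r"
    using u ij by auto
  have A: "wedge_list ?A \<in> ext_power n (r * i)" using wedge_list_in_ext_power[OF sets(1)] by simp
  have C: "wedge_list ?C \<in> ext_power n (r * (j - Suc i))"
    using wedge_list_in_ext_power[OF sets(2)] by simp
  have xy': "wedge x y \<in> ext_power n (2 * r)" using wedge_in_ext_power[OF xy] by (simp add: mult_2)
  have "wedge_list (?A @ [x] @ ?C @ [y] @ ?D) =
      wedge (wedge_list ?A) (wedge x (wedge (wedge_list ?C) (wedge y (wedge_list ?D))))"
    using sets xy by (subst wedge_list_append[where n = n and p = r], simp,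
      simp only: append_Cons append_Nil wedge_list_Cons,
      subst wedge_list_append[where n = n and p = r], simp, simp)
  \<comment> \<open>\<open>y\<close> passes \<open>j - Suc i\<close> factors of degree
    \<open>r\<close>.\<close>
  also have "wedge (wedge_list ?C) (wedge y (wedge_list ?D)) =
      fscale ((-1) ^ (r * (j - Suc i) * r)) (wedge y (wedge (wedge_list ?C) (wedge_list ?D)))"
    by (simp only: wedge_assoc[symmetric] wedge_commute[OF C xy(2)] wedge_scale_left)
  also have "wedge (wedge_list ?A) (wedge x (fscale ((-1) ^ (r * (j - Suc i) * r))
        (wedge y (wedge (wedge_list ?C) (wedge_list ?D))))) =
      fscale ((-1) ^ (r * (j - Suc i) * r))
        (wedge (wedge (wedge_list ?A) (wedge x y)) (wedge (wedge_list ?C) (wedge_list ?D)))"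
    by (simp only: wedge_assoc wedge_scale_right)
  \<comment> \<open>\<open>x \<and> y\<close>, of degree \<open>2 * r\<close>, passes
    \<open>i\<close> factors of degree \<open>r\<close>.\<close>
  also have "wedge (wedge_list ?A) (wedge x y) =
      fscale ((-1) ^ (r * i * (2 * r))) (wedge (wedge x y) (wedge_list ?A))"
    by (rule wedge_commute[OF A xy'])
  finally have "wedge_list (?A @ [x] @ ?C @ [y] @ ?D) =
      fscale ((-1) ^ (r * (j - Suc i) * r) * (-1) ^ (r * i * (2 * r)))
        (wedge (wedge x y) (wedge (wedge_list ?A) (wedge (wedge_list ?C) (wedge_list ?D))))"
    by (simp only: wedge_assoc wedge_scale_left cfun.scale_scale)
  moreover have "wedge (wedge_list ?A) (wedge (wedge_list ?C) (wedge_list ?D)) =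
      wedge_list (map u (pair_slots m i j))"
    using sets unfolding pair_slots_def map_append
    by (subst wedge_list_append[where n = n and p = r], simp,
      subst wedge_list_append[where n = n and p = r], simp, simp)
  ultimately show ?thesis
    unfolding plucker_form_def map_pair_upd_upt[OF ij] by (simp only: fscale_apply mult_ac)
qed

text \<open>The wedge pairing of degrees \<open>2 * r\<close> and \<open>n - 2 * r\<close> is
  perfect, and products of \<open>m - 2\<close> elements of degree \<open>r\<close> span the second
  degree. The sum of two products covers both the multiplicity condition, with the second product
  zero, and the linearised one.\<close>

lemma plucker_form_pair_nondegenerate:
  assumes n: "n = r * m" and ij: "i < j" "j < m"
    and x: "x \<in> ext_power n r" "y \<in> ext_power n r" and x': "x' \<in> ext_power n r" "y' \<in> ext_power n r"
  shows "(\<forall>u. (\<forall>l<m. u l \<in> ext_power n r) \<longrightarrow>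
      plucker_form n m (u(i := x, j := y)) + plucker_form n m (u(i := x', j := y')) = 0) \<longleftrightarrow>
    wedge x y + wedge x' y' = 0" (is "?L \<longleftrightarrow> ?R")
proof -
  let ?s = "(-1) ^ (r * i * (2 * r)) * (-1) ^ (r * (j - Suc i) * r) :: complex"
  let ?Y = "wedge x y + wedge x' y'"
  have form: "plucker_form n m (u(i := x, j := y)) + plucker_form n m (u(i := x', j := y')) =
      ?s * wedge ?Y (wedge_list (map u (pair_slots m i j))) {..<n}"
    if "\<forall>l<m. u l \<in> ext_power n r" for u
  proof -
    have u: "\<And>l. l < m \<Longrightarrow> u l \<in> ext_power n r" using that by blast
    have "plucker_form n m (u(i := x, j := y)) =
        ?s * wedge (wedge x y) (wedge_list (map u (pair_slots m i j))) {..<n}"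
      by (rule plucker_form_pair[OF ij u x])
    moreover have "plucker_form n m (u(i := x', j := y')) =
        ?s * wedge (wedge x' y') (wedge_list (map u (pair_slots m i j))) {..<n}"
      by (rule plucker_form_pair[OF ij u x'])
    ultimately show ?thesis
      by (simp only: wedge_add_left plus_fun_apply distrib_left)
  qed
  show ?thesis
  proof
    assume ?R
    then show ?L using form by (simp only: wedge_zero_left zero_fun_apply mult_zero_right) blast
  next
    assume L: ?L
    show ?R
    proof (rule ccontr)
      assume "?Y \<noteq> 0"
      then obtain R where R: "?Y R \<noteq> 0" by (metis ext zero_fun_apply)
      have "?Y \<in> ext_power n (r + r)"
        by (intro cfun.subspace_add subspace_ext_power wedge_in_ext_power x x')
      then have R': "R \<subseteq> {..<n}" "card R = r + r" "finite R" using ext_power_nonzeroD R by blast+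
      have "card ({..<n} - R) = r * m - (r + r)"
        using R' n by (simp add: card_Diff_subset)
      also have "\<dots> = r * (m - 2)" using ij by (simp add: diff_mult_distrib2)
      finally have "card ({..<n} - R) = r * (m - 2)" .
      \<comment> \<open>The complement of \<open>R\<close> fills the other \<open>m - 2\<close>
        slots; wedging with its basis multivector isolates the coefficient at
        \<open>R\<close>.\<close>
      then obtain ps c where ps: "length ps = m - 2"
        "set ps \<subseteq> basis_fun ` {T. T \<subseteq> {..<n} - R \<and> card T = r}" "c \<noteq> 0"
        "wedge_list ps = fscale c (basis_fun ({..<n} - R))"
        by (rule basis_fun_wedge_list[OF finite_Diff[OF finite_lessThan]])
      have "length (pair_slots m i j) = length ps" "distinct (pair_slots m i j)"
        using ij ps by (auto simp: pair_slots_def)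
      then obtain u where u: "map u (pair_slots m i j) = ps" "\<And>l. l \<notin> set (pair_slots m i j) \<Longrightarrow> u l = 0"
        by (rule exists_map_eq) blast
      have "u l \<in> ext_power n r" for l
      proof (cases "l \<in> set (pair_slots m i j)")
        case True
        then have "u l \<in> set ps" using u(1) by auto
        then obtain T where "u l = basis_fun T" "T \<subseteq> {..<n} - R" "card T = r" using ps(2) by blast
        then show ?thesis using basis_fun_in_ext_power[of T n r] by auto
      next
        case False
        then show ?thesis using u(2) cfun.subspace_0[OF subspace_ext_power] by metis
      qed
      then have "?s * wedge ?Y (wedge_list (map u (pair_slots m i j))) {..<n} = 0"
        using L form by metis
      then have "wedge ?Y (fscale c (basis_fun ({..<n} - R))) {..<n} = 0"
        using u(1) ps(4) by simp
      moreover have "{..<n} - ({..<n} - R) = R" using R' by auto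
      ultimately show False
        using R ps(3) by (simp add: wedge_scale_right fscale_apply wedge_basis_fun)
    qed
  qed
qed

section \<open>Charts around a point of the diagonal\<close>

lemma span_fscale:
  assumes "c \<noteq> 0" shows "cfun.span {fscale c w} = cfun.span {w}"
proof
  show "cfun.span {fscale c w} \<subseteq> cfun.span {w}"
    by (intro cfun.span_minimal) (auto intro: cfun.span_scale cfun.span_base)
  have "fscale (1 / c) (fscale c w) \<in> cfun.span {fscale c w}"
    by (intro cfun.span_scale cfun.span_base) simp
  moreover have "fscale (1 / c) (fscale c w) = w" using assms by (simp add: fscale_apply fun_eq_iff)
  ultimately show "cfun.span {w} \<subseteq> cfun.span {fscale c w}"
    by (intro cfun.span_minimal) auto
qed

text \<open>The scalar is the inverse of \<open>w (\<sigma> i)\<close>. It may vary with the slot,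
  because a chart may normalise different coordinates in different slots.\<close>

lemma in_chart_diag_point:
  assumes "in_chart m B \<sigma> a (diag_point m (cfun.span {w}))" "i < m"
  obtains c where "c \<noteq> 0" "chart_vec B \<sigma> a i = fscale c w" "c * w (\<sigma> i) = 1"
proof -
  let ?z = "chart_vec B \<sigma> a i"
  have "cfun.span {?z} = cfun.span {w}"
    using assms by (auto simp: in_chart_def diag_point_def chart_point_def fun_eq_iff restrict_def split: if_splits)
  then have "?z \<in> cfun.span {w}" using cfun.span_base[of ?z "{?z}"] by simp
  then obtain c where c: "?z = fscale c w" by (auto simp: cfun.span_singleton)
  moreover have "?z (\<sigma> i) = 1" by (simp add: chart_vec_def)
  ultimately have "c * w (\<sigma> i) = 1" by (simp add: fscale_apply)
  then show ?thesis using that c by (cases "c = 0") auto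
qed

lemma exists_chart:
  assumes w: "w \<in> coord_space B" and S: "S \<in> B" "w S \<noteq> 0"
  obtains \<sigma> a where "in_chart m B \<sigma> a (diag_point m (cfun.span {w}))"
proof
  let ?\<sigma> = "\<lambda>_. S" and ?a = "\<lambda>(i, T). if i < m \<and> T \<in> B \<and> T \<noteq> S then w T / w S else 0"
  have "cfun.span {chart_vec B ?\<sigma> ?a i} = cfun.span {w}" if "i < m" for i
  proof -
    have "chart_vec B ?\<sigma> ?a i = fscale (1 / w S) w"
      using w S that by (auto simp: chart_vec_def fscale_apply fun_eq_iff coord_space_def)
    then show ?thesis using span_fscale[of "1 / w S" w] S by simp
  qed
  then show "in_chart m B ?\<sigma> ?a (diag_point m (cfun.span {w}))"
    using S by (auto simp: in_chart_def coord_space_def chart_index_def diag_point_def chart_point_def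
      intro!: restrict_ext)
qed

text \<open>Here \<open>\<epsilon>\<close> stands for the sign of exchanging two elements of degree
  \<open>r\<close>, \<open>h i\<close> for a coefficient of \<open>w \<and> d i\<close>, and
  \<open>c i\<close> for the chart scalars. If \<open>\<epsilon> = -1\<close>, the quotients
  \<open>h i / c i\<close> are all equal. If \<open>\<epsilon> = 1\<close>, any two of them are
  opposite, which for three slots forces zero.\<close>

lemma pair_relations:
  fixes h c :: "nat \<Rightarrow> complex" and \<epsilon> :: complex
  assumes m: "3 \<le> m" and \<epsilon>: "\<epsilon> = 1 \<or> \<epsilon> = -1" and c: "\<And>i. i < m \<Longrightarrow> c i \<noteq> 0"
  shows "(\<forall>i j. i < j \<longrightarrow> j < m \<longrightarrow> c j * \<epsilon> * h i + c i * h j = 0) \<longleftrightarrow>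
    (\<epsilon> = 1 \<longrightarrow> h 0 = 0) \<and> (\<forall>i. 0 < i \<longrightarrow> i < m \<longrightarrow> h i = (if \<epsilon> = 1 then 0 else c i / c 0) * h 0)"
    (is "?L \<longleftrightarrow> ?R")
proof
  assume L: ?L
  have c0: "c 0 \<noteq> 0" "c 1 \<noteq> 0" "c 2 \<noteq> 0" using c m by auto
  have 0: "c i * \<epsilon> * h 0 + c 0 * h i = 0" if "0 < i" "i < m" for i using L that by blast
  show ?R
  proof (cases "\<epsilon> = 1")
    case True
    have "c 1 * h 0 + c 0 * h 1 = 0" "c 2 * h 0 + c 0 * h 2 = 0" "c 2 * h 1 + c 1 * h 2 = 0"
      using L[rule_format, of 0 1] L[rule_format, of 0 2] L[rule_format, of 1 2] m True by auto
    \<comment> \<open>The combination of the three relations with factors \<open>c 2\<close>,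
      \<open>c 1\<close> and \<open>- c 0\<close>.\<close>
    then have "2 * c 1 * c 2 * h 0 = 0" by algebra
    then have "h 0 = 0" using c0 by simp
    then show ?thesis using 0 True c0 by simp
  next
    case False
    then have "\<epsilon> = -1" using \<epsilon> by simp
    have "h i = c i / c 0 * h 0" if "0 < i" "i < m" for i
    proof -
      have "c 0 * h i = c i * h 0" using 0[OF that] \<open>\<epsilon> = -1\<close> by (simp add: algebra_simps)
      then show ?thesis using c0 by (simp add: field_simps)
    qed
    then show ?thesis using False by simp
  qed
next
  assume R: ?R
  have c0: "c 0 \<noteq> 0" using c m by auto
  show ?L
  proof (cases "\<epsilon> = 1")
    case True
    then have "h i = 0" if "i < m" for i using R that by (cases "i = 0") auto
    then have "c j * \<epsilon> * h i + c i * h j = 0" if "i < m" "j < m" for i j using that by simp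
    then show ?thesis using less_trans by blast
  next
    case False
    then have h: "h i = c i / c 0 * h 0" if "i < m" for i using R that c0 by (cases "i = 0") simp_all
    have "\<epsilon> = -1" using \<epsilon> False by simp
    then have "c j * \<epsilon> * h i + c i * h j = 0" if "i < m" "j < m" for i j
      unfolding h[OF that(1)] h[OF that(2)] by simp
    then show ?thesis using less_trans by blast
  qed
qed

lemma all_pairs_reorder:
  "(\<forall>i j u. P i j \<longrightarrow> Q i j \<longrightarrow> A u \<longrightarrow> S i j u) \<longleftrightarrow> (\<forall>i j. P i j \<longrightarrow> Q i j \<longrightarrow> (\<forall>u. A u \<longrightarrow> S i j u))"
  by blast

lemma in_chartD:
  "in_chart m B \<sigma> a x \<Longrightarrow> i < m \<Longrightarrow> \<sigma> i \<in> B"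
  by (simp add: in_chart_def)

lemma in_chart_diag_scalars:
  assumes "in_chart m B \<sigma> a (diag_point m (cfun.span {w}))"
  obtains c where "\<And>i. i < m \<Longrightarrow> c i \<noteq> 0" "\<And>i. i < m \<Longrightarrow> chart_vec B \<sigma> a i = fscale (c i) w"
    "\<And>i. i < m \<Longrightarrow> c i * w (\<sigma> i) = 1"
proof -
  have "\<forall>i. \<exists>c. i < m \<longrightarrow> c \<noteq> 0 \<and> chart_vec B \<sigma> a i = fscale c w \<and> c * w (\<sigma> i) = 1"
    using in_chart_diag_point[OF assms] by metis
  then show ?thesis using that by metis
qed

text \<open>At a diagonal point every pair of slots gives the same equation, up to the nonzero
  factor \<open>c i * c j\<close>.\<close>

lemma plucker_sing_iff:
  assumes m: "3 \<le> m" and n: "n = r * m" and w: "w \<in> ext_power n r"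
    and chart: "in_chart m (ext_index n r) \<sigma> a (diag_point m (cfun.span {w}))"
  shows "(\<forall>g\<in>sing_ideal m (ext_index n r) (plucker_form n m) (m - 1) \<sigma>. g a = 0) \<longleftrightarrow> wedge w w = 0"
proof -
  let ?B = "ext_index n r" and ?F = "plucker_form n m"
  interpret multilinear_form m ?B ?F by (rule multilinear_form_plucker)
  obtain c where c: "\<And>i. i < m \<Longrightarrow> c i \<noteq> 0" "\<And>i. i < m \<Longrightarrow> chart_vec ?B \<sigma> a i = fscale (c i) w"
    using in_chart_diag_scalars[OF chart] by metis
  let ?z = "chart_vec ?B \<sigma> a"
  have pair: "(\<forall>u. (\<forall>l<m. u l \<in> coord_space ?B) \<longrightarrow> ?F (u(i := ?z i, j := ?z j)) = 0) \<longleftrightarrow> wedge w w = 0"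
    if ij: "i < j" "j < m" for i j
  proof -
    have im: "i < m" using ij by simp
    have z: "?z l \<in> ext_power n r" if "l < m" for l
      unfolding c(2)[OF that] by (rule cfun.subspace_scale[OF subspace_ext_power w])
    have 0: "0 \<in> ext_power n r" by (rule cfun.subspace_0[OF subspace_ext_power])
    have F0: "?F (u(i := 0, j := 0)) = 0" for u by (rule F_zero[OF ij(2)]) simp
    have "wedge (?z i) (?z j) + wedge 0 0 = fscale (c i * c j) (wedge w w)"
      unfolding c(2)[OF im] c(2)[OF ij(2)] wedge_scale_left wedge_scale_right cfun.scale_scale
      by simp
    moreover have "fscale (c i * c j) (wedge w w) = 0 \<longleftrightarrow> wedge w w = 0"
      using c(1)[OF im] c(1)[OF ij(2)] by simp
    ultimately show ?thesis
      using plucker_form_pair_nondegenerate[OF n ij z[OF im] z[OF ij(2)] 0 0]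
      unfolding F0 ext_power_def by simp
  qed
  have "(\<forall>g\<in>sing_ideal m ?B ?F (m - 1) \<sigma>. g a = 0) \<longleftrightarrow>
      (\<forall>i j. i < j \<longrightarrow> j < m \<longrightarrow> (\<forall>u. (\<forall>l<m. u l \<in> coord_space ?B) \<longrightarrow> ?F (u(i := ?z i, j := ?z j)) = 0))"
    by (subst sing_ideal_vanish_pairs[OF in_chartD[OF chart]]) auto
  also have "\<dots> \<longleftrightarrow> (\<forall>i j. i < j \<longrightarrow> j < m \<longrightarrow> wedge w w = 0)"
    by (intro iff_allI imp_cong refl pair)
  also have "\<dots> \<longleftrightarrow> wedge w w = 0"
  proof
    assume "\<forall>i j. i < j \<longrightarrow> j < m \<longrightarrow> wedge w w = 0"
    from this[rule_format, of 0 1] show "wedge w w = 0" using m by simp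
  qed simp
  finally show ?thesis .
qed

section \<open>The tangent space at a diagonal point\<close>

lemma self_in_wedge_kernel: "w \<in> ext_power n r \<Longrightarrow> wedge w w = 0 \<Longrightarrow> w \<in> wedge_kernel n r w"
  by (simp add: wedge_kernel_def)

text \<open>The vector equations are compared coefficient by coefficient, which reduces them to
  \<open>pair_relations\<close>; the exponent \<open>r * r\<close> of the sign has the parity of
  \<open>r\<close>.\<close>

lemma plucker_tangent_conditions:
  assumes m: "3 \<le> m" and n: "n = r * m" and w: "w \<in> ext_power n r"
    and c: "\<And>i. i < m \<Longrightarrow> c i \<noteq> 0" "\<And>i. i < m \<Longrightarrow> z i = fscale (c i) w"
    and d: "\<And>i. i < m \<Longrightarrow> d i \<in> ext_power n r"
  shows "(\<forall>i j u. i < j \<longrightarrow> j < m \<longrightarrow> (\<forall>l<m. u l \<in> ext_power n r) \<longrightarrow>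
        plucker_form n m (u(i := d i, j := z j)) + plucker_form n m (u(i := z i, j := d j)) = 0) \<longleftrightarrow>
    (even r \<longrightarrow> wedge w (d 0) = 0) \<and>
    (\<forall>i. 0 < i \<longrightarrow> i < m \<longrightarrow> wedge w (d i) = fscale (if even r then 0 else c i / c 0) (wedge w (d 0)))"
    (is "?L \<longleftrightarrow> ?R")
proof -
  let ?\<epsilon> = "(-1) ^ (r * r) :: complex"
  have \<epsilon>: "?\<epsilon> = 1 \<or> ?\<epsilon> = -1" "?\<epsilon> = 1 \<longleftrightarrow> even r" by (simp_all add: minus_one_power_iff)
  have z: "z l \<in> ext_power n r" if "l < m" for l
    unfolding c(2)[OF that] by (rule cfun.subspace_scale[OF subspace_ext_power w])
  have pair: "(\<forall>u. (\<forall>l<m. u l \<in> ext_power n r) \<longrightarrow>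
        plucker_form n m (u(i := d i, j := z j)) + plucker_form n m (u(i := z i, j := d j)) = 0) \<longleftrightarrow>
      (\<forall>R. c j * ?\<epsilon> * wedge w (d i) R + c i * wedge w (d j) R = 0)" if ij: "i < j" "j < m" for i j
  proof -
    have im: "i < m" using ij by simp
    have "wedge (d i) (z j) + wedge (z i) (d j) =
        fscale (c j * ?\<epsilon>) (wedge w (d i)) + fscale (c i) (wedge w (d j))"
      unfolding c(2)[OF im] c(2)[OF ij(2)] wedge_scale_left wedge_scale_right
        wedge_commute[OF d[OF im] w] cfun.scale_scale ..
    then show ?thesis
      using plucker_form_pair_nondegenerate[OF n ij d[OF im] z[OF ij(2)] z[OF im] d[OF ij(2)]]
      by (simp add: fun_eq_iff fscale_apply)
  qed
  have "?L \<longleftrightarrow> (\<forall>i j. i < j \<longrightarrow> j < m \<longrightarrow> (\<forall>R. c j * ?\<epsilon> * wedge w (d i) R + c i * wedge w (d j) R = 0))"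
    unfolding all_pairs_reorder by (intro iff_allI imp_cong refl pair)
  also have "\<dots> \<longleftrightarrow> (\<forall>R. \<forall>i j. i < j \<longrightarrow> j < m \<longrightarrow>
      c j * ?\<epsilon> * wedge w (d i) R + c i * wedge w (d j) R = 0)"
    by blast
  also have "\<dots> \<longleftrightarrow> (\<forall>R. (even r \<longrightarrow> wedge w (d 0) R = 0) \<and> (\<forall>i. 0 < i \<longrightarrow> i < m \<longrightarrow>
      wedge w (d i) R = (if even r then 0 else c i / c 0) * wedge w (d 0) R))"
  proof (rule iff_allI)
    fix R
    show "(\<forall>i j. i < j \<longrightarrow> j < m \<longrightarrow> c j * ?\<epsilon> * wedge w (d i) R + c i * wedge w (d j) R = 0) \<longleftrightarrow>
        (even r \<longrightarrow> wedge w (d 0) R = 0) \<and> (\<forall>i. 0 < i \<longrightarrow> i < m \<longrightarrow>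
          wedge w (d i) R = (if even r then 0 else c i / c 0) * wedge w (d 0) R)"
      by (rule pair_relations[where h = "\<lambda>i. wedge w (d i) R", OF m \<epsilon>(1), unfolded \<epsilon>(2)]) (rule c(1))
  qed
  also have "\<dots> \<longleftrightarrow> ?R"
    by (auto simp: fun_eq_iff fscale_apply)
  finally show ?thesis .
qed

text \<open>Each slot of a chart direction lies in the hyperplane of coordinate 0 at
  \<open>\<sigma> i\<close>, a complement of the line of \<open>w\<close>; this explains the
  subtracted ones. For odd \<open>r\<close> slot 0 is free and determines the others up to the
  kernel. A triangular change of coordinates then turns the tangent space into a product over the
  slots.\<close>

lemma plucker_tangent_dim:
  assumes m: "3 \<le> m" and n: "n = r * m" and w: "w \<in> ext_power n r" and ww: "wedge w w = 0"
    and chart: "in_chart m (ext_index n r) \<sigma> a (diag_point m (cfun.span {w}))"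
  shows "cfun.dim (zariski_tangent (chart_index m (ext_index n r) \<sigma>)
      (sing_ideal m (ext_index n r) (plucker_form n m) (m - 1) \<sigma>) a) =
    (cfun.dim (if even r then wedge_kernel n r w else ext_power n r) - 1) +
    (m - 1) * (cfun.dim (wedge_kernel n r w) - 1)"
proof -
  let ?B = "ext_index n r" and ?F = "plucker_form n m" and ?K = "wedge_kernel n r w"
  let ?I = "chart_index m ?B \<sigma>"
  interpret multilinear_form m ?B ?F by (rule multilinear_form_plucker)
  have \<sigma>: "\<sigma> i \<in> ?B" if "i < m" for i using in_chartD[OF chart that] .
  obtain c where c: "\<And>i. i < m \<Longrightarrow> c i \<noteq> 0" "\<And>i. i < m \<Longrightarrow> chart_vec ?B \<sigma> a i = fscale (c i) w"
    and cw: "\<And>i. i < m \<Longrightarrow> c i * w (\<sigma> i) = 1"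
    using in_chart_diag_scalars[OF chart] by metis
  have m0: "0 < m" using m by simp
  let ?d = "chart_dir ?B \<sigma>"
  \<comment> \<open>The ratio that the tangent condition prescribes between
    \<open>w \<and> d i\<close> and \<open>w \<and> d 0\<close>. It is 0 in slot 0, so that the
    change of coordinates fixes this slot.\<close>
  define \<kappa> where "\<kappa> i = (if i = 0 \<or> even r then 0 else c i / c 0)" for i
  \<comment> \<open>The projection along \<open>w\<close> to the hyperplane of coordinate 0 at
    \<open>\<sigma> i\<close>. As \<open>w \<and> w = 0\<close>, it does not affect products with
    \<open>w\<close>.\<close>
  define P where "P i x = x - fscale (c i * x (\<sigma> i)) w" for i and x :: "nat set \<Rightarrow> complex"
  define Q where "Q i = (if i = 0 \<and> odd r then ext_power n r else ?K)" for i :: nat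
  define L where "L i = {x \<in> Q i. x (\<sigma> i) = 0}" for i
  define T where "T = {v \<in> coord_space ?I. (even r \<longrightarrow> wedge w (?d v 0) = 0) \<and>
    (\<forall>i. 0 < i \<longrightarrow> i < m \<longrightarrow> wedge w (?d v i) = fscale (\<kappa> i) (wedge w (?d v 0)))}"
  define M where "M = {v \<in> coord_space ({..<m} \<times> ?B). \<forall>i\<in>{..<m}. (\<lambda>S. v (i, S)) \<in> L i}"
  have eq: "(\<forall>i j u. i < j \<longrightarrow> j < m \<longrightarrow> (\<forall>l<m. u l \<in> coord_space ?B) \<longrightarrow>
        ?F (u(i := ?d v i, j := chart_vec ?B \<sigma> a j)) + ?F (u(i := chart_vec ?B \<sigma> a i, j := ?d v j)) = 0) \<longleftrightarrow>
      (even r \<longrightarrow> wedge w (?d v 0) = 0) \<and>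
      (\<forall>i. 0 < i \<longrightarrow> i < m \<longrightarrow> wedge w (?d v i) = fscale (\<kappa> i) (wedge w (?d v 0)))" for v
  proof -
    have "?d v i \<in> ext_power n r" for i
      unfolding ext_power_def by (rule chart_dir_in_coord_space)
    moreover have "\<kappa> i = (if even r then 0 else c i / c 0)" if "0 < i" for i
      using that by (simp add: \<kappa>_def)
    ultimately show ?thesis
      using plucker_tangent_conditions[where d = "?d v" and z = "chart_vec ?B \<sigma> a", OF m n w] c
      unfolding ext_power_def by simp
  qed
  have van: "\<forall>g\<in>sing_ideal m ?B ?F (m - 1) \<sigma>. g a = 0"
    using plucker_sing_iff[OF m n w chart] ww by simp
  have "cfun.dim (zariski_tangent ?I (sing_ideal m ?B ?F (m - 1) \<sigma>) a) =
    cfun.dim {v \<in> coord_space ?I.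
      \<forall>i j u. i < j \<longrightarrow> j < m \<longrightarrow> (\<forall>l<m. u l \<in> coord_space ?B) \<longrightarrow>
        ?F (u(i := ?d v i, j := chart_vec ?B \<sigma> a j)) + ?F (u(i := chart_vec ?B \<sigma> a i, j := ?d v j)) = 0}"
    by (rule dim_zariski_tangent_pairs[OF _ van]) (rule \<sigma>)
  then have dimT: "cfun.dim (zariski_tangent ?I (sing_ideal m ?B ?F (m - 1) \<sigma>) a) = cfun.dim T"
    unfolding T_def eq .
  have K: "cfun.subspace ?K" "?K \<subseteq> coord_space ?B" "w \<in> ?K"
    using subspace_wedge_kernel self_in_wedge_kernel[OF w ww] by (auto simp: wedge_kernel_def ext_power_def)
  have Q: "cfun.subspace (Q i)" "Q i \<subseteq> coord_space ?B" "w \<in> Q i" for i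
    using K subspace_ext_power w by (auto simp: Q_def ext_power_def)
  have subL: "cfun.subspace (L i)" for i
  proof (rule cfun.subspaceI)
    show "0 \<in> L i" using cfun.subspace_0[OF Q(1)] by (simp add: L_def)
    show "x + y \<in> L i" if "x \<in> L i" "y \<in> L i" for x y
      using cfun.subspace_add[OF Q(1), of x i y] that by (simp add: L_def)
    show "fscale k x \<in> L i" if "x \<in> L i" for k x
      using cfun.subspace_scale[OF Q(1), of x i k] that by (simp add: L_def fscale_apply)
  qed
  have LB: "L i \<subseteq> coord_space ?B" for i using Q by (auto simp: L_def)
  have wP: "wedge w (P i x) = wedge w x" for i x
    by (simp add: P_def wedge_diff_right wedge_scale_right ww fun_eq_iff fscale_apply)
  have PB: "P i x \<in> coord_space ?B" if "x \<in> coord_space ?B" for i x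
    unfolding P_def using w that
    by (intro cfun.subspace_diff cfun.subspace_scale subspace_coord_space) (auto simp: ext_power_def)
  have P\<sigma>: "P i x (\<sigma> i) = 0" if "i < m" for i x
    using cw[OF that] by (simp add: P_def fscale_apply algebra_simps)
  \<comment> \<open>Independent rows become a solution of the tangent equations once the prescribed
    multiple of row 0, projected into the right hyperplane, is added. Row 0 is unchanged, so
    subtracting the same multiple is the inverse.\<close>
  define D where "D v i = (\<lambda>S. v (i, S)) + fscale (\<kappa> i) (P i (\<lambda>S. v (0, S)))"
    for i and v :: "nat \<times> nat set \<Rightarrow> complex"
  define \<Xi> where "\<Xi> v = (\<lambda>(i, S). if (i, S) \<in> ?I then D v i S else 0)"
    for v :: "nat \<times> nat set \<Rightarrow> complex"
  have linD: "D (v + v') i = D v i + D v' i" "D (fscale k v) i = fscale k (D v i)" for v v' i k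
    by (auto simp: D_def P_def fun_eq_iff fscale_apply algebra_simps)
  have lin: "Vector_Spaces.linear fscale fscale \<Xi>"
    by (rule linear_fscaleI) (auto simp: \<Xi>_def linD fun_eq_iff fscale_apply)
  have dD: "?d (\<Xi> v) i = D v i" if v: "v \<in> M" and i: "i < m" for v i
  proof
    fix S
    have row: "(\<lambda>S. v (l, S)) \<in> L l" if "l < m" for l using v that by (simp add: M_def)
    have "D v i \<in> coord_space ?B"
      unfolding D_def using row[OF i] row[OF m0] LB
      by (intro cfun.subspace_add cfun.subspace_scale subspace_coord_space PB) auto
    moreover have "D v i (\<sigma> i) = 0"
      using row[OF i] P\<sigma>[OF i] by (simp add: D_def L_def fscale_apply)
    ultimately show "?d (\<Xi> v) i S = D v i S"
      using i by (auto simp: chart_dir_def \<Xi>_def chart_index_def coord_space_def)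
  qed
  have inj: "inj_on \<Xi> M"
  proof (rule inj_onI)
    fix v v' assume v: "v \<in> M" "v' \<in> M" "\<Xi> v = \<Xi> v'"
    have DD: "D v i = D v' i" if "i < m" for i using dD[OF v(1) that] dD[OF v(2) that] v(3) by simp
    have 0: "(\<lambda>S. v (0, S)) = (\<lambda>S. v' (0, S))"
      using DD[OF m0] by (simp add: D_def \<kappa>_def)
    have rows: "(\<lambda>S. v (i, S)) = (\<lambda>S. v' (i, S))" if "i < m" for i
      using DD[OF that] 0 by (simp add: D_def)
    show "v = v'"
    proof
      fix p :: "nat \<times> nat set"
      obtain i S where p: "p = (i, S)" by (cases p)
      show "v p = v' p"
      proof (cases "i < m")
        case True
        then show ?thesis using fun_cong[OF rows[OF True], of S] p by simp
      next
        case False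
        then show ?thesis using v p by (auto simp: M_def coord_space_def)
      qed
    qed
  qed
  have "\<Xi> ` M = T"
  proof
    show "\<Xi> ` M \<subseteq> T"
    proof (rule image_subsetI)
      fix v assume v: "v \<in> M"
      have row: "(\<lambda>S. v (l, S)) \<in> L l" if "l < m" for l using v that by (simp add: M_def)
      have wD: "wedge w (?d (\<Xi> v) i) = wedge w (\<lambda>S. v (i, S)) + fscale (\<kappa> i) (wedge w (\<lambda>S. v (0, S)))"
        if "i < m" for i
        unfolding dD[OF v that] D_def by (simp only: wedge_add_right wedge_scale_right wP)
      have d0: "?d (\<Xi> v) 0 = (\<lambda>S. v (0, S))"
        unfolding dD[OF v m0] by (simp add: D_def \<kappa>_def)
      have "wedge w (\<lambda>S. v (0, S)) = 0" if "even r"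
        using row[OF m0] that by (simp add: L_def Q_def wedge_kernel_def)
      moreover have "wedge w (\<lambda>S. v (i, S)) = 0" if "0 < i" "i < m" for i
        using row[OF that(2)] that by (simp add: L_def Q_def wedge_kernel_def)
      ultimately show "\<Xi> v \<in> T"
        unfolding T_def using wD by (simp add: d0) (simp add: \<Xi>_def coord_space_def)
    qed
    show "T \<subseteq> \<Xi> ` M"
    proof
      fix v assume v: "v \<in> T"
      let ?v = "\<lambda>(i, S). if i < m then (?d v i - fscale (\<kappa> i) (P i (?d v 0))) S else 0"
      have row: "(\<lambda>S. ?v (i, S)) = ?d v i - fscale (\<kappa> i) (P i (?d v 0))" if "i < m" for i
        using that by auto
      have dB: "?d v i \<in> ext_power n r" for i
        unfolding ext_power_def by (rule chart_dir_in_coord_space)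
      have rowB: "?d v i - fscale (\<kappa> i) (P i (?d v 0)) \<in> ext_power n r" for i
        using dB unfolding ext_power_def
        by (intro cfun.subspace_diff cfun.subspace_scale subspace_coord_space PB)
      have row0: "?d v 0 - fscale (\<kappa> 0) (P 0 (?d v 0)) = ?d v 0" by (simp add: \<kappa>_def)
      have "?d v i - fscale (\<kappa> i) (P i (?d v 0)) \<in> L i" if i: "i < m" for i
      proof -
        have "(?d v i - fscale (\<kappa> i) (P i (?d v 0))) (\<sigma> i) = 0"
          using P\<sigma>[OF i] by (simp add: chart_dir_def fscale_apply)
        moreover have "?d v i - fscale (\<kappa> i) (P i (?d v 0)) \<in> Q i"
        proof (cases "i = 0")
          case True
          show ?thesis unfolding True row0
            using v dB by (simp add: T_def Q_def wedge_kernel_def)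
        next
          case False
          then have "wedge w (?d v i - fscale (\<kappa> i) (P i (?d v 0))) = 0"
            using v i by (simp only: wedge_diff_right wedge_scale_right wP) (simp add: T_def)
          then show ?thesis using rowB False by (simp add: Q_def wedge_kernel_def)
        qed
        ultimately show ?thesis by (simp add: L_def)
      qed
      moreover have "?v \<in> coord_space ({..<m} \<times> ?B)"
        using rowB by (auto simp: coord_space_def ext_power_def)
      ultimately have vM: "?v \<in> M" unfolding M_def using row by simp
      have "\<Xi> ?v = v"
      proof
        fix p :: "nat \<times> nat set"
        obtain i S where p: "p = (i, S)" by (cases p)
        show "\<Xi> ?v p = v p"
        proof (cases "p \<in> ?I")
          case True
          then have i: "i < m" "S \<in> ?B" "S \<noteq> \<sigma> i" using p by (auto simp: chart_index_def)
          have "D ?v i = ?d v i"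
            unfolding D_def row[OF i(1)] row[OF m0] row0 by simp
          then have "\<Xi> ?v (i, S) = ?d v i S" using True p by (simp add: \<Xi>_def)
          then show ?thesis using i p by (simp add: chart_dir_def)
        next
          case False
          then show ?thesis using v p by (simp add: \<Xi>_def T_def coord_space_def)
        qed
      qed
      then show "v \<in> \<Xi> ` M" using vM by (intro image_eqI[of _ _ ?v]) (rule sym)
    qed
  qed
  then have "cfun.dim T = cfun.dim M"
    using dim_linear_image_inj[OF lin _ inj] subspace_product[of "{..<m}" L ?B] subL
    by (simp add: M_def)
  also have "\<dots> = (\<Sum>i<m. cfun.dim (L i))"
    unfolding M_def by (rule dim_product) (use finite_ext_index subL LB in auto)
  also have "\<dots> = (\<Sum>i<m. cfun.dim (Q i) - 1)"
  proof (rule sum.cong[OF refl])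
    fix i assume "i \<in> {..<m}"
    then have "w (\<sigma> i) \<noteq> 0" using cw[of i] by auto
    from dim_hyperplane_section[OF finite_ext_index Q(2,1,3) this]
    show "cfun.dim (L i) = cfun.dim (Q i) - 1" by (simp add: L_def)
  qed
  also have "\<dots> = (cfun.dim (Q 0) - 1) + (\<Sum>i\<in>{1..<m}. cfun.dim (Q i) - 1)"
    using m0 by (simp add: lessThan_atLeast0 sum.atLeast_Suc_lessThan)
  also have "(\<Sum>i\<in>{1..<m}. cfun.dim (Q i) - 1) = (m - 1) * (cfun.dim ?K - 1)"
    by (simp add: Q_def)
  finally show ?thesis unfolding dimT by (simp add: Q_def)
qed

section \<open>The Grassmannian\<close>

text \<open>Multilinear expansion, carried out on one factor at a time through subspaces instead of
  indexed sums.\<close>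

lemma wedge_list_in_span_generators:
  assumes "set xs \<subseteq> cfun.span G"
  shows "wedge_list xs \<in> cfun.span {wedge_list gs |gs. length gs = length xs \<and> set gs \<subseteq> G}"
  using assms
proof (induction xs)
  case Nil
  then show ?case by (intro cfun.span_base) auto
next
  case (Cons x xs)
  let ?A = "{wedge_list gs |gs. length gs = length xs \<and> set gs \<subseteq> G}"
  let ?V = "cfun.span {wedge_list gs |gs. length gs = length (x # xs) \<and> set gs \<subseteq> G}"
  have left: "wedge g y \<in> ?V" if g: "g \<in> G" and y: "y \<in> cfun.span ?A" for g y
  proof -
    have "cfun.span ?A \<subseteq> {y. wedge g y \<in> ?V}"
    proof (rule cfun.span_minimal)
      show "cfun.subspace {y. wedge g y \<in> ?V}"
        by (rule cfun.subspaceI)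
          (simp_all only: mem_Collect_eq wedge_zero_right wedge_add_right wedge_scale_right
            cfun.span_zero cfun.span_add cfun.span_scale)
      show "?A \<subseteq> {y. wedge g y \<in> ?V}"
      proof clarify
        fix gs assume gs: "length gs = length xs" "set gs \<subseteq> G"
        have "wedge_list (g # gs) \<in> ?V"
          by (intro cfun.span_base CollectI exI[of _ "g # gs"]) (use gs g in simp)
        then show "wedge g (wedge_list gs) \<in> ?V" by simp
      qed
    qed
    then show ?thesis using y by blast
  qed
  have y: "wedge_list xs \<in> cfun.span ?A" using Cons by simp
  have "cfun.span G \<subseteq> {g. wedge g (wedge_list xs) \<in> ?V}"
  proof (rule cfun.span_minimal)
    show "cfun.subspace {g. wedge g (wedge_list xs) \<in> ?V}"
      by (rule cfun.subspaceI)
        (simp_all only: mem_Collect_eq wedge_zero_left wedge_add_left wedge_scale_left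
          cfun.span_zero cfun.span_add cfun.span_scale)
    show "G \<subseteq> {g. wedge g (wedge_list xs) \<in> ?V}" using left y by blast
  qed
  then show ?case using Cons.prems by auto
qed

text \<open>After expansion each term is a product of members of the family. With a repetition it is
  zero; otherwise every member occurs and annihilates it, so it is a multiple of the fixed product.
  No permutation signs are tracked.\<close>

lemma wedge_list_in_line:
  assumes ech: "echelon n (set ss) f" and ss: "distinct ss" "length ss = r"
    and xs: "length xs = r" "set xs \<subseteq> cfun.span (f ` set ss)"
  shows "wedge_list xs \<in> cfun.span {wedge_list (map f ss)}"
proof -
  have f1: "f ` set ss \<subseteq> ext_power n 1" using ech by (auto simp: echelon_def)
  have inj: "inj_on f (set ss)"
    using ech by (intro inj_onI) (metis echelon_def one_neq_zero)
  have "{wedge_list gs |gs. length gs = length xs \<and> set gs \<subseteq> f ` set ss} \<subseteq>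
      cfun.span {wedge_list (map f ss)}"
  proof clarify
    fix gs assume gs: "length gs = length xs" "set gs \<subseteq> f ` set ss"
    have gs1: "set gs \<subseteq> ext_power n 1" using gs f1 by auto
    show "wedge_list gs \<in> cfun.span {wedge_list (map f ss)}"
    proof (cases "distinct gs")
      case True
      have "card (set gs) = card (f ` set ss)"
        using True gs xs ss card_image[OF inj] by (simp add: distinct_card)
      then have "set gs = f ` set ss" using gs(2) by (intro card_subset_eq) auto
      then have 0: "wedge (wedge_list gs) (f s) = 0" if "s \<in> set ss" for s
        using wedge_list_vector_member[OF gs1] that by blast
      have "wedge_list gs \<in> ext_power n r"
        using wedge_list_in_ext_power[OF gs1] gs xs by simp
      from decomposable_eq_scale_wedge_list[OF ech ss this 0]
      show ?thesis using cfun.span_scale[OF cfun.span_base[of _ "{wedge_list (map f ss)}"]]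
        by (metis singletonI)
    next
      case False
      then show ?thesis using wedge_list_not_distinct[OF gs1] cfun.span_zero by metis
    qed
  qed
  then have "cfun.span {wedge_list gs |gs. length gs = length xs \<and> set gs \<subseteq> f ` set ss} \<subseteq>
      cfun.span {wedge_list (map f ss)}"
    by (rule cfun.span_minimal[OF _ cfun.subspace_span])
  then show ?thesis using wedge_list_in_span_generators[OF xs(2)] by blast
qed

section \<open>From the abstract vector space to coordinates\<close>

locale based_space = vector_space scal
  for scal :: "complex \<Rightarrow> 'v::ab_group_add \<Rightarrow> 'v" +
  fixes b :: "'v list"
  assumes basis: "ordered_basis scal b"
begin

lemma basis_list: "distinct b" "independent (set b)" "span (set b) = UNIV"
  using basis by (auto simp: ordered_basis_def)

sublocale finite_dimensional_vector_space scal "set b"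
  by unfold_locales (use basis_list in auto)

lemma dim_eq_length: "dim (UNIV :: 'v set) = length b"
  using dim_eq_card[of "set b" UNIV] basis_list by (simp add: distinct_card)

lemma ext_vec_nth:
  assumes "i < length b" shows "ext_vec scal b v {i} = representation (set b) v (b ! i)"
proof -
  have "ext_vec scal b v {i} = (\<Sum>j<length b. if j = i then representation (set b) v (b ! i) else 0)"
    unfolding ext_vec_def by (intro sum.cong) auto
  then show ?thesis using assms by simp
qed

lemma ext_vec_outside: "\<not> (\<exists>i<length b. S = {i}) \<Longrightarrow> ext_vec scal b v S = 0"
  unfolding ext_vec_def by (intro sum.neutral) auto

lemma ext_vec_in_ext_power: "ext_vec scal b v \<in> ext_power (length b) 1"
proof (rule ext_powerI)
  fix S assume "ext_vec scal b v S \<noteq> 0"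
  then obtain i where "i < length b" "S = {i}" using ext_vec_outside by blast
  then show "S \<subseteq> {..<length b} \<and> card S = 1" by simp
qed

lemma ext_vec_linear: "Vector_Spaces.linear scal fscale (ext_vec scal b)"
proof unfold_locales
  show "ext_vec scal b (x + y) = ext_vec scal b x + ext_vec scal b y" for x y
    using basis_list by (auto simp: ext_vec_def fun_eq_iff representation_add sum.distrib[symmetric]
      intro!: sum.cong)
  show "ext_vec scal b (scal c x) = fscale c (ext_vec scal b x)" for c x
    using basis_list by (auto simp: ext_vec_def fun_eq_iff fscale_apply representation_scale
      sum_distrib_left intro!: sum.cong)
qed

lemma ext_vec_basis:
  assumes "i < length b" shows "ext_vec scal b (b ! i) = basis_fun {i}"
proof
  fix S
  have rep: "representation (set b) (b ! i) = (\<lambda>v. if v = b ! i then 1 else 0)"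
    using assms basis_list by (intro representation_basis) auto
  show "ext_vec scal b (b ! i) S = basis_fun {i} S"
  proof (cases "\<exists>j<length b. S = {j}")
    case True
    then obtain j where j: "j < length b" "S = {j}" by blast
    then show ?thesis
      using ext_vec_nth[OF j(1), of "b ! i"] rep assms basis_list(1)
      by (auto simp: basis_fun_def nth_eq_iff_index_eq)
  next
    case False
    then have "S \<noteq> {i}" using assms by auto
    then show ?thesis using ext_vec_outside[OF False] by (simp add: basis_fun_def)
  qed
qed

lemma ext_vec_surj:
  assumes "f \<in> ext_power (length b) 1" obtains v where "ext_vec scal b v = f"
proof -
  interpret lin: Vector_Spaces.linear scal fscale "ext_vec scal b" by (rule ext_vec_linear)
  have "f \<in> range (ext_vec scal b)"
  proof (rule in_subspace_if_basis[OF finite_ext_index])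
    show "f \<in> coord_space (ext_index (length b) 1)" using assms by (simp add: ext_power_def)
    show "cfun.subspace (range (ext_vec scal b))"
      by (rule lin.subspace_image) simp
    fix S assume "S \<in> ext_index (length b) 1"
    then obtain i where "i < length b" "S = {i}"
      by (auto simp: ext_index_def card_1_singleton_iff)
    then show "basis_fun S \<in> range (ext_vec scal b)" using ext_vec_basis by (metis rangeI)
  qed
  then show ?thesis using that by blast
qed

text \<open>Evaluating a linear relation at the singleton of a pivot isolates one
  coefficient.\<close>

lemma echelon_independent:
  assumes ech: "echelon (length b) S (\<lambda>s. ext_vec scal b (u s))"
  shows "independent (u ` S)" "card (u ` S) = card S"
proof -
  interpret lin: Vector_Spaces.linear scal fscale "ext_vec scal b" by (rule ext_vec_linear)
  have fin: "finite S" using ech by (auto simp: echelon_def intro: finite_subset)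
  have u: "ext_vec scal b (u s) {t} = (if s = t then 1 else 0)" if "s \<in> S" "t \<in> S" for s t
    using ech that by (simp add: echelon_def)
  have inj: "inj_on u S" by (intro inj_onI) (metis u one_neq_zero)
  then show "card (u ` S) = card S" by (rule card_image)
  show "independent (u ` S)"
  proof (subst dependent_finite)
    show "finite (u ` S)" using fin by simp
    show "\<not> (\<exists>k. (\<exists>v\<in>u ` S. k v \<noteq> 0) \<and> (\<Sum>v\<in>u ` S. scal (k v) v) = 0)"
    proof clarify
      fix k t assume z: "(\<Sum>v\<in>u ` S. scal (k v) v) = 0" and t: "t \<in> S" "k (u t) \<noteq> 0"
      have "(\<Sum>s\<in>S. scal (k (u s)) (u s)) = 0" using z by (simp add: sum.reindex[OF inj])
      then have "ext_vec scal b (\<Sum>s\<in>S. scal (k (u s)) (u s)) {t} = 0"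
        by (simp only: lin.zero zero_fun_apply)
      then have "(\<Sum>s\<in>S. k (u s) * ext_vec scal b (u s) {t}) = 0"
        by (simp add: lin.sum lin.scale sum_fun_apply fscale_apply)
      also have "(\<Sum>s\<in>S. k (u s) * ext_vec scal b (u s) {t}) = (\<Sum>s\<in>S. if s = t then k (u t) else 0)"
        using u t by (intro sum.cong) auto
      finally show False using t fin by simp
    qed
  qed
qed

lemma plucker_span:
  assumes ech: "echelon (length b) (set ss) (\<lambda>s. ext_vec scal b (u s))"
    and ss: "distinct ss" "length ss = r"
  shows "plucker scal b r (span (u ` set ss)) =
    cfun.span {wedge_list (map (\<lambda>s. ext_vec scal b (u s)) ss)}"
proof
  interpret lin: Vector_Spaces.linear scal fscale "ext_vec scal b" by (rule ext_vec_linear)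
  let ?f = "\<lambda>s. ext_vec scal b (u s)"
  have "wedge_list (map (ext_vec scal b) us) \<in> cfun.span {wedge_list (map ?f ss)}"
    if "length us = r" "set us \<subseteq> span (u ` set ss)" for us
  proof (rule wedge_list_in_line[OF ech ss])
    have "ext_vec scal b ` span (u ` set ss) = cfun.span (?f ` set ss)"
      by (simp add: lin.span_image[symmetric] image_image)
    then show "set (map (ext_vec scal b) us) \<subseteq> cfun.span (?f ` set ss)" using that by auto
  qed (use that in simp)
  then show "plucker scal b r (span (u ` set ss)) \<subseteq> cfun.span {wedge_list (map ?f ss)}"
    unfolding plucker_def by (intro cfun.span_minimal cfun.subspace_span) blast
  have "map (ext_vec scal b) (map u ss) = map ?f ss" by simp
  moreover have "length (map u ss) = r \<and> set (map u ss) \<subseteq> span (u ` set ss)"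
    using ss by (auto intro: span_base)
  ultimately have "wedge_list (map ?f ss) \<in> plucker scal b r (span (u ` set ss))"
    unfolding plucker_def by (intro cfun.span_base) (metis (mono_tags, lifting) mem_Collect_eq)
  then show "cfun.span {wedge_list (map ?f ss)} \<subseteq> plucker scal b r (span (u ` set ss))"
    unfolding plucker_def by (intro cfun.span_minimal cfun.subspace_span) simp
qed

lemma subspace_echelon_basis:
  assumes U: "subspace U" "dim U = r"
  obtains ss u where "distinct ss" "length ss = r"
    "echelon (length b) (set ss) (\<lambda>s. ext_vec scal b (u s))" "U = span (u ` set ss)"
proof -
  interpret lin: Vector_Spaces.linear scal fscale "ext_vec scal b" by (rule ext_vec_linear)
  obtain A where A: "A \<subseteq> U" "independent A" "U \<subseteq> span A" "card A = dim U"
    by (rule basis_exists)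
  have spA: "span A = U" using A U by (simp add: span_minimal subset_antisym)
  obtain D where D: "A \<subseteq> D" "D \<subseteq> A \<union> set b" "independent D" "A \<union> set b \<subseteq> span D"
    using maximal_independent_subset_extend[OF _ A(2), of "A \<union> set b"] by auto
  have "span (set b) \<subseteq> span D" using D(4) by (intro span_minimal subspace_span) simp
  then have "span D = UNIV" unfolding basis_list(3) by (rule top.extremum_uniqueI)
  then have cardD: "card D = length b"
    using dim_eq_card[of D UNIV] D(3) dim_eq_length by simp
  have finD: "finite D" using D(3) by (rule finiteI_independent)
  let ?C = "D - A"
  have C: "?C \<subseteq> set b" using D by auto
  have finA: "finite A" using finD D(1) by (rule finite_subset[rotated])
  have cardC: "card ?C = length b - r"
    using card_Diff_subset[OF finA D(1)] cardD A U by simp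
  let ?S = "{i. i < length b \<and> b ! i \<notin> ?C}"
  have "bij_betw ((!) b) {..<length b} (set b)"
    using basis_list(1) by (rule bij_betw_nth) auto
  then have "(!) b ` ?S = set b - ?C" and "inj_on ((!) b) ?S"
    by (auto simp: bij_betw_def intro: inj_on_subset)
  then have "card ?S = card (set b - ?C)" using card_image[of "(!) b" ?S] by (simp only:)
  also have "\<dots> = length b - card ?C"
    using C finD basis_list(1) by (simp add: card_Diff_subset distinct_card)
  also have "\<dots> = r"
    using cardC card_mono[OF finD D(1)] cardD A U by simp
  finally have cardS: "card ?S = r" .
  have "finite ?S" by simp
  then obtain ss where ss: "set ss = ?S" "distinct ss" by (metis finite_distinct_list)
  have "\<exists>x c. b ! s = x + c \<and> x \<in> U \<and> c \<in> span ?C" for s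
  proof -
    have "b ! s \<in> span (A \<union> ?C)" using \<open>span D = UNIV\<close> D(1) by (simp add: Un_absorb1)
    then show ?thesis using spA unfolding span_Un by auto
  qed
  then obtain u c where uc: "\<And>s. b ! s = u s + c s" "\<And>s. u s \<in> U" "\<And>s. c s \<in> span ?C" by metis
  \<comment> \<open>The span of \<open>?C\<close> involves no pivot position, so the projection
    leaves the pivot coordinates of \<open>b ! s\<close> unchanged.\<close>
  have c0: "ext_vec scal b (c s) {t} = 0" if t: "t \<in> ?S" for s t
  proof -
    have "subspace {v. ext_vec scal b v {t} = 0}"
      by (intro subspaceI) (auto simp: lin.zero lin.add lin.scale fscale_apply)
    moreover have "?C \<subseteq> {v. ext_vec scal b v {t} = 0}"
    proof
      fix v assume v: "v \<in> ?C"
      then obtain i where i: "i < length b" "v = b ! i" using C by (metis in_set_conv_nth subsetD)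
      then have "i \<noteq> t" using t v by auto
      then show "v \<in> {v. ext_vec scal b v {t} = 0}" using i by (simp add: ext_vec_basis basis_fun_def)
    qed
    ultimately have "span ?C \<subseteq> {v. ext_vec scal b v {t} = 0}" by (rule span_minimal[rotated])
    then show ?thesis using uc(3) by blast
  qed
  have ech: "echelon (length b) (set ss) (\<lambda>s. ext_vec scal b (u s))"
    unfolding echelon_def ss(1)
  proof (intro conjI ballI)
    show "?S \<subseteq> {..<length b}" by auto
    show "ext_vec scal b (u s) \<in> ext_power (length b) 1" for s by (rule ext_vec_in_ext_power)
    fix s t assume st: "s \<in> ?S" "t \<in> ?S"
    have "ext_vec scal b (b ! s) {t} = ext_vec scal b (u s) {t} + ext_vec scal b (c s) {t}"
      using uc(1)[of s] lin.add by (metis plus_fun_apply)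
    then have "ext_vec scal b (u s) {t} = basis_fun {s} {t}"
      using st c0[OF st(2)] by (simp add: ext_vec_basis)
    then show "ext_vec scal b (u s) {t} = (if s = t then 1 else 0)"
      by (auto simp: basis_fun_def)
  qed
  have "U = span (u ` set ss)"
  proof
    show "span (u ` set ss) \<subseteq> U" using uc(2) U by (intro span_minimal) auto
    have "card (u ` set ss) = dim U"
      using echelon_independent(2)[OF ech] cardS ss U by simp
    then show "U \<subseteq> span (u ` set ss)"
      using card_eq_dim[of "u ` set ss" U] echelon_independent(1)[OF ech] uc(2) by auto
  qed
  moreover have "length ss = r" using ss cardS by (metis distinct_card)
  ultimately show ?thesis using that ss(2) ech by blast
qed

text \<open>An echelon basis of a subspace provides the product; conversely the annihilating vectors
  of a decomposable multivector lift to vectors that span the subspace.\<close>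

lemma plucker_image:
  assumes n: "length b = n"
  shows "plucker scal b r ` grassmannian scal r =
    {cfun.span {w} |w. w \<in> ext_power n r \<and> w \<noteq> 0 \<and> decomposable n r w}" (is "?L = ?R")
proof
  show "?L \<subseteq> ?R"
  proof
    fix x assume "x \<in> ?L"
    then obtain U where U: "subspace U" "dim U = r" "x = plucker scal b r U"
      by (auto simp: grassmannian_def)
    obtain ss u where ss: "distinct ss" "length ss = r"
      and ech: "echelon n (set ss) (\<lambda>s. ext_vec scal b (u s))" and Uu: "U = span (u ` set ss)"
      using subspace_echelon_basis[OF U(1,2)] unfolding n .
    let ?y = "wedge_list (map (\<lambda>s. ext_vec scal b (u s)) ss)"
    have "x = cfun.span {?y}" using plucker_span[of ss u r] ech ss U(3) Uu n by simp
    moreover have "?y \<noteq> 0" using wedge_list_echelon_nonzero[OF ech ss(1)] by (metis order_refl zero_fun_apply)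
    moreover have "?y \<in> ext_power n r"
      using wedge_list_in_ext_power[of "map (\<lambda>s. ext_vec scal b (u s)) ss" n 1] ech ss(2)
      by (auto simp: echelon_def)
    moreover have "decomposable n r ?y" by (rule decomposable_wedge_list[OF ech ss])
    ultimately show "x \<in> ?R" by blast
  qed
  show "?R \<subseteq> ?L"
  proof clarify
    fix w assume w: "w \<in> ext_power n r" "w \<noteq> 0" "decomposable n r w"
    obtain ss f c where ech: "echelon n (set ss) f" and ss: "distinct ss" "length ss = r"
      and "\<forall>s\<in>set ss. wedge w (f s) = 0" and wc: "w = fscale c (wedge_list (map f ss))"
      using decomposableE[OF w(3,1)] .
    have "\<exists>v. s \<in> set ss \<longrightarrow> ext_vec scal b v = f s" for s
      using ech n ext_vec_surj unfolding echelon_def by metis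
    then obtain u where u: "\<And>s. s \<in> set ss \<Longrightarrow> ext_vec scal b (u s) = f s" by metis
    have ech': "echelon (length b) (set ss) (\<lambda>s. ext_vec scal b (u s))"
      using ech u n by (simp add: echelon_def)
    have "c \<noteq> 0" using wc w(2) by auto
    have "map (\<lambda>s. ext_vec scal b (u s)) ss = map f ss" using u by simp
    then have "plucker scal b r (span (u ` set ss)) = cfun.span {w}"
      using plucker_span[OF ech' ss] span_fscale[OF \<open>c \<noteq> 0\<close>] wc by metis
    moreover have "span (u ` set ss) \<in> grassmannian scal r"
      using echelon_independent[OF ech'] ss
      by (simp add: grassmannian_def dim_span_eq_card_independent dim_eq_card_independent distinct_card)
    ultimately show "cfun.span {w} \<in> ?L" by blast
  qed
qed

end

section \<open>Diagonal points of the singular locus\<close>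

lemma proj_space_ext_power:
  "x \<in> proj_space (ext_power n r) \<longleftrightarrow> (\<exists>w. w \<in> ext_power n r \<and> w \<noteq> 0 \<and> x = cfun.span {w})"
proof
  assume "x \<in> proj_space (ext_power n r)"
  then have x: "x \<subseteq> ext_power n r" "cfun.subspace x" "cfun.dim x = 1" by (auto simp: proj_space_def)
  obtain A where A: "A \<subseteq> x" "cfun.independent A" "x \<subseteq> cfun.span A" "card A = cfun.dim x"
    by (rule cfun.basis_exists)
  obtain w where w: "A = {w}" using A(4) x(3) by (metis card_1_singletonE)
  have "w \<noteq> 0" using A(2) w cfun.dependent_zero by blast
  moreover have "x = cfun.span {w}" using A x w by (simp add: cfun.span_minimal subset_antisym)
  ultimately show "\<exists>w. w \<in> ext_power n r \<and> w \<noteq> 0 \<and> x = cfun.span {w}" using A x w by auto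
next
  assume "\<exists>w. w \<in> ext_power n r \<and> w \<noteq> 0 \<and> x = cfun.span {w}"
  then obtain w where w: "w \<in> ext_power n r" "w \<noteq> 0" "x = cfun.span {w}" by blast
  have "cfun.independent {w}" using w(2) by simp
  then have "cfun.dim x = card {w}" using w(3) by (intro dim_eq_card_basis) auto
  moreover have "x \<subseteq> ext_power n r" unfolding w(3) using w(1) by (intro cfun.span_minimal subspace_ext_power) auto
  ultimately show "x \<in> proj_space (ext_power n r)" using w(3) by (simp add: proj_space_def)
qed

lemma diag_point_in_Sing_iff:
  assumes m: "3 \<le> m" and n: "n = r * m" and w: "w \<in> ext_power n r" "w \<noteq> 0"
  shows "diag_point m (cfun.span {w}) \<in> Sing m (ext_index n r) (plucker_form n m) (m - 1) \<longleftrightarrow>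
    wedge w w = 0"
proof -
  have "cfun.span {w} \<in> proj_space (ext_power n r)" using w by (auto simp: proj_space_ext_power)
  then have multi: "diag_point m (cfun.span {w}) \<in> multi_proj m (ext_index n r)"
    by (auto simp: diag_point_def multi_proj_def ext_power_def)
  obtain S where S: "S \<in> ext_index n r" "w S \<noteq> 0" using nonzero_coeff[OF w] .
  obtain \<sigma> a where "in_chart m (ext_index n r) \<sigma> a (diag_point m (cfun.span {w}))"
    by (rule exists_chart[OF w(1)[unfolded ext_power_def] S(1) S(2)])
  then show ?thesis
    using plucker_sing_iff[OF m n w(1)] multi unfolding Sing_def by blast
qed

text \<open>The definite description is legitimate: some chart exists, and all charts give the same
  expression in \<open>w\<close>.\<close>

lemma sing_tangent_dim_diag:
  assumes m: "3 \<le> m" and n: "n = r * m" and w: "w \<in> ext_power n r" "w \<noteq> 0" and ww: "wedge w w = 0"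
  shows "sing_tangent_dim m (ext_index n r) (plucker_form n m) (m - 1) (diag_point m (cfun.span {w})) =
    (cfun.dim (if even r then wedge_kernel n r w else ext_power n r) - 1) +
    (m - 1) * (cfun.dim (wedge_kernel n r w) - 1)"
proof -
  obtain S where S: "S \<in> ext_index n r" "w S \<noteq> 0" using nonzero_coeff[OF w] .
  obtain \<sigma> a where chart: "in_chart m (ext_index n r) \<sigma> a (diag_point m (cfun.span {w}))"
    by (rule exists_chart[OF w(1)[unfolded ext_power_def] S(1) S(2)])
  note dim = plucker_tangent_dim[OF m n w(1) ww]
  show ?thesis
    unfolding sing_tangent_dim_def
  proof (rule the_equality)
    show "\<exists>\<sigma> a. in_chart m (ext_index n r) \<sigma> a (diag_point m (cfun.span {w})) \<and>
        (cfun.dim (if even r then wedge_kernel n r w else ext_power n r) - 1) +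
        (m - 1) * (cfun.dim (wedge_kernel n r w) - 1) =
        cfun.dim (zariski_tangent (chart_index m (ext_index n r) \<sigma>)
          (sing_ideal m (ext_index n r) (plucker_form n m) (m - 1) \<sigma>) a)"
      by (intro exI conjI, rule chart, rule dim[OF chart, symmetric])
  qed (elim exE conjE, simp only: dim)
qed

text \<open>Provides a reference point at which the bound on the kernel dimension is
  attained.\<close>

lemma exists_decomposable:
  assumes "r \<le> n" obtains w where "w \<in> ext_power n r" "w \<noteq> 0" "decomposable n r w"
proof
  let ?f = "\<lambda>s. basis_fun {s}" and ?ss = "[0..<r]"
  have ech: "echelon n (set ?ss) ?f"
    using assms by (auto simp: echelon_def basis_fun_def intro!: ext_powerI split: if_splits)
  show "wedge_list (map ?f ?ss) \<in> ext_power n r"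
    using wedge_list_in_ext_power[of "map ?f ?ss" n 1] ech by (auto simp: echelon_def)
  show "wedge_list (map ?f ?ss) \<noteq> 0"
    using wedge_list_echelon_nonzero[OF ech] by (metis distinct_upt order_refl zero_fun_apply)
  show "decomposable n r (wedge_list (map ?f ?ss))"
    by (rule decomposable_wedge_list[OF ech]) auto
qed

theorem theorem3p1:
  fixes scal :: "complex \<Rightarrow> 'v::ab_group_add \<Rightarrow> 'v"
    and b :: "'v list" and r m :: nat
  assumes "r \<ge> 1" and "m \<ge> 3"
    and "vector_space scal" and "vector_space.dim scal (UNIV :: 'v set) = r * m"
    and "ordered_basis scal b"
  shows "plucker scal b r ` grassmannian scal r =
    {x \<in> proj_space (ext_power (r * m) r).
       diag_point m x \<in> Sing m (ext_index (r * m) r) (plucker_form (r * m) m) (m - 1) \<and>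
       (\<forall>y \<in> proj_space (ext_power (r * m) r).
          diag_point m y \<in> Sing m (ext_index (r * m) r) (plucker_form (r * m) m) (m - 1) \<longrightarrow>
          sing_tangent_dim m (ext_index (r * m) r) (plucker_form (r * m) m) (m - 1)
              (diag_point m y)
            \<le> sing_tangent_dim m (ext_index (r * m) r) (plucker_form (r * m) m) (m - 1)
                (diag_point m x))}" (is "_ = ?R")
proof -
  interpret based_space scal b
    using assms(3,5) by (intro based_space.intro based_space_axioms.intro)
  define n where "n = r * m"
  have lb: "length b = n" using dim_eq_length assms(4) by (simp add: n_def)
  let ?K = "\<lambda>w. cfun.dim (wedge_kernel n r w)"
  let ?max = "(n choose r) - ((n - r) choose r)"
  let ?sing = "\<lambda>x. diag_point m x \<in> Sing m (ext_index n r) (plucker_form n m) (m - 1)"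
  let ?t = "\<lambda>x. sing_tangent_dim m (ext_index n r) (plucker_form n m) (m - 1) (diag_point m x)"
  have n3: "3 * r \<le> n" using assms(1,2) by (simp add: n_def)
  have sing: "?sing (cfun.span {w}) \<longleftrightarrow> wedge w w = 0" if "w \<in> ext_power n r" "w \<noteq> 0" for w
    using diag_point_in_Sing_iff[OF assms(2) n_def that] .
  \<comment> \<open>The kernel contains \<open>w\<close>. Without this, truncated subtraction of 1
    could identify two kernel dimensions.\<close>
  have Kpos: "1 \<le> ?K w" if w: "w \<in> ext_power n r" "w \<noteq> 0" "wedge w w = 0" for w
  proof -
    obtain S where S: "S \<in> ext_index n r" "w S \<noteq> 0" using nonzero_coeff[OF w(1,2)] .
    have "wedge_kernel n r w \<subseteq> coord_space (ext_index n r)"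
      by (auto simp: wedge_kernel_def ext_power_def)
    from dim_hyperplane_section[OF finite_ext_index this subspace_wedge_kernel
        self_in_wedge_kernel[OF w(1,3)] S(2)]
    show ?thesis by simp
  qed
  have mono: "?t (cfun.span {w}) \<le> ?t (cfun.span {w'}) \<longleftrightarrow> ?K w \<le> ?K w'"
    if w: "w \<in> ext_power n r" "w \<noteq> 0" "wedge w w = 0"
      and w': "w' \<in> ext_power n r" "w' \<noteq> 0" "wedge w' w' = 0" for w w'
  proof -
    \<comment> \<open>The tangent dimension as a function of the kernel dimension; for either parity
      the summand with the positive factor \<open>m - 1\<close> makes it strictly
      increasing.\<close>
    let ?g = "\<lambda>k. ((if even r then k else cfun.dim (ext_power n r)) - 1) + (m - 1) * (k - 1)"
    have t: "?t (cfun.span {w}) = ?g (?K w)" "?t (cfun.span {w'}) = ?g (?K w')"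
      using sing_tangent_dim_diag[OF assms(2) n_def w] sing_tangent_dim_diag[OF assms(2) n_def w']
      by auto
    have le: "?g k \<le> ?g l" if "k \<le> l" for k l :: nat
      using that by (intro add_mono mult_le_mono2 diff_le_mono) auto
    have less: "?g k < ?g l" if "k < l" "1 \<le> k" for k l :: nat
    proof -
      have "(m - 1) * (k - 1) < (m - 1) * (l - 1)" using that assms(2) by simp
      then show ?thesis using that by (intro add_le_less_mono diff_le_mono) auto
    qed
    show ?thesis
      unfolding t using le[of "?K w" "?K w'"] less[of "?K w'" "?K w"] Kpos[OF w'] by force
  qed
  have "r \<le> n" using n3 by simp
  then obtain w0 where w0: "w0 \<in> ext_power n r" "w0 \<noteq> 0" "decomposable n r w0"
    by (rule exists_decomposable)
  have w00: "wedge w0 w0 = 0" by (rule wedge_self_decomposable[OF w0(3,1) assms(1)])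
  have char: "(wedge w w = 0 \<and> (\<forall>y\<in>proj_space (ext_power n r). ?sing y \<longrightarrow> ?t y \<le> ?t (cfun.span {w}))) \<longleftrightarrow>
      decomposable n r w" if w: "w \<in> ext_power n r" "w \<noteq> 0" for w
  proof
    assume *: "wedge w w = 0 \<and> (\<forall>y\<in>proj_space (ext_power n r). ?sing y \<longrightarrow> ?t y \<le> ?t (cfun.span {w}))"
    \<comment> \<open>Comparison with the reference point \<open>w0\<close> pushes the kernel
      dimension of \<open>w\<close> up to its bound.\<close>
    have "cfun.span {w0} \<in> proj_space (ext_power n r)" using w0 by (auto simp: proj_space_ext_power)
    then have "?t (cfun.span {w0}) \<le> ?t (cfun.span {w})" using * sing[OF w0(1,2)] w00 by blast
    then have "?K w0 \<le> ?K w" using mono[OF w0(1,2) w00 w] * by blast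
    then have "?K w = ?max"
      using dim_wedge_kernel_decomposable[OF w0 assms(1)] dim_wedge_kernel_le[OF w] by simp
    then show "decomposable n r w" by (rule decomposable_if_dim_wedge_kernel[OF w n3 assms(1)])
  next
    assume dec: "decomposable n r w"
    have ww: "wedge w w = 0" by (rule wedge_self_decomposable[OF dec w(1) assms(1)])
    have "?t y \<le> ?t (cfun.span {w})" if y: "y \<in> proj_space (ext_power n r)" "?sing y" for y
    proof -
      obtain w' where w': "w' \<in> ext_power n r" "w' \<noteq> 0" "y = cfun.span {w'}"
        using y(1) by (auto simp: proj_space_ext_power)
      have w'w': "wedge w' w' = 0" using sing[OF w'(1,2)] y(2) w'(3) by simp
      have "?K w' \<le> ?K w"
        using dim_wedge_kernel_le[OF w'(1,2)] dim_wedge_kernel_decomposable[OF w dec assms(1)] by simp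
      then show ?thesis using mono[OF w'(1,2) w'w' w ww] w'(3) by simp
    qed
    then show "wedge w w = 0 \<and> (\<forall>y\<in>proj_space (ext_power n r). ?sing y \<longrightarrow> ?t y \<le> ?t (cfun.span {w}))"
      using ww by blast
  qed
  have "?R = {cfun.span {w} |w. w \<in> ext_power n r \<and> w \<noteq> 0 \<and> decomposable n r w}"
  proof (rule set_eqI)
    fix x
    have "x \<in> ?R \<longleftrightarrow> x \<in> proj_space (ext_power n r) \<and> ?sing x \<and>
        (\<forall>y\<in>proj_space (ext_power n r). ?sing y \<longrightarrow> ?t y \<le> ?t x)"
      unfolding n_def by simp
    also have "\<dots> \<longleftrightarrow> (\<exists>w. w \<in> ext_power n r \<and> w \<noteq> 0 \<and> x = cfun.span {w} \<and> decomposable n r w)"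
    proof
      assume *: "x \<in> proj_space (ext_power n r) \<and> ?sing x \<and>
        (\<forall>y\<in>proj_space (ext_power n r). ?sing y \<longrightarrow> ?t y \<le> ?t x)"
      then obtain w where w: "w \<in> ext_power n r" "w \<noteq> 0" and x: "x = cfun.span {w}"
        unfolding proj_space_ext_power by blast
      have "decomposable n r w" using * unfolding x sing[OF w] char[OF w, symmetric] by blast
      then show "\<exists>w. w \<in> ext_power n r \<and> w \<noteq> 0 \<and> x = cfun.span {w} \<and> decomposable n r w"
        using w x by blast
    next
      assume "\<exists>w. w \<in> ext_power n r \<and> w \<noteq> 0 \<and> x = cfun.span {w} \<and> decomposable n r w"
      then obtain w where w: "w \<in> ext_power n r" "w \<noteq> 0" and x: "x = cfun.span {w}"
        and dec: "decomposable n r w" by blast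
      have "x \<in> proj_space (ext_power n r)" unfolding proj_space_ext_power using w x by blast
      moreover have "?sing x" "\<forall>y\<in>proj_space (ext_power n r). ?sing y \<longrightarrow> ?t y \<le> ?t x"
        using dec unfolding x sing[OF w] char[OF w, symmetric] by blast+
      ultimately show "x \<in> proj_space (ext_power n r) \<and> ?sing x \<and>
        (\<forall>y\<in>proj_space (ext_power n r). ?sing y \<longrightarrow> ?t y \<le> ?t x)" by blast
    qed
    finally show "x \<in> ?R \<longleftrightarrow>
        x \<in> {cfun.span {w} |w. w \<in> ext_power n r \<and> w \<noteq> 0 \<and> decomposable n r w}" by blast
  qed
  then show ?thesis using plucker_image[OF lb, of r] by simp
qed

end
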